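(* Let $A=K[[x,y,z]]/I$ be a local ring of type $(2,2)$ and multiplicity $e$. If the Hilbert function of $A$ has a flat in position $n$, then $e\le 2n$.
   Context: $K$ is an algebraically closed field of characteristic zero, $R=K[[x,y,z]]$ with maximal ideal $\mathcal M=(x,y,z)$, $P=K[x,y,z]$. For nonzero $f\in R$, $\operatorname{order}(f)$ is the least degree $v$ of a monomial appearing in $f$, and $f^*\in P$ is the homogeneous component of degree $v$ of $f$ (its initial form). $A=R/I$ is of type $(2,2)$ if $I$ is generated by a regular sequence $\{f,g\}$ with $\operatorname{order}(f)=\operatorname{order}(g)=2$ and $g^*\notin(f^* )$. For $A=R/I$ with maximal ideal $\mathfrak m=\mathcal M/I$, the Hilbert function is $HF_A(t)=\dim_K(\mathfrak m^t/\mathfrak m^{t+1})$. Such $A$ is one-dimensional Cohen-Macaulay; its multiplicity $e$ is the value of $HF_A(t)$ for all large $t$. $HF_A$ has a flat in position $n$ if $HF_A(n)=HF_A(n+1)<e$. *)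

theory Defs
  imports "HOL-Algebra.Algebra" "HOL-Algebra.Algebraic_Closure_Type"
begin

text \<open>
  The ring \<open>K[[x,y,z]]\<close> is the iterated power series ring \<open>K[[x]][[y]][[z]]\<close>, and \<open>K[x,y,z]\<close> is
  \<open>K[x][y][z]\<close>; the outermost type constructor belongs to \<open>z\<close>.  Ideals, quotients and dimensions
  are those of HOL-Algebra, applied to the ring record of the type.
\<close>

type_synonym 'k pser3 = "'k fps fps fps"
type_synonym 'k poly3 = "'k poly poly poly"

abbreviation PS3 :: "'k::field pser3 ring"
  where "PS3 \<equiv> ring_of_type_algebra"

abbreviation P3 :: "'k::field poly3 ring"
  where "P3 \<equiv> ring_of_type_algebra"

definition ps_const :: "'k::field \<Rightarrow> 'k pser3"
  where "ps_const c = fps_const (fps_const (fps_const c))"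

definition ps_x :: "'k::field pser3"
  where "ps_x = fps_const (fps_const fps_X)"

definition ps_y :: "'k::field pser3"
  where "ps_y = fps_const fps_X"

definition ps_z :: "'k::field pser3"
  where "ps_z = fps_X"

text \<open>The coefficient of \<open>x\<^sup>i y\<^sup>j z\<^sup>k\<close>.\<close>

definition ps_coeff :: "'k::field pser3 \<Rightarrow> nat \<Rightarrow> nat \<Rightarrow> nat \<Rightarrow> 'k"
  where "ps_coeff f i j k = fps_nth (fps_nth (fps_nth f k) j) i"

text \<open>Only meaningful for nonzero \<open>f\<close>.\<close>

definition ps_order :: "'k::field pser3 \<Rightarrow> nat"
  where "ps_order f = (LEAST v. \<exists>i j k. i + j + k = v \<and> ps_coeff f i j k \<noteq> 0)"

definition initial_form :: "'k::field pser3 \<Rightarrow> 'k poly3"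
  where "initial_form f =
    (\<Sum>(i, j, k) \<in> {(i, j, k). i + j + k = ps_order f}.
       monom (monom (monom (ps_coeff f i j k) i) j) k)"

lemma finite_exponents: "finite {(i :: nat, j :: nat, k :: nat). i + j + k = v}"
  by (rule finite_subset[of _ "{..v} \<times> {..v} \<times> {..v}"]) auto

lemma coeff_initial_form:
  "coeff (coeff (coeff (initial_form f) k) j) i =
     (if i + j + k = ps_order f then ps_coeff f i j k else 0)"
proof -
  let ?S = "{(i, j, k). i + j + k = ps_order f}"
  have "coeff (coeff (coeff (initial_form f) k) j) i =
      (\<Sum>(a, b, c) \<in> ?S. coeff (coeff (coeff (monom (monom (monom (ps_coeff f a b c) a) b) c) k) j) i)"
    by (simp add: initial_form_def coeff_sum case_prod_unfold)
  also have "\<dots> = (\<Sum>p \<in> ?S. if p = (i, j, k) then ps_coeff f i j k else 0)"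
    by (rule sum.cong) (auto split: if_splits)
  also have "\<dots> = (if i + j + k = ps_order f then ps_coeff f i j k else 0)"
    using finite_exponents[of "ps_order f"] by simp
  finally show ?thesis .
qed

text \<open>
  The implication says that \<open>r\<^sub>i\<close> is a nonzerodivisor on \<open>R/(r\<^sub>0, \<dots>, r\<^bsub>i-1\<^esub>)\<close>.
\<close>

definition regular_sequence :: "('a, 'b) ring_scheme \<Rightarrow> 'a list \<Rightarrow> bool"
  where "regular_sequence R rs \<longleftrightarrow>
    set rs \<subseteq> carrier R \<and>
    Idl\<^bsub>R\<^esub> (set rs) \<noteq> carrier R \<and>
    (\<forall>i < length rs. \<forall>a \<in> carrier R.
       rs ! i \<otimes>\<^bsub>R\<^esub> a \<in> Idl\<^bsub>R\<^esub> (set (take i rs)) \<longrightarrow> a \<in> Idl\<^bsub>R\<^esub> (set (take i rs)))"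

definition type_2_2 :: "'k::field pser3 set \<Rightarrow> bool"
  where "type_2_2 I \<longleftrightarrow>
    (\<exists>f g. regular_sequence PS3 [f, g] \<and> I = Idl\<^bsub>PS3\<^esub> {f, g} \<and>
       f \<noteq> 0 \<and> g \<noteq> 0 \<and> ps_order f = 2 \<and> ps_order g = 2 \<and>
       initial_form g \<notin> Idl\<^bsub>P3\<^esub> {initial_form f})"

text \<open>
  For an ideal \<open>\<mm>\<close> of a ring \<open>A\<close> containing the field \<open>k\<close>, the space \<open>\<mm>\<^sup>t/\<mm>\<^bsup>t+1\<^esup>\<close> is taken
  inside the ring \<open>A/\<mm>\<^bsup>t+1\<^esup>\<close>, with scalars the image of \<open>k\<close> there.
\<close>

definition graded_dim :: "('a, 'b) ring_scheme \<Rightarrow> 'a set \<Rightarrow> 'a set \<Rightarrow> nat \<Rightarrow> nat"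
  where "graded_dim A k \<mm> t =
    (let J = \<mm> [^]\<^bsub>ideals_set A\<^esub> Suc t
     in ring.dim (A Quot J) (a_r_coset A J ` k) (a_r_coset A J ` (\<mm> [^]\<^bsub>ideals_set A\<^esub> t)))"

definition HF :: "'k::field pser3 set \<Rightarrow> nat \<Rightarrow> nat"
  where "HF I = graded_dim (PS3 Quot I) (a_r_coset PS3 I ` range ps_const)
                  (a_r_coset PS3 I ` (Idl\<^bsub>PS3\<^esub> {ps_x, ps_y, ps_z}))"

definition hs_multiplicity :: "'k::field pser3 set \<Rightarrow> nat"
  where "hs_multiplicity I = (THE e. \<forall>\<^sub>F t in sequentially. HF I t = e)"

definition has_flat :: "'k::field pser3 set \<Rightarrow> nat \<Rightarrow> bool"
  where "has_flat I n \<longleftrightarrow> HF I n = HF I (n + 1) \<and> HF I (n + 1) < hs_multiplicity I"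

end

theory Submission
  imports Defs
begin

text \<open>
  Passing to initial forms, \<open>HF I t = dim R\<^sub>t - dim (I\<^sup>*)\<^sub>t\<close>, where \<open>I\<^sup>*\<close> is the ideal of
  initial forms.  If the quadrics \<open>f\<^sup>*, g\<^sup>*\<close> are coprime, the Hilbert function decreases from degree 2
  on, where its value is 4, and no flat exists.  Otherwise \<open>f\<^sup>* = L l1\<close>, \<open>g\<^sup>* = L l2\<close> with linear
  forms, and \<open>t + 1 \<le> HF I t \<le> t + 2\<close> until \<open>I\<^sup>*\<close> leaves the ideal \<open>(L)\<close>, say in degree \<open>k\<close>;
  from degree \<open>k - 1\<close> on the function decreases.  Hence a flat in position \<open>n\<close> forces \<open>n < k - 1\<close>,
  \<open>e \<le> k\<close>, and a new generator \<open>L q\<close> of \<open>I\<^sup>*\<close> in degree \<open>n + 1\<close>, with \<open>q \<notin> (l1, l2)\<close>.  It is the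
  initial form of \<open>h = a f + b g\<close> with \<open>a\<^sup>* = l2\<close>, \<open>b\<^sup>* = - l1\<close>.  Suppose \<open>k > 2 n\<close>.  Then
  \<open>l1 h - q f\<close> and \<open>l2 h - q g\<close> can be reduced modulo \<open>f, g, h\<close> to elements of order \<open>> 2 n\<close>.
  On the curve \<open>a = b = 0\<close> the element \<open>h\<close> vanishes and \<open>q\<close> has order \<open>n\<close>, so \<open>f\<close> and \<open>g\<close> have
  order \<open>> n\<close> there.  But then \<open>L q \<in> (l1, l2)\<^sup>2\<close>, which is impossible.
\<close>

section \<open>The order filtration\<close>

text \<open>The bound \<open>2 n\<close> is a sum of two orders on the curve
  \<open>a = b = 0\<close>. The linear parts of \<open>a\<close> and \<open>b\<close> are
  independent, so the curve is smooth with parameter \<open>w\<close>, and orders on it add up.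
  There \<open>q\<close> has order exactly \<open>n\<close>. If the smaller of the orders of
  \<open>f\<close> and \<open>g\<close> is \<open>j \<le> n\<close>, then the reduced relations,
  valid up to order \<open>2 n\<close>, are contradicted in order \<open>n + j\<close>. The obstacle
  is the multiplier of \<open>h\<close> in those relations, over which the reductions give no
  control; the curve is introduced because \<open>h\<close> vanishes on it. The reductions
  themselves need only that the initial ideal stays inside \<open>(L)\<close> up to degree
  \<open>2 n\<close>: modulo \<open>(l1, l2)\<close> a form is a multiple of a power of
  \<open>w\<close>, and \<open>h\<close> supplies \<open>L\<close> times that power. Finally,
  \<open>L q\<close> is outside the square of \<open>(l1, l2)\<close> because
  \<open>(l1, l2)\<close> modulo its square is free over \<open>K[w]\<close> on the classes of
  \<open>l1\<close> and \<open>l2\<close>, while \<open>q\<close> is a nonzero multiple of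
  \<open>w^n\<close> modulo \<open>(l1, l2)\<close>. If \<open>L\<close> itself involves
  \<open>w\<close>, then \<open>L q\<close> is not even in \<open>(l1, l2)\<close>.\<close>

definition order_ge :: "nat \<Rightarrow> 'k::field pser3 set"
  where "order_ge t = {f. \<forall>i j k. i + j + k < t \<longrightarrow> ps_coeff f i j k = 0}"

text \<open>Forms stay inside the power series ring, so that they multiply with series without any
  conversion; the polynomials of \<open>initial_form\<close> reappear only at the end.\<close>

definition forms :: "nat \<Rightarrow> 'k::field pser3 set"
  where "forms t = {f. \<forall>i j k. i + j + k \<noteq> t \<longrightarrow> ps_coeff f i j k = 0}"

definition ps_of :: "(nat \<Rightarrow> nat \<Rightarrow> nat \<Rightarrow> 'k) \<Rightarrow> 'k::field pser3"
  where "ps_of c = Abs_fps (\<lambda>k. Abs_fps (\<lambda>j. Abs_fps (\<lambda>i. c i j k)))"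

definition part :: "nat \<Rightarrow> 'k::field pser3 \<Rightarrow> 'k pser3"
  where "part t f = ps_of (\<lambda>i j k. if i + j + k = t then ps_coeff f i j k else 0)"

lemma ps_coeff_of [simp]: "ps_coeff (ps_of c) i j k = c i j k"
  by (simp add: ps_coeff_def ps_of_def)

lemma ps_eqI: "(\<And>i j k. ps_coeff f i j k = ps_coeff g i j k) \<Longrightarrow> f = g"
  by (auto simp: ps_coeff_def intro!: fps_ext)

lemma ps_coeff_0 [simp]: "ps_coeff 0 i j k = 0"
  by (simp add: ps_coeff_def)

lemma ps_coeff_add [simp]: "ps_coeff (f + g) i j k = ps_coeff f i j k + ps_coeff g i j k"
  by (simp add: ps_coeff_def)

lemma ps_coeff_diff [simp]: "ps_coeff (f - g) i j k = ps_coeff f i j k - ps_coeff g i j k"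
  by (simp add: ps_coeff_def)

lemma ps_coeff_uminus [simp]: "ps_coeff (- f) i j k = - ps_coeff f i j k"
  by (simp add: ps_coeff_def)

lemma ps_coeff_const_mult [simp]: "ps_coeff (ps_const c * f) i j k = c * ps_coeff f i j k"
  by (simp add: ps_coeff_def ps_const_def)

lemma ps_coeff_const: "ps_coeff (ps_const c) i j k = (if i = 0 \<and> j = 0 \<and> k = 0 then c else 0)"
  by (simp add: ps_coeff_def ps_const_def)

lemma ps_coeff_1: "ps_coeff 1 i j k = (if i = 0 \<and> j = 0 \<and> k = 0 then 1 else 0)"
  by (simp add: ps_coeff_def)

lemma ps_coeff_x_mult [simp]: "ps_coeff (ps_x * f) i j k = (if i = 0 then 0 else ps_coeff f (i - 1) j k)"
  by (simp add: ps_coeff_def ps_x_def)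

lemma ps_coeff_y_mult [simp]: "ps_coeff (ps_y * f) i j k = (if j = 0 then 0 else ps_coeff f i (j - 1) k)"
  by (simp add: ps_coeff_def ps_y_def)

lemma ps_coeff_z_mult [simp]: "ps_coeff (ps_z * f) i j k = (if k = 0 then 0 else ps_coeff f i j (k - 1))"
  by (simp add: ps_coeff_def ps_z_def)

lemma ps_coeff_mult:
  "ps_coeff (f * g) i j k =
     (\<Sum>c\<le>k. \<Sum>b\<le>j. \<Sum>a\<le>i. ps_coeff f a b c * ps_coeff g (i - a) (j - b) (k - c))"
  by (simp add: ps_coeff_def fps_mult_nth fps_sum_nth atLeast0AtMost)

lemma ps_coeff_part [simp]:
  "ps_coeff (part t f) i j k = (if i + j + k = t then ps_coeff f i j k else 0)"
  by (simp add: part_def)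

lemma ps_const_0 [simp]: "ps_const 0 = 0"
  and ps_const_1 [simp]: "ps_const 1 = 1"
  and ps_const_add: "ps_const (c + d) = ps_const c + ps_const d"
  and ps_const_mult: "ps_const (c * d) = ps_const c * ps_const d"
  and ps_const_uminus: "ps_const (- c) = - ps_const c"
  and ps_const_diff: "ps_const (c - d) = ps_const c - ps_const d"
  by (simp_all add: ps_const_def fps_const_add[symmetric] fps_const_sub[symmetric] del: fps_const_add fps_const_sub)

lemma ps_const_eq_0_iff [simp]: "ps_const c = 0 \<longleftrightarrow> c = 0"
  by (simp add: ps_const_def)

global_interpretation ps: vector_space "\<lambda>c f. ps_const c * (f :: 'k::field pser3)"
  by unfold_locales (simp_all add: algebra_simps ps_const_add ps_const_mult)

lemma order_ge_0 [simp]: "order_ge 0 = UNIV"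
  by (simp add: order_ge_def)

lemma order_ge_mono: "s \<le> t \<Longrightarrow> f \<in> order_ge t \<Longrightarrow> f \<in> order_ge s"
  by (auto simp: order_ge_def)

lemma order_ge_add: "f \<in> order_ge t \<Longrightarrow> g \<in> order_ge t \<Longrightarrow> f + g \<in> order_ge t"
  and order_ge_diff: "f \<in> order_ge t \<Longrightarrow> g \<in> order_ge t \<Longrightarrow> f - g \<in> order_ge t"
  and order_ge_uminus: "f \<in> order_ge t \<Longrightarrow> - f \<in> order_ge t"
  and zero_order_ge [simp]: "0 \<in> order_ge t"
  by (auto simp: order_ge_def)

lemma order_ge_mult:
  assumes "f \<in> order_ge s" "g \<in> order_ge t"
  shows "f * g \<in> order_ge (s + t)"
proof -
  have "ps_coeff f a b c * ps_coeff g (i - a) (j - b) (k - c) = 0"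
    if "i + j + k < s + t" "a \<le> i" "b \<le> j" "c \<le> k" for a b c i j k
  proof (cases "a + b + c < s")
    case False
    then have "(i - a) + (j - b) + (k - c) < t" using that by linarith
    then show ?thesis using assms(2) by (simp add: order_ge_def)
  qed (use assms(1) in \<open>simp add: order_ge_def\<close>)
  then show ?thesis
    by (auto simp: order_ge_def ps_coeff_mult intro!: sum.neutral)
qed

lemma order_ge_mult_left: "f \<in> order_ge t \<Longrightarrow> g * f \<in> order_ge t"
  using order_ge_mult[of g 0 f t] by simp

lemma order_ge_mult_right: "f \<in> order_ge t \<Longrightarrow> f * g \<in> order_ge t"
  using order_ge_mult[of f t g 0] by simp

text \<open>If two monomials have total degree \<open>s + t\<close> and the first has degree other
  than \<open>s\<close>, then the first has degree below \<open>s\<close> or the second has degree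
  below \<open>t\<close>, so one coefficient vanishes. Both components are allowed to be 0.\<close>

lemma part_mult:
  assumes "f \<in> order_ge s" "g \<in> order_ge t"
  shows "part (s + t) (f * g) = part s f * part t g"
proof (rule ps_eqI)
  fix i j k
  have *: "(if i + j + k = s + t then ps_coeff f a b c * ps_coeff g (i - a) (j - b) (k - c) else 0) =
      ps_coeff (part s f) a b c * ps_coeff (part t g) (i - a) (j - b) (k - c)"
    if "a \<le> i" "b \<le> j" "c \<le> k" for a b c
  proof -
    consider "a + b + c < s" | "a + b + c = s" | "a + b + c > s" by linarith
    then show ?thesis
    proof cases
      case 1
      then show ?thesis using assms(1) by (simp add: order_ge_def)
    next
      case 2
      then show ?thesis using that by auto
    next
      case 3
      show ?thesis
      proof (cases "i + j + k = s + t")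
        case True
        then have "(i - a) + (j - b) + (k - c) < t" using 3 that by linarith
        then show ?thesis using assms(2) by (simp add: order_ge_def)
      qed (use 3 in simp)
    qed
  qed
  have "ps_coeff (part (s + t) (f * g)) i j k =
      (\<Sum>c\<le>k. \<Sum>b\<le>j. \<Sum>a\<le>i. if i + j + k = s + t then ps_coeff f a b c * ps_coeff g (i - a) (j - b) (k - c) else 0)"
    by (simp add: ps_coeff_mult)
  also have "\<dots> = ps_coeff (part s f * part t g) i j k"
    unfolding ps_coeff_mult by (intro sum.cong refl *) auto
  finally show "ps_coeff (part (s + t) (f * g)) i j k = ps_coeff (part s f * part t g) i j k" .
qed

lemma part_add: "part t (f + g) = part t f + part t g"
  and part_diff: "part t (f - g) = part t f - part t g"
  and part_uminus: "part t (- f) = - part t f"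
  and part_0 [simp]: "part t 0 = 0"
  by (auto intro!: ps_eqI)

lemma part_forms [simp]: "part t f \<in> forms t"
  by (simp add: forms_def)

lemma part_of_form: "f \<in> forms t \<Longrightarrow> part t f = f"
  by (rule ps_eqI) (auto simp: forms_def)

lemma part_of_order_ge: "f \<in> order_ge (Suc t) \<Longrightarrow> part t f = 0"
  by (rule ps_eqI) (auto simp: order_ge_def)

lemma form_order_ge: "f \<in> forms t \<Longrightarrow> f \<in> order_ge t"
  by (auto simp: forms_def order_ge_def)

lemma diff_part_order_ge: "f \<in> order_ge t \<Longrightarrow> f - part t f \<in> order_ge (Suc t)"
  by (auto simp: order_ge_def)

lemma order_ge_SucI: "f \<in> order_ge t \<Longrightarrow> part t f = 0 \<Longrightarrow> f \<in> order_ge (Suc t)"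
  using diff_part_order_ge[of f t] by simp

lemma part_eqI: "f - g \<in> order_ge (Suc t) \<Longrightarrow> part t f = part t g"
  using part_of_order_ge[of "f - g" t] by (simp add: part_diff)

lemma forms_subspace: "ps.subspace (forms t)"
  by (auto simp: ps.subspace_def forms_def)

lemma forms_add: "f \<in> forms t \<Longrightarrow> g \<in> forms t \<Longrightarrow> f + g \<in> forms t"
  and forms_diff: "f \<in> forms t \<Longrightarrow> g \<in> forms t \<Longrightarrow> f - g \<in> forms t"
  and forms_uminus: "f \<in> forms t \<Longrightarrow> - f \<in> forms t"
  and forms_scale: "f \<in> forms t \<Longrightarrow> ps_const c * f \<in> forms t"
  and zero_forms [simp]: "0 \<in> forms t"
  by (auto simp: forms_def)

lemma forms_mult: "f \<in> forms s \<Longrightarrow> g \<in> forms t \<Longrightarrow> f * g \<in> forms (s + t)"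
  by (metis form_order_ge part_forms part_mult part_of_form)

lemma forms_mult_Suc: "f \<in> forms 1 \<Longrightarrow> g \<in> forms t \<Longrightarrow> f * g \<in> forms (Suc t)"
  using forms_mult[of f 1 g t] by simp

lemma ps_const_forms [simp]: "ps_const c \<in> forms 0"
  by (auto simp: forms_def ps_coeff_const)

lemma one_forms [simp]: "1 \<in> forms 0"
  by (auto simp: forms_def ps_coeff_1)

lemma forms_power: "f \<in> forms s \<Longrightarrow> f ^ n \<in> forms (s * n)"
  by (induction n) (auto dest: forms_mult)

lemma linear_power_forms: "f \<in> forms 1 \<Longrightarrow> f ^ n \<in> forms n"
  using forms_power[of f 1 n] by simp

lemma forms_0_const: "f \<in> forms 0 \<Longrightarrow> f = ps_const (ps_coeff f 0 0 0)"
  by (rule ps_eqI) (auto simp: forms_def ps_coeff_const)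

lemma ps_coeff_xyz:
  "ps_coeff ps_x i j k = (if i = 1 \<and> j = 0 \<and> k = 0 then 1 else 0)"
  "ps_coeff ps_y i j k = (if i = 0 \<and> j = 1 \<and> k = 0 then 1 else 0)"
  "ps_coeff ps_z i j k = (if i = 0 \<and> j = 0 \<and> k = 1 then 1 else 0)"
  using ps_coeff_x_mult[of 1 i j k] ps_coeff_y_mult[of 1 i j k] ps_coeff_z_mult[of 1 i j k]
  by (auto simp: ps_coeff_1 simp del: ps_coeff_x_mult ps_coeff_y_mult ps_coeff_z_mult)

lemma xyz_forms [simp]: "ps_x \<in> forms 1" "ps_y \<in> forms 1" "ps_z \<in> forms 1"
  by (auto simp: forms_def ps_coeff_xyz)

text \<open>Each nonconstant monomial is charged to the last variable that occurs in it:
  \<open>z\<close> before \<open>y\<close> before \<open>x\<close>.\<close>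

lemma ps_split:
  "f = ps_const (ps_coeff f 0 0 0) + (ps_x * ps_of (\<lambda>i j k. if j = 0 \<and> k = 0 then ps_coeff f (Suc i) 0 0 else 0)
     + ps_y * ps_of (\<lambda>i j k. if k = 0 then ps_coeff f i (Suc j) 0 else 0)
     + ps_z * ps_of (\<lambda>i j k. ps_coeff f i j (Suc k)))"
  by (rule ps_eqI) (auto simp: ps_coeff_const)

lemma order_ge_Suc_split:
  assumes "f \<in> order_ge (Suc t)"
  obtains a b c where "a \<in> order_ge t" "b \<in> order_ge t" "c \<in> order_ge t"
    "f = ps_x * a + ps_y * b + ps_z * c"
proof -
  have "ps_coeff f 0 0 0 = 0" using assms by (simp add: order_ge_def)
  then have eq: "f = ps_x * ps_of (\<lambda>i j k. if j = 0 \<and> k = 0 then ps_coeff f (Suc i) 0 0 else 0)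
     + ps_y * ps_of (\<lambda>i j k. if k = 0 then ps_coeff f i (Suc j) 0 else 0)
     + ps_z * ps_of (\<lambda>i j k. ps_coeff f i j (Suc k))"
    using ps_split[of f] by simp
  show ?thesis
    by (rule that[OF _ _ _ eq]) (use assms in \<open>auto simp: order_ge_def\<close>)
qed

lemma forms_Suc_split:
  assumes "f \<in> forms (Suc t)"
  obtains a b c where "a \<in> forms t" "b \<in> forms t" "c \<in> forms t"
    "f = ps_x * a + ps_y * b + ps_z * c"
proof -
  have "ps_coeff f 0 0 0 = 0" using assms by (simp add: forms_def)
  then have eq: "f = ps_x * ps_of (\<lambda>i j k. if j = 0 \<and> k = 0 then ps_coeff f (Suc i) 0 0 else 0)
     + ps_y * ps_of (\<lambda>i j k. if k = 0 then ps_coeff f i (Suc j) 0 else 0)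
     + ps_z * ps_of (\<lambda>i j k. ps_coeff f i j (Suc k))"
    using ps_split[of f] by simp
  show ?thesis
    by (rule that[OF _ _ _ eq]) (use assms in \<open>auto simp: forms_def\<close>)
qed

section \<open>Dimensions of subspaces\<close>

context vector_space begin

text \<open>The series ring is infinite-dimensional over \<open>K\<close>, and \<open>dim\<close> is
  the cardinality of a basis, which is 0 for an infinite one; finiteness is therefore recorded for
  each subspace separately.\<close>

definition finite_dim :: "'b set \<Rightarrow> bool"
  where "finite_dim U \<longleftrightarrow> (\<exists>B. finite B \<and> U \<subseteq> span B)"

lemma finite_dim_subset: "V \<subseteq> U \<Longrightarrow> local.finite_dim U \<Longrightarrow> local.finite_dim V"
  by (auto simp: finite_dim_def)

lemma finite_dim_basis:
  assumes "local.finite_dim U"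
  obtains B where "finite B" "B \<subseteq> U" "independent B" "U \<subseteq> span B" "card B = local.dim U"
proof -
  obtain B where B: "B \<subseteq> U" "independent B" "U \<subseteq> span B" "card B = local.dim U"
    using basis_exists by blast
  moreover have "finite B"
    using assms B independent_span_bound unfolding finite_dim_def by (meson subset_trans)
  ultimately show ?thesis using that by blast
qed

lemma complement_exists:
  assumes "local.finite_dim U" "subspace V" "V \<subseteq> U" "subspace U"
  obtains C where "finite C" "C \<subseteq> U" "independent C" "local.dim V + card C = local.dim U"
    "\<And>u. u \<in> U \<Longrightarrow> \<exists>v\<in>V. \<exists>s\<in>span C. u = v + s" "\<And>s. s \<in> span C \<Longrightarrow> s \<in> V \<Longrightarrow> s = 0"
proof -
  obtain B where B: "finite B" "B \<subseteq> V" "independent B" "V \<subseteq> span B" "card B = local.dim V"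
    using finite_dim_basis[OF finite_dim_subset[OF assms(3,1)]] by blast
  obtain B' where B': "B \<subseteq> B'" "B' \<subseteq> U" "independent B'" "U \<subseteq> span B'"
    using maximal_independent_subset_extend[OF _ B(3)] B(2) assms(3) by (metis subset_trans)
  have fin: "finite B'"
    using assms(1) B' independent_span_bound unfolding finite_dim_def by (meson subset_trans)
  have card: "card B' = local.dim U" using B' basis_card_eq_dim by blast
  have V: "V = span B" using B assms(2) by (simp add: span_subspace)
  have un: "B \<union> (B' - B) = B'" using B'(1) by blast
  show ?thesis
  proof (rule that[of "B' - B"])
    show "local.dim V + card (B' - B) = local.dim U"
      using card B(5) card_Diff_subset[OF B(1) B'(1)] card_mono[OF fin B'(1)] by simp
    show "\<exists>v\<in>V. \<exists>s\<in>span (B' - B). u = v + s" if "u \<in> U" for u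
      using that B'(4) span_Un[of B "B' - B"] unfolding un V by blast
    show "s = 0" if "s \<in> span (B' - B)" "s \<in> V" for s
    proof -
      \<comment> \<open>The expansions of \<open>s\<close> over \<open>B\<close> and over
        \<open>B' - B\<close> both agree with the one over \<open>B'\<close>, so a nonzero
        coefficient would belong to a vector of both sets.\<close>
      have "representation B' s b = 0" for b
        using representation_extend[OF B'(3) _ B'(1), of s] representation_extend[OF B'(3), of s "B' - B"]
          representation_ne_zero[of B s b] representation_ne_zero[of "B' - B" s b] that V by auto
      moreover have "s \<in> span B'" using that V B'(1) span_mono by blast
      ultimately show ?thesis using sum_nonzero_representation_eq[OF B'(3), of s] by simp
    qed
    show "independent (B' - B)" by (rule independent_mono[OF B'(3)]) auto
  qed (use fin B' in auto)
qed

lemma dim_mono_finite: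
  assumes "local.finite_dim U" "V \<subseteq> U"
  shows "local.dim V \<le> local.dim U"
proof -
  obtain B where "finite B" "U \<subseteq> span B" "card B = local.dim U"
    using finite_dim_basis[OF assms(1)] by metis
  then show ?thesis using dim_le_card[of V B] assms(2) by auto
qed

lemma subspace_eq_of_dim_le:
  assumes "local.finite_dim U" "subspace U" "subspace V" "V \<subseteq> U" "local.dim U \<le> local.dim V"
  shows "V = U"
proof -
  obtain C where C: "finite C" "local.dim V + card C = local.dim U"
      "\<And>u. u \<in> U \<Longrightarrow> \<exists>v\<in>V. \<exists>s\<in>span C. u = v + s"
    using complement_exists[OF assms(1,3,4,2)] by metis
  have "C = {}" using C(1,2) assms(5) by (metis add_le_same_cancel1 card_0_eq le_zero_eq)
  then show ?thesis using C(3) assms(4) by fastforce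
qed

lemma dim_le_add_card:
  assumes "local.finite_dim V" "finite C" "\<And>u. u \<in> U \<Longrightarrow> \<exists>v\<in>V. \<exists>s\<in>span C. u = v + s"
  shows "local.dim U \<le> local.dim V + card C"
proof -
  obtain B where B: "finite B" "B \<subseteq> V" "V \<subseteq> span B" "card B = local.dim V"
    using finite_dim_basis[OF assms(1)] by metis
  have "U \<subseteq> span (B \<union> C)"
    using assms(3) B(3) unfolding span_Un by blast
  then have "local.dim U \<le> card (B \<union> C)" using B(1) assms(2) by (simp add: dim_le_card)
  also have "\<dots> \<le> card B + card C" by (rule card_Un_le)
  finally show ?thesis using B(4) by simp
qed

end

section \<open>Monomials as a basis of the forms of a given degree\<close>

definition exponents :: "nat \<Rightarrow> (nat \<times> nat \<times> nat) set"
  where "exponents t = {(i, j, k). i + j + k = t}"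

lemma finite_exponents_set [simp]: "finite (exponents t)"
  unfolding exponents_def by (rule finite_exponents)

text \<open>Exponents with positive last entry are shifts of those of degree \<open>t\<close>; the
  others are the \<open>t + 2\<close> monomials of degree \<open>t + 1\<close> in two
  variables.\<close>

lemma card_exponents_Suc: "card (exponents (Suc t)) = card (exponents t) + (t + 2)"
proof -
  let ?A = "(\<lambda>(i, j, k). (i, j, Suc k)) ` exponents t" and ?B = "(\<lambda>i. (i, Suc t - i, 0)) ` {..Suc t}"
  have "exponents (Suc t) = ?A \<union> ?B"
  proof (intro equalityI subsetI)
    fix p assume p: "p \<in> exponents (Suc t)"
    obtain i j k where [simp]: "p = (i, j, k)" by (cases p)
    show "p \<in> ?A \<union> ?B"
    proof (cases k)
      case 0
      then have "p = (\<lambda>i. (i, Suc t - i, 0)) i" "i \<in> {..Suc t}" using p by (auto simp: exponents_def)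
      then show ?thesis by blast
    next
      case (Suc l)
      then have "p = (\<lambda>(i, j, k). (i, j, Suc k)) (i, j, l)" "(i, j, l) \<in> exponents t"
        using p by (auto simp: exponents_def)
      then show ?thesis by blast
    qed
  qed (auto simp: exponents_def)
  moreover have "?A \<inter> ?B = {}" by auto
  moreover have "card ?A = card (exponents t)" by (rule card_image) (auto simp: inj_on_def)
  moreover have "card ?B = t + 2" by (subst card_image) (auto simp: inj_on_def)
  ultimately show ?thesis by (simp add: card_Un_disjoint)
qed

lemma card_exponents_0: "card (exponents 0) = 1"
proof -
  have "exponents 0 = {(0, 0, 0)}" by (auto simp: exponents_def)
  then show ?thesis by simp
qed

definition ps_monom :: "nat \<times> nat \<times> nat \<Rightarrow> 'k::field pser3"
  where "ps_monom p = ps_of (\<lambda>i j k. if (i, j, k) = p then 1 else 0)"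

lemma ps_coeff_monom [simp]: "ps_coeff (ps_monom p) i j k = (if (i, j, k) = p then 1 else 0)"
  by (simp add: ps_monom_def)

lemma ps_coeff_sum [simp]: "ps_coeff (sum f A) i j k = (\<Sum>a\<in>A. ps_coeff (f a) i j k)"
  by (induction A rule: infinite_finite_induct) auto

lemma ps_coeff_combination:
  "finite A \<Longrightarrow> ps_coeff (\<Sum>p\<in>A. ps_const (u p) * ps_monom p) i j k = (if (i, j, k) \<in> A then u (i, j, k) else 0)"
  by (simp add: if_distrib[of "(*) _"] cong: if_cong)

lemma forms_eq_span: "forms t = ps.span (ps_monom ` exponents t)"
proof (intro subset_antisym subsetI)
  fix f :: "'a pser3" assume f: "f \<in> forms t"
  have "f = (\<Sum>p\<in>exponents t. ps_const (case p of (i, j, k) \<Rightarrow> ps_coeff f i j k) * ps_monom p)"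
  proof (rule ps_eqI)
    fix i j k
    show "ps_coeff f i j k = ps_coeff (\<Sum>p\<in>exponents t. ps_const (case p of (i, j, k) \<Rightarrow> ps_coeff f i j k) * ps_monom p) i j k"
      using f by (simp only: ps_coeff_combination[OF finite_exponents_set]) (auto simp: exponents_def forms_def)
  qed
  also have "\<dots> \<in> ps.span (ps_monom ` exponents t)"
    by (intro ps.span_sum ps.span_scale ps.span_base) auto
  finally show "f \<in> ps.span (ps_monom ` exponents t)" .
next
  fix f :: "'a pser3" assume "f \<in> ps.span (ps_monom ` exponents t)"
  moreover have "ps_monom ` exponents t \<subseteq> (forms t :: 'a pser3 set)"
    by (auto simp: forms_def exponents_def)
  ultimately show "f \<in> forms t" using ps.span_minimal[OF _ forms_subspace] by blast
qed

lemma inj_ps_monom: "inj ps_monom"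
proof (rule injI)
  fix p q assume "ps_monom p = (ps_monom q :: 'a pser3)"
  then have "ps_coeff (ps_monom p :: 'a pser3) (fst p) (fst (snd p)) (snd (snd p)) =
      ps_coeff (ps_monom q :: 'a pser3) (fst p) (fst (snd p)) (snd (snd p))" by simp
  then show "p = q" by (simp split: if_splits)
qed

lemma independent_ps_monom:
  assumes "finite A"
  shows "ps.independent (ps_monom ` A :: 'k::field pser3 set)"
proof (rule ps.independent_if_scalars_zero)
  fix u :: "'k pser3 \<Rightarrow> 'k" and m :: "'k pser3"
  assume *: "(\<Sum>m\<in>ps_monom ` A. ps_const (u m) * m) = 0" and "m \<in> ps_monom ` A"
  then obtain i j k where p: "(i, j, k) \<in> A" "m = ps_monom (i, j, k)" by auto
  have "(\<Sum>m\<in>ps_monom ` A. ps_const (u m) * m) = (\<Sum>p\<in>A. ps_const (u (ps_monom p)) * ps_monom p)"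
    by (subst sum.reindex) (auto intro: inj_on_subset[OF inj_ps_monom])
  with * have "ps_coeff (\<Sum>p\<in>A. ps_const (u (ps_monom p)) * ps_monom p) i j k = 0" by simp
  then show "u m = 0" using p assms by (simp only: ps_coeff_combination) simp
qed (use assms in simp)

lemma finite_dim_forms [simp]: "ps.finite_dim (forms t)"
  by (auto simp: ps.finite_dim_def forms_eq_span intro!: exI[of _ "ps_monom ` exponents t"])

lemma dim_forms: "ps.dim (forms t :: 'k::field pser3 set) = card (exponents t)"
proof -
  have "ps.dim (forms t :: 'k pser3 set) = card (ps_monom ` exponents t :: 'k pser3 set)"
    unfolding forms_eq_span by (simp add: ps.dim_eq_card_independent independent_ps_monom)
  also have "\<dots> = card (exponents t)"
    by (rule card_image) (auto intro: inj_on_subset[OF inj_ps_monom])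
  finally show ?thesis .
qed

lemma dim_forms_Suc: "ps.dim (forms (Suc t) :: 'k::field pser3 set) = ps.dim (forms t :: 'k pser3 set) + (t + 2)"
  by (simp add: dim_forms card_exponents_Suc)

lemma dim_forms_0: "ps.dim (forms 0 :: 'k::field pser3 set) = 1"
  by (simp add: dim_forms card_exponents_0)

lemma dim_forms_1: "ps.dim (forms 1 :: 'k::field pser3 set) = 3"
  by (simp add: dim_forms_Suc[of 0, simplified] dim_forms_0)

section \<open>Dimensions under multiplication by a fixed series\<close>

lemma mult_mem_span_image: "u \<in> ps.span B \<Longrightarrow> L * u \<in> ps.span ((*) L ` B)"
proof (induction rule: ps.span_induct_alt)
  case (step c b v)
  have "L * (ps_const c * b + v) = ps_const c * (L * b) + L * v" by (simp add: algebra_simps)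
  moreover have "L * b \<in> ps.span ((*) L ` B)" using step.hyps by (intro ps.span_base imageI)
  ultimately show ?case using step.IH by (simp only: ps.span_add ps.span_scale)
qed (simp add: ps.span_zero)

lemma subspace_image_mult:
  assumes "ps.subspace U"
  shows "ps.subspace ((*) L ` U)"
proof (rule ps.subspaceI)
  show "0 \<in> (*) L ` U" using ps.subspace_0[OF assms] by (intro image_eqI[of _ _ 0]) simp_all
next
  fix a b assume "a \<in> (*) L ` U" "b \<in> (*) L ` U"
  then obtain u v where "u \<in> U" "v \<in> U" "a = L * u" "b = L * v" by blast
  then show "a + b \<in> (*) L ` U"
    using ps.subspace_add[OF assms] by (intro image_eqI[of _ _ "u + v"]) (simp_all add: distrib_left)
next
  fix c a assume "a \<in> (*) L ` U"
  then obtain u where "u \<in> U" "a = L * u" by blast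
  then show "ps_const c * a \<in> (*) L ` U"
    using ps.subspace_scale[OF assms] by (intro image_eqI[of _ _ "ps_const c * u"]) (simp_all add: mult_ac)
qed

lemma finite_dim_image_mult:
  assumes "ps.finite_dim U"
  shows "ps.finite_dim ((*) L ` U)"
proof -
  obtain B where B: "finite B" "U \<subseteq> ps.span B" using assms unfolding ps.finite_dim_def by blast
  have "(*) L ` U \<subseteq> ps.span ((*) L ` B)" using B(2) mult_mem_span_image by blast
  then show ?thesis using B(1) unfolding ps.finite_dim_def by blast
qed

lemma dim_image_mult_le:
  assumes "ps.finite_dim U"
  shows "ps.dim ((*) L ` U) \<le> ps.dim U"
proof -
  obtain B where B: "finite B" "U \<subseteq> ps.span B" "card B = ps.dim U"
    using ps.finite_dim_basis[OF assms] by metis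
  have "(*) L ` U \<subseteq> ps.span ((*) L ` B)" using B(2) mult_mem_span_image by blast
  then have "ps.dim ((*) L ` U) \<le> card ((*) L ` B)" using B(1) by (intro ps.dim_le_card) auto
  also have "\<dots> \<le> card B" using B(1) by (rule card_image_le)
  finally show ?thesis using B(3) by simp
qed

lemma dim_image_mult:
  assumes "ps.finite_dim U" "ps.subspace U" "L \<noteq> 0"
  shows "ps.dim ((*) L ` U) = ps.dim U"
proof (rule antisym[OF dim_image_mult_le[OF assms(1)]])
  obtain B where B: "finite B" "B \<subseteq> U" "ps.independent B" "card B = ps.dim U"
    using ps.finite_dim_basis[OF assms(1)] by metis
  have "ps.independent ((*) L ` B)"
  proof (rule ps.independent_if_scalars_zero)
    fix u m assume *: "(\<Sum>m\<in>(*) L ` B. ps_const (u m) * m) = 0" and "m \<in> (*) L ` B"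
    then obtain b where b: "b \<in> B" "m = L * b" by auto
    have "(\<Sum>m\<in>(*) L ` B. ps_const (u m) * m) = L * (\<Sum>b\<in>B. ps_const (u (L * b)) * b)"
      using assms(3) by (subst sum.reindex) (auto simp: inj_on_def sum_distrib_left mult_ac)
    with * assms(3) have "(\<Sum>b\<in>B. ps_const (u (L * b)) * b) = 0" by simp
    then show "u m = 0" using ps.independentD[OF B(3) B(1) subset_refl, of "\<lambda>b. u (L * b)" b] b by simp
  qed (use B(1) in simp)
  then have "ps.dim ((*) L ` B) = card ((*) L ` B)" by (rule ps.dim_eq_card_independent)
  also have "\<dots> = card B" using assms(3) by (intro card_image) (auto simp: inj_on_def)
  finally have "ps.dim ((*) L ` B) = ps.dim U" using B(4) by simp
  moreover have "ps.dim ((*) L ` B) \<le> ps.dim ((*) L ` U)"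
    using B(2) by (intro ps.dim_mono_finite finite_dim_image_mult assms image_mono)
  ultimately show "ps.dim U \<le> ps.dim ((*) L ` U)" by simp
qed

section \<open>Linear coordinates\<close>

lemmas xyz_forms_Suc_0 [simp] = xyz_forms[unfolded One_nat_def]

text \<open>Only spanning is demanded: the linear forms have dimension 3, so a spanning triple is a
  basis. The resulting independence is \<open>linear_coords_independent\<close>.\<close>

definition linear_coords :: "'k::field pser3 \<Rightarrow> 'k pser3 \<Rightarrow> 'k pser3 \<Rightarrow> bool"
  where "linear_coords P Q R \<longleftrightarrow> {P, Q, R} \<subseteq> forms 1 \<and>
    (\<forall>l \<in> forms 1. \<exists>a b c. l = ps_const a * P + ps_const b * Q + ps_const c * R)"

lemma linear_form_xyz:
  "l \<in> forms 1 \<Longrightarrow> l = ps_const (ps_coeff l 1 0 0) * ps_x + ps_const (ps_coeff l 0 1 0) * ps_y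
     + ps_const (ps_coeff l 0 0 1) * ps_z"
proof (rule ps_eqI)
  fix i j k :: nat assume l: "l \<in> forms 1"
  have "i + j + k \<noteq> 1 \<or> (i = 1 \<and> j = 0 \<and> k = 0) \<or> (i = 0 \<and> j = 1 \<and> k = 0) \<or> (i = 0 \<and> j = 0 \<and> k = 1)"
    by arith
  then show "ps_coeff l i j k = ps_coeff (ps_const (ps_coeff l 1 0 0) * ps_x
      + ps_const (ps_coeff l 0 1 0) * ps_y + ps_const (ps_coeff l 0 0 1) * ps_z) i j k"
    using l by (auto simp: ps_coeff_xyz forms_def)
qed

lemma linear_coordsI:
  assumes "P \<in> forms 1" "Q \<in> forms 1" "R \<in> forms 1"
    "ps_x = ps_const x1 * P + ps_const x2 * Q + ps_const x3 * R"
    "ps_y = ps_const y1 * P + ps_const y2 * Q + ps_const y3 * R"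
    "ps_z = ps_const z1 * P + ps_const z2 * Q + ps_const z3 * R"
  shows "linear_coords P Q R"
  unfolding linear_coords_def
proof (intro conjI ballI)
  fix l :: "'a pser3" assume l: "l \<in> forms 1"
  let ?a = "ps_coeff l 1 0 0" and ?b = "ps_coeff l 0 1 0" and ?c = "ps_coeff l 0 0 1"
  have "l = ps_const (?a * x1 + ?b * y1 + ?c * z1) * P + ps_const (?a * x2 + ?b * y2 + ?c * z2) * Q
      + ps_const (?a * x3 + ?b * y3 + ?c * z3) * R"
    by (subst linear_form_xyz[OF l], subst assms(4), subst assms(5), subst assms(6))
       (simp add: ps_const_add ps_const_mult algebra_simps)
  then show "\<exists>a b c. l = ps_const a * P + ps_const b * Q + ps_const c * R" by blast
qed (use assms in simp)

lemma linear_coords_xyz: "linear_coords ps_x ps_y ps_z"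
  by (rule linear_coordsI[of _ _ _ 1 0 0 0 1 0 0 0 1]) simp_all

lemma linear_coords_formsD:
  assumes "linear_coords P Q R"
  shows "P \<in> forms 1" "Q \<in> forms 1" "R \<in> forms 1"
  using assms by (simp_all add: linear_coords_def)

lemma linear_coords_swap:
  assumes "linear_coords P Q R"
  shows "linear_coords Q P R" "linear_coords P R Q"
proof -
  have *: "\<exists>a b c. l = ps_const b * Q + ps_const a * P + ps_const c * R"
      "\<exists>a b c. l = ps_const a * P + ps_const c * R + ps_const b * Q" if l: "l \<in> forms 1" for l
  proof -
    obtain a b c where "l = ps_const a * P + ps_const b * Q + ps_const c * R"
      using assms l unfolding linear_coords_def by blast
    then have "l = ps_const b * Q + ps_const a * P + ps_const c * R"
        "l = ps_const a * P + ps_const c * R + ps_const b * Q" by (simp_all only: add_ac)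
    then show "\<exists>a b c. l = ps_const b * Q + ps_const a * P + ps_const c * R"
      "\<exists>a b c. l = ps_const a * P + ps_const c * R + ps_const b * Q" by blast+
  qed
  show "linear_coords Q P R" unfolding linear_coords_def
  proof (intro conjI ballI)
    show "{Q, P, R} \<subseteq> forms 1" using assms unfolding linear_coords_def by blast
  qed (use *(1) in blast)
  show "linear_coords P R Q" unfolding linear_coords_def
  proof (intro conjI ballI)
    show "{P, R, Q} \<subseteq> forms 1" using assms unfolding linear_coords_def by blast
  qed (use *(2) in blast)
qed

lemma linear_coords_independent:
  assumes "linear_coords P Q R" "ps_const a * P + ps_const b * Q + ps_const c * R = 0"
  shows "a = 0 \<and> b = 0 \<and> c = 0"
proof -
  have sp: "forms 1 \<subseteq> ps.span {P, Q, R}"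
  proof
    fix l :: "'a pser3" assume "l \<in> forms 1"
    then obtain a b c where "l = ps_const a * P + ps_const b * Q + ps_const c * R"
      using assms(1) unfolding linear_coords_def by blast
    moreover have "ps_const a * P + ps_const b * Q + ps_const c * R \<in> ps.span {P, Q, R}"
      by (intro ps.span_add ps.span_scale ps.span_base) simp_all
    ultimately show "l \<in> ps.span {P, Q, R}" by metis
  qed
  have no2: "False" if "forms 1 \<subseteq> ps.span {U, V}" for U V :: "'a pser3"
  proof -
    have "ps.dim (forms 1 :: 'a pser3 set) \<le> card {U, V}"
      using that by (intro ps.dim_le_card) auto
    moreover have "card {U, V} \<le> 2" by (simp add: card_insert_if)
    ultimately show False by (simp add: dim_forms_1[unfolded One_nat_def])
  qed
  have *: "False" if u: "d \<noteq> 0" "ps_const d * U + ps_const e * V + ps_const f * W = 0"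
      "forms 1 \<subseteq> ps.span {U, V, W}" for U V W :: "'a pser3" and d e f
  proof -
    have "U = ps_const (inverse d) * (ps_const d * U)"
      using u(1) by (simp add: mult.assoc[symmetric] ps_const_mult[symmetric])
    also have "ps_const d * U = ps_const (- e) * V + ps_const (- f) * W"
      using u(2) by (simp add: ps_const_uminus algebra_simps eq_neg_iff_add_eq_0)
    finally have "U = ps_const (inverse d) * (ps_const (- e) * V + ps_const (- f) * W)" .
    moreover have "ps_const (inverse d) * (ps_const (- e) * V + ps_const (- f) * W) \<in> ps.span {V, W}"
      by (intro ps.span_add ps.span_scale ps.span_base) simp_all
    ultimately have "U \<in> ps.span {V, W}" by metis
    then have "ps.span {U, V, W} \<subseteq> ps.span {V, W}"
      by (intro ps.span_minimal) (auto intro: ps.span_base)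
    then show False using u(3) no2 by blast
  qed
  show ?thesis
  proof (intro conjI)
    show "a = 0" using *[of a P b Q c R] assms(2) sp by blast
    have "ps_const b * Q + ps_const a * P + ps_const c * R = 0" "ps_const c * R + ps_const a * P + ps_const b * Q = 0"
      using assms(2) by (simp_all only: add_ac)
    moreover have "{Q, P, R} = {P, Q, R}" "{R, P, Q} = {P, Q, R}" by blast+
    ultimately show "b = 0" "c = 0" using *[of b Q a P c R] *[of c R a P b Q] sp by metis+
  qed
qed

lemma linear_coords_extend2:
  assumes "l1 \<in> forms 1" "l2 \<in> forms 1"
    and indep: "\<And>a b. ps_const a * l1 + ps_const b * l2 = 0 \<Longrightarrow> a = 0 \<and> b = 0"
  obtains w where "linear_coords l1 l2 w"
proof -
  have "ps.independent {l1, l2}"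
  proof -
    have "l2 \<noteq> 0" using indep[of 0 1] by auto
    moreover have "l1 \<notin> ps.span {l2}"
    proof
      assume "l1 \<in> ps.span {l2}"
      then obtain c where "l1 = ps_const c * l2" unfolding ps.span_singleton by blast
      then show False using indep[of 1 "- c"] by (simp add: ps_const_uminus)
    qed
    moreover have "ps.independent {l2}" using \<open>l2 \<noteq> 0\<close> by (simp only: ps.dependent_single) simp
    ultimately show ?thesis using ps.independent_insertI[of l1 "{l2}"] by blast
  qed
  moreover have "card {l1, l2} \<le> 2" by (simp add: card_insert_if)
  moreover have "\<not> forms 1 \<subseteq> ps.span {l1, l2}"
  proof
    assume "forms 1 \<subseteq> ps.span {l1, l2}"
    then have "ps.dim (forms 1 :: 'a pser3 set) \<le> card {l1, l2}" by (intro ps.dim_le_card) auto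
    with \<open>card {l1, l2} \<le> 2\<close> show False by (simp add: dim_forms_1[unfolded One_nat_def])
  qed
  then obtain w where w: "w \<in> forms 1" "w \<notin> ps.span {l1, l2}" by blast
  ultimately have ind: "ps.independent {w, l1, l2}" using ps.independent_insertI[of w "{l1, l2}"] by blast
  have "l1 \<noteq> l2" using indep[of 1 "- 1"] by (auto simp: ps_const_uminus)
  moreover have "w \<noteq> l1" "w \<noteq> l2" using w(2) ps.span_base[of w "{l1, l2}"] by blast+
  ultimately have "card {w, l1, l2} = 3" by simp
  then have d: "ps.dim (ps.span {w, l1, l2}) = 3" using ps.dim_span_eq_card_independent[OF ind] by simp
  have sub: "ps.span {w, l1, l2} \<subseteq> forms 1"
    using assms(1,2) w(1) by (intro ps.span_minimal forms_subspace) auto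
  have eq: "ps.span {w, l1, l2} = forms 1"
    by (rule ps.subspace_eq_of_dim_le[OF finite_dim_forms forms_subspace ps.subspace_span sub])
       (simp only: d dim_forms_1)
  show ?thesis
  proof (rule that, unfold linear_coords_def, intro conjI ballI)
    fix l :: "'a pser3" assume "l \<in> forms 1"
    then have "l \<in> ps.span {w, l1, l2}" using eq by simp
    then obtain a where "l - ps_const a * w \<in> ps.span {l1, l2}"
      unfolding ps.span_breakdown_eq[of l w] by blast
    then obtain b where "l - ps_const a * w - ps_const b * l1 \<in> ps.span {l2}"
      unfolding ps.span_breakdown_eq[of _ l1] by blast
    then obtain c where "l - ps_const a * w - ps_const b * l1 = ps_const c * l2"
      unfolding ps.span_singleton by blast
    then have "l = ps_const b * l1 + ps_const c * l2 + ps_const a * w" by (simp add: algebra_simps)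
    then show "\<exists>a b c. l = ps_const a * l1 + ps_const b * l2 + ps_const c * w" by blast
  qed (use assms w in simp)
qed

lemma linear_coords_extend1:
  assumes "L \<in> forms 1" "L \<noteq> 0"
  obtains Q R where "linear_coords L Q R"
proof -
  have "\<not> forms 1 \<subseteq> ps.span {L}"
  proof
    assume "forms 1 \<subseteq> ps.span {L}"
    then have "ps.dim (forms 1 :: 'a pser3 set) \<le> card {L}" by (intro ps.dim_le_card) auto
    then show False by (simp add: dim_forms_1[unfolded One_nat_def])
  qed
  then obtain Q where Q: "Q \<in> forms 1" "Q \<notin> ps.span {L}" by blast
  have "a = 0 \<and> b = 0" if "ps_const a * L + ps_const b * Q = 0" for a b
  proof -
    have "b = 0"
    proof (rule ccontr)
      assume "b \<noteq> 0"
      have "Q = ps_const (inverse b) * (ps_const b * Q)"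
        using \<open>b \<noteq> 0\<close> by (simp add: mult.assoc[symmetric] ps_const_mult[symmetric])
      also have "ps_const b * Q = ps_const (- a) * L"
        using that by (simp add: ps_const_uminus eq_neg_iff_add_eq_0 add.commute)
      finally have "Q = ps_const (inverse b) * (ps_const (- a) * L)" .
      then show False using Q(2) by (metis ps.span_base ps.span_scale singletonI)
    qed
    then show ?thesis using that assms(2) by simp
  qed
  then obtain R where "linear_coords L Q R" using linear_coords_extend2[OF assms(1) Q(1)] by blast
  then show ?thesis using that by blast
qed

lemma forms_Suc_split3:
  assumes "linear_coords P Q R" "F \<in> forms (Suc t)"
  obtains A B C where "A \<in> forms t" "B \<in> forms t" "C \<in> forms t" "F = P * A + Q * B + R * C"
proof -
  obtain a b c where abc: "a \<in> forms t" "b \<in> forms t" "c \<in> forms t" "F = ps_x * a + ps_y * b + ps_z * c"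
    using forms_Suc_split[OF assms(2)] .
  obtain x1 x2 x3 where x: "ps_x = ps_const x1 * P + ps_const x2 * Q + ps_const x3 * R"
    using assms(1) xyz_forms(1) unfolding linear_coords_def by blast
  obtain y1 y2 y3 where y: "ps_y = ps_const y1 * P + ps_const y2 * Q + ps_const y3 * R"
    using assms(1) xyz_forms(2) unfolding linear_coords_def by blast
  obtain z1 z2 z3 where z: "ps_z = ps_const z1 * P + ps_const z2 * Q + ps_const z3 * R"
    using assms(1) xyz_forms(3) unfolding linear_coords_def by blast
  show ?thesis
  proof (rule that)
    show "F = P * (ps_const x1 * a + ps_const y1 * b + ps_const z1 * c)
        + Q * (ps_const x2 * a + ps_const y2 * b + ps_const z2 * c)
        + R * (ps_const x3 * a + ps_const y3 * b + ps_const z3 * c)"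
      unfolding abc(4) x y z by (simp add: algebra_simps)
  qed (use abc in \<open>auto intro!: forms_add forms_scale\<close>)
qed

text \<open>Splitting the coefficient of \<open>R\<close> again and again leaves a pure power of
  \<open>R\<close>; this is the graded isomorphism of the quotient by \<open>(P, Q)\<close> with
  \<open>K[R]\<close>.\<close>

lemma forms_Suc_split_power:
  assumes "linear_coords P Q R" "F \<in> forms (Suc t)"
  obtains A B c where "A \<in> forms t" "B \<in> forms t" "F = P * A + Q * B + ps_const c * R ^ Suc t"
proof -
  have "\<exists>A\<in>forms t. \<exists>B\<in>forms t. \<exists>c. F = P * A + Q * B + ps_const c * R ^ Suc t"
    using assms(2)
  proof (induction t arbitrary: F)
    case 0
    then obtain A B C where *: "A \<in> forms 0" "B \<in> forms 0" "C \<in> forms 0" "F = P * A + Q * B + R * C"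
      using forms_Suc_split3[OF assms(1)] by metis
    have "F = P * A + Q * B + ps_const (ps_coeff C 0 0 0) * R ^ Suc 0"
      using *(4) forms_0_const[OF *(3)] by (simp add: mult.commute)
    then show ?case using * by blast
  next
    case (Suc t)
    obtain A B C where *: "A \<in> forms (Suc t)" "B \<in> forms (Suc t)" "C \<in> forms (Suc t)" "F = P * A + Q * B + R * C"
      using forms_Suc_split3[OF assms(1) Suc.prems] by metis
    obtain A' B' c where **: "A' \<in> forms t" "B' \<in> forms t" "C = P * A' + Q * B' + ps_const c * R ^ Suc t"
      using Suc.IH[OF *(3)] by blast
    have "F = P * (A + R * A') + Q * (B + R * B') + ps_const c * R ^ Suc (Suc t)"
      unfolding *(4) **(3) by (simp add: algebra_simps)
    moreover have "A + R * A' \<in> forms (Suc t)" "B + R * B' \<in> forms (Suc t)"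
      using * ** linear_coords_formsD(3)[OF assms(1)] by (auto intro!: forms_add forms_mult_Suc[unfolded One_nat_def])
    ultimately show ?case by blast
  qed
  then show ?thesis using that by blast
qed

section \<open>Substitution into forms and dehomogenization\<close>

definition form_eval :: "'k::field poly \<Rightarrow> 'k poly \<Rightarrow> 'k poly \<Rightarrow> nat \<Rightarrow> 'k pser3 \<Rightarrow> 'k poly"
  where "form_eval A B C t F = (\<Sum>(i, j, k)\<in>exponents t. smult (ps_coeff F i j k) (A ^ i * B ^ j * C ^ k))"

lemma form_eval_add: "form_eval A B C t (F + G) = form_eval A B C t F + form_eval A B C t G"
  by (simp add: form_eval_def case_prod_unfold smult_add_left sum.distrib)

lemma form_eval_scale: "form_eval A B C t (ps_const c * F) = smult c (form_eval A B C t F)"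
proof -
  have "smult c (\<Sum>p\<in>S. f p) = (\<Sum>p\<in>S. smult c (f p))" for S and f :: "nat \<times> nat \<times> nat \<Rightarrow> 'a poly"
    by (induction S rule: infinite_finite_induct) (simp_all add: smult_add_right)
  then show ?thesis by (simp add: form_eval_def case_prod_unfold)
qed

lemma form_eval_1: "form_eval A B C 0 1 = 1"
proof -
  have "exponents 0 = {(0, 0, 0)}" by (auto simp: exponents_def)
  then show ?thesis by (simp add: form_eval_def ps_coeff_1)
qed

lemma form_eval_x_mult: "form_eval A B C (Suc t) (ps_x * F) = A * form_eval A B C t F"
proof -
  have "form_eval A B C (Suc t) (ps_x * F) =
      (\<Sum>(i, j, k)\<in>(\<lambda>(i, j, k). (Suc i, j, k)) ` exponents t. smult (ps_coeff (ps_x * F) i j k) (A ^ i * B ^ j * C ^ k))"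
    unfolding form_eval_def
  proof (rule sum.mono_neutral_right)
    show "\<forall>p\<in>exponents (Suc t) - (\<lambda>(i, j, k). (Suc i, j, k)) ` exponents t.
        (case p of (i, j, k) \<Rightarrow> smult (ps_coeff (ps_x * F) i j k) (A ^ i * B ^ j * C ^ k)) = 0"
    proof
      fix p assume p: "p \<in> exponents (Suc t) - (\<lambda>(i, j, k). (Suc i, j, k)) ` exponents t"
      obtain i j k where [simp]: "p = (i, j, k)" by (cases p)
      have "i = 0"
      proof (rule ccontr)
        assume "i \<noteq> 0"
        then have "p = (\<lambda>(i, j, k). (Suc i, j, k)) (i - 1, j, k)" "(i - 1, j, k) \<in> exponents t"
          using p by (auto simp: exponents_def)
        then show False using p by blast
      qed
      then show "(case p of (i, j, k) \<Rightarrow> smult (ps_coeff (ps_x * F) i j k) (A ^ i * B ^ j * C ^ k)) = 0" by simp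
    qed
  qed (auto simp: exponents_def intro: finite_exponents)
  also have "\<dots> = A * form_eval A B C t F"
    by (subst sum.reindex)
       (auto simp: inj_on_def form_eval_def sum_distrib_left case_prod_unfold mult_ac intro!: sum.cong)
  finally show ?thesis .
qed

lemma form_eval_y_mult: "form_eval A B C (Suc t) (ps_y * F) = B * form_eval A B C t F"
proof -
  have "form_eval A B C (Suc t) (ps_y * F) =
      (\<Sum>(i, j, k)\<in>(\<lambda>(i, j, k). (i, Suc j, k)) ` exponents t. smult (ps_coeff (ps_y * F) i j k) (A ^ i * B ^ j * C ^ k))"
    unfolding form_eval_def
  proof (rule sum.mono_neutral_right)
    show "\<forall>p\<in>exponents (Suc t) - (\<lambda>(i, j, k). (i, Suc j, k)) ` exponents t.
        (case p of (i, j, k) \<Rightarrow> smult (ps_coeff (ps_y * F) i j k) (A ^ i * B ^ j * C ^ k)) = 0"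
    proof
      fix p assume p: "p \<in> exponents (Suc t) - (\<lambda>(i, j, k). (i, Suc j, k)) ` exponents t"
      obtain i j k where [simp]: "p = (i, j, k)" by (cases p)
      have "j = 0"
      proof (rule ccontr)
        assume "j \<noteq> 0"
        then have "p = (\<lambda>(i, j, k). (i, Suc j, k)) (i, j - 1, k)" "(i, j - 1, k) \<in> exponents t"
          using p by (auto simp: exponents_def)
        then show False using p by blast
      qed
      then show "(case p of (i, j, k) \<Rightarrow> smult (ps_coeff (ps_y * F) i j k) (A ^ i * B ^ j * C ^ k)) = 0" by simp
    qed
  qed (auto simp: exponents_def intro: finite_exponents)
  also have "\<dots> = B * form_eval A B C t F"
    by (subst sum.reindex)
       (auto simp: inj_on_def form_eval_def sum_distrib_left case_prod_unfold mult_ac intro!: sum.cong)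
  finally show ?thesis .
qed

lemma form_eval_z_mult: "form_eval A B C (Suc t) (ps_z * F) = C * form_eval A B C t F"
proof -
  have "form_eval A B C (Suc t) (ps_z * F) =
      (\<Sum>(i, j, k)\<in>(\<lambda>(i, j, k). (i, j, Suc k)) ` exponents t. smult (ps_coeff (ps_z * F) i j k) (A ^ i * B ^ j * C ^ k))"
    unfolding form_eval_def
  proof (rule sum.mono_neutral_right)
    show "\<forall>p\<in>exponents (Suc t) - (\<lambda>(i, j, k). (i, j, Suc k)) ` exponents t.
        (case p of (i, j, k) \<Rightarrow> smult (ps_coeff (ps_z * F) i j k) (A ^ i * B ^ j * C ^ k)) = 0"
    proof
      fix p assume p: "p \<in> exponents (Suc t) - (\<lambda>(i, j, k). (i, j, Suc k)) ` exponents t"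
      obtain i j k where [simp]: "p = (i, j, k)" by (cases p)
      have "k = 0"
      proof (rule ccontr)
        assume "k \<noteq> 0"
        then have "p = (\<lambda>(i, j, k). (i, j, Suc k)) (i, j, k - 1)" "(i, j, k - 1) \<in> exponents t"
          using p by (auto simp: exponents_def)
        then show False using p by blast
      qed
      then show "(case p of (i, j, k) \<Rightarrow> smult (ps_coeff (ps_z * F) i j k) (A ^ i * B ^ j * C ^ k)) = 0" by simp
    qed
  qed (auto simp: exponents_def intro: finite_exponents)
  also have "\<dots> = C * form_eval A B C t F"
    by (subst sum.reindex)
       (auto simp: inj_on_def form_eval_def sum_distrib_left case_prod_unfold mult_ac intro!: sum.cong)
  finally show ?thesis .
qed

text \<open>The homogenization of \<open>p\<close> to degree \<open>t\<close> in \<open>Q\<close>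
  and \<open>R\<close>. It inverts the dehomogenization up to multiples of \<open>P\<close> and
  thereby exhibits the kernel; coefficients of \<open>p\<close> above \<open>t\<close> would be cut
  off, which is why degree bounds accompany it.\<close>

definition binary_form :: "'k::field pser3 \<Rightarrow> 'k pser3 \<Rightarrow> nat \<Rightarrow> 'k poly \<Rightarrow> 'k pser3"
  where "binary_form Q R t p = (\<Sum>j\<le>t. ps_const (coeff p j) * (Q ^ j * R ^ (t - j)))"

lemma binary_form_add: "binary_form Q R t (p + q) = binary_form Q R t p + binary_form Q R t q"
  by (simp add: binary_form_def ps_const_add distrib_right sum.distrib)

lemma binary_form_pCons: "binary_form Q R (Suc t) (pCons 0 p) = Q * binary_form Q R t p"
proof -
  have "binary_form Q R (Suc t) (pCons 0 p) = (\<Sum>j\<le>t. ps_const (coeff p j) * (Q ^ Suc j * R ^ (t - j)))"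
    unfolding binary_form_def by (subst sum.atMost_Suc_shift) simp
  then show ?thesis by (simp add: binary_form_def sum_distrib_left mult_ac)
qed

lemma binary_form_Suc:
  assumes "degree p \<le> t"
  shows "binary_form Q R (Suc t) p = R * binary_form Q R t p"
proof -
  have "coeff p (Suc t) = 0" using assms by (intro coeff_eq_0) simp
  then have "binary_form Q R (Suc t) p = (\<Sum>j\<le>t. ps_const (coeff p j) * (Q ^ j * R ^ (Suc t - j)))"
    unfolding binary_form_def by simp
  also have "\<dots> = R * binary_form Q R t p"
    unfolding binary_form_def sum_distrib_left
    by (intro sum.cong) (auto simp: Suc_diff_le mult_ac)
  finally show ?thesis .
qed

text \<open>The substitution \<open>P \<mapsto> 0, Q \<mapsto> T, R \<mapsto> 1\<close> on forms.  The degree of the form is an argument because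
  the maps for different degrees do not glue to a map on power series.\<close>

definition dehomogenization :: "'k::field pser3 \<Rightarrow> 'k pser3 \<Rightarrow> 'k pser3 \<Rightarrow> (nat \<Rightarrow> 'k pser3 \<Rightarrow> 'k poly) \<Rightarrow> bool"
  where "dehomogenization P Q R \<theta> \<longleftrightarrow>
    (\<forall>t F G. \<theta> t (F + G) = \<theta> t F + \<theta> t G) \<and>
    (\<forall>t c F. \<theta> t (ps_const c * F) = smult c (\<theta> t F)) \<and>
    \<theta> 0 1 = 1 \<and>
    (\<forall>t F. \<theta> (Suc t) (P * F) = 0) \<and>
    (\<forall>t F. \<theta> (Suc t) (Q * F) = pCons 0 (\<theta> t F)) \<and>
    (\<forall>t F. \<theta> (Suc t) (R * F) = \<theta> t F) \<and>
    (\<forall>t. \<forall>F\<in>forms (Suc t). \<theta> (Suc t) F = 0 \<longrightarrow> (\<exists>F'\<in>forms t. F = P * F'))"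

lemma dehomogenization_exists:
  assumes co: "linear_coords P Q R"
  shows "\<exists>\<theta>. dehomogenization P Q R \<theta>"
proof -
  obtain x1 x2 x3 where x: "ps_x = ps_const x1 * P + ps_const x2 * Q + ps_const x3 * R"
    using co xyz_forms(1) unfolding linear_coords_def by blast
  obtain y1 y2 y3 where y: "ps_y = ps_const y1 * P + ps_const y2 * Q + ps_const y3 * R"
    using co xyz_forms(2) unfolding linear_coords_def by blast
  obtain z1 z2 z3 where z: "ps_z = ps_const z1 * P + ps_const z2 * Q + ps_const z3 * R"
    using co xyz_forms(3) unfolding linear_coords_def by blast
  \<comment> \<open>Under \<open>P\<close> to 0, \<open>Q\<close> to \<open>T\<close> and
    \<open>R\<close> to 1, the variable \<open>x = x1 P + x2 Q + x3 R\<close> goes to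
    \<open>x3 + x2 T\<close>, and likewise \<open>y\<close> and \<open>z\<close>.\<close>
  define \<theta> where "\<theta> = form_eval [:x3, x2:] [:y3, y2:] [:z3, z2:]"
  have add: "\<theta> t (F + G) = \<theta> t F + \<theta> t G" and scale: "\<theta> t (ps_const c * F) = smult c (\<theta> t F)" for t c F G
    by (simp_all add: \<theta>_def form_eval_add form_eval_scale)
  have one: "\<theta> 0 1 = 1" by (simp add: \<theta>_def form_eval_1)
  \<comment> \<open>A linear form has only one expression in \<open>P, Q, R\<close>, so evaluating
    it through \<open>x, y, z\<close> gives the value read off from any expression in the new
    coordinates.\<close>
  have lin: "\<theta> (Suc t) (l * F) = [:q3, q2:] * \<theta> t F"
    if l: "l \<in> forms 1" "l = ps_const q1 * P + ps_const q2 * Q + ps_const q3 * R" for l F t q1 q2 q3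
  proof -
    let ?a = "ps_coeff l 1 0 0" and ?b = "ps_coeff l 0 1 0" and ?c = "ps_coeff l 0 0 1"
    have l': "l = ps_const ?a * ps_x + ps_const ?b * ps_y + ps_const ?c * ps_z"
      by (rule linear_form_xyz[OF l(1)])
    have "ps_const (?a * x1 + ?b * y1 + ?c * z1 - q1) * P + ps_const (?a * x2 + ?b * y2 + ?c * z2 - q2) * Q
        + ps_const (?a * x3 + ?b * y3 + ?c * z3 - q3) * R =
        (ps_const ?a * (ps_const x1 * P + ps_const x2 * Q + ps_const x3 * R)
         + ps_const ?b * (ps_const y1 * P + ps_const y2 * Q + ps_const y3 * R)
         + ps_const ?c * (ps_const z1 * P + ps_const z2 * Q + ps_const z3 * R))
        - (ps_const q1 * P + ps_const q2 * Q + ps_const q3 * R)"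
      by (simp add: ps_const_add ps_const_mult ps_const_diff algebra_simps)
    also have "\<dots> = 0"
      unfolding x[symmetric] y[symmetric] z[symmetric] l'[symmetric] l(2)[symmetric] by simp
    finally have "?a * x2 + ?b * y2 + ?c * z2 - q2 = 0 \<and> ?a * x3 + ?b * y3 + ?c * z3 - q3 = 0"
      using linear_coords_independent[OF co] by blast
    then have "smult ?a [:x3, x2:] + smult ?b [:y3, y2:] + smult ?c [:z3, z2:] = [:q3, q2:]" by simp
    moreover have "\<theta> (Suc t) (l * F) =
        (smult ?a [:x3, x2:] + smult ?b [:y3, y2:] + smult ?c [:z3, z2:]) * \<theta> t F"
    proof -
      have "l * F = ps_const ?a * (ps_x * F) + ps_const ?b * (ps_y * F) + ps_const ?c * (ps_z * F)"
        by (subst l') (simp add: algebra_simps)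
      then show ?thesis
        unfolding \<theta>_def
        by (simp only: form_eval_add form_eval_scale form_eval_x_mult form_eval_y_mult form_eval_z_mult
            distrib_right mult_smult_left)
    qed
    ultimately show ?thesis by simp
  qed
  have P: "\<theta> (Suc t) (P * F) = 0" for t F
    using lin[of P 1 0 0 t F] linear_coords_formsD[OF co] by simp
  have Q: "\<theta> (Suc t) (Q * F) = pCons 0 (\<theta> t F)" for t F
    using lin[of Q 0 1 0 t F] linear_coords_formsD[OF co] by simp
  have R: "\<theta> (Suc t) (R * F) = \<theta> t F" for t F
    using lin[of R 0 0 1 t F] linear_coords_formsD[OF co] by simp
  \<comment> \<open>A form differs from the homogenization of its image by a multiple of
    \<open>P\<close>, so a form with image 0 is divisible by \<open>P\<close>. The cofactor
    \<open>u\<close> has degree \<open>t - 1\<close>; in degree 0 it is fixed to be 0.\<close>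
  have main: "degree (\<theta> t F) \<le> t \<and>
      (\<exists>u. (t = 0 \<longrightarrow> u = 0) \<and> (\<forall>s. t = Suc s \<longrightarrow> u \<in> forms s) \<and> F = P * u + binary_form Q R t (\<theta> t F))"
    if "F \<in> forms t" for t F
    using that
  proof (induction t arbitrary: F)
    case 0
    have F: "F = ps_const (ps_coeff F 0 0 0) * 1" using forms_0_const[OF 0] by simp
    then have "\<theta> 0 F = smult (ps_coeff F 0 0 0) 1" using scale one by metis
    then show ?case using F by (auto simp: binary_form_def)
  next
    case (Suc t)
    obtain A B C where F: "A \<in> forms t" "B \<in> forms t" "C \<in> forms t" "F = P * A + Q * B + R * C"
      using forms_Suc_split3[OF co Suc.prems] by metis
    obtain u where u: "t = 0 \<longrightarrow> u = 0" "\<forall>s. t = Suc s \<longrightarrow> u \<in> forms s" "B = P * u + binary_form Q R t (\<theta> t B)"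
      using Suc.IH[OF F(2)] by blast
    obtain v where v: "t = 0 \<longrightarrow> v = 0" "\<forall>s. t = Suc s \<longrightarrow> v \<in> forms s" "C = P * v + binary_form Q R t (\<theta> t C)"
      using Suc.IH[OF F(3)] by blast
    have \<theta>F: "\<theta> (Suc t) F = pCons 0 (\<theta> t B) + \<theta> t C" unfolding F(4) by (simp add: add P Q R)
    have deg: "degree (\<theta> t B) \<le> t" "degree (\<theta> t C) \<le> t" using Suc.IH F by blast+
    have "degree (pCons 0 (\<theta> t B) + \<theta> t C) \<le> Suc t"
      using deg by (intro degree_add_le) (auto simp: degree_pCons_le intro: order_trans[OF degree_pCons_le])
    moreover have "A + Q * u + R * v \<in> forms t"
      using u v F(1) linear_coords_formsD[OF co]
      by (cases t) (auto intro!: forms_add forms_mult_Suc[unfolded One_nat_def])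
    moreover have "F = P * (A + Q * u + R * v) + binary_form Q R (Suc t) (\<theta> (Suc t) F)"
    proof -
      have "binary_form Q R (Suc t) (\<theta> (Suc t) F) = Q * binary_form Q R t (\<theta> t B) + R * binary_form Q R t (\<theta> t C)"
        unfolding \<theta>F binary_form_add binary_form_pCons binary_form_Suc[OF deg(2)] ..
      moreover have "F = P * A + Q * (P * u + binary_form Q R t (\<theta> t B)) + R * (P * v + binary_form Q R t (\<theta> t C))"
        using F(4) u(3) v(3) by metis
      ultimately show ?thesis by (simp add: algebra_simps)
    qed
    ultimately show ?case unfolding \<theta>F by (intro conjI exI[of _ "A + Q * u + R * v"]) simp_all
  qed
  have ker: "\<exists>F'\<in>forms t. F = P * F'" if "F \<in> forms (Suc t)" "\<theta> (Suc t) F = 0" for t F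
    using main[OF that(1)] that(2) by (auto simp: binary_form_def)
  have "dehomogenization P Q R \<theta>"
    unfolding dehomogenization_def using add scale one P Q R ker by simp
  then show ?thesis by blast
qed

section \<open>The curve cut out by a lifted syzygy\<close>

lemma dehomogenizationD:
  assumes "dehomogenization P Q R \<theta>"
  shows "\<theta> t (F + G) = \<theta> t F + \<theta> t G" "\<theta> t (ps_const c * F) = smult c (\<theta> t F)" "\<theta> 0 1 = 1"
    "\<theta> (Suc t) (P * F) = 0" "\<theta> (Suc t) (Q * F) = pCons 0 (\<theta> t F)" "\<theta> (Suc t) (R * F) = \<theta> t F"
    "F \<in> forms (Suc t) \<Longrightarrow> \<theta> (Suc t) F = 0 \<Longrightarrow> \<exists>F'\<in>forms t. F = P * F'"
  using assms unfolding dehomogenization_def by blast+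

text \<open>Dehomogenization sends powers of \<open>R\<close> to 1, kills multiples of
  \<open>P\<close> and makes multiples of \<open>Q\<close> divisible by \<open>T\<close>; the
  constant coefficients then give \<open>c = 0\<close>.\<close>

lemma power_notin_ideal:
  assumes co: "linear_coords P Q R" and "A \<in> forms t" "B \<in> forms t"
    and eq: "ps_const c * R ^ Suc t = P * A + Q * B"
  shows "c = 0"
proof -
  obtain \<theta> where "dehomogenization P Q R \<theta>" using dehomogenization_exists[OF co] by blast
  note \<theta> = dehomogenizationD[OF this]
  have "\<theta> s (R ^ s) = 1" for s
    by (induction s) (simp_all add: \<theta>)
  then have "smult c 1 = \<theta> (Suc t) (ps_const c * R ^ Suc t)" by (simp only: \<theta>(2))
  also have "\<dots> = pCons 0 (\<theta> t B)" unfolding eq by (simp add: \<theta>)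
  finally have "coeff (smult c 1) 0 = coeff (pCons 0 (\<theta> t B)) 0" by simp
  then show ?thesis by simp
qed

lemma linear_coords_nonzero:
  assumes "linear_coords P Q R"
  shows "P \<noteq> 0" "Q \<noteq> 0" "R \<noteq> 0"
  using linear_coords_independent[OF assms, of 1 0 0] linear_coords_independent[OF assms, of 0 1 0]
    linear_coords_independent[OF assms, of 0 0 1] by auto

text \<open>Dehomogenizing the relation kills \<open>P u\<close> and turns \<open>Q v\<close> into
  \<open>T\<close> times the image of \<open>v\<close>, so that image is 0 and \<open>P\<close>
  divides \<open>v\<close>. The last two conclusions say that \<open>c\<close> has degree
  \<open>t - 1\<close>, read as \<open>c = 0\<close> when \<open>t = 0\<close>.\<close>

lemma linear_syzygy:
  assumes co: "linear_coords P Q R" and "u \<in> forms t" "v \<in> forms t" "P * u + Q * v = 0"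
  obtains c where "u = Q * c" "v = - (P * c)" "t = 0 \<Longrightarrow> c = 0" "\<And>s. t = Suc s \<Longrightarrow> c \<in> forms s"
proof (cases t)
  case 0
  then have "u = ps_const (ps_coeff u 0 0 0)" "v = ps_const (ps_coeff v 0 0 0)"
    using forms_0_const assms(2,3) by blast+
  moreover from this have "ps_const (ps_coeff u 0 0 0) * P + ps_const (ps_coeff v 0 0 0) * Q + ps_const 0 * R = 0"
    using assms(4) by (simp add: mult.commute)
  then have "ps_coeff u 0 0 0 = 0" "ps_coeff v 0 0 0 = 0"
    using linear_coords_independent[OF co] by blast+
  ultimately have "u = 0" "v = 0" by simp_all
  then show ?thesis using that[of 0] 0 by simp
next
  case (Suc s)
  obtain \<theta> where "dehomogenization P Q R \<theta>" using dehomogenization_exists[OF co] by blast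
  note \<theta> = dehomogenizationD[OF this]
  have "\<theta> (Suc t) 0 = 0" using \<theta>(2)[of "Suc t" 0 0] by simp
  then have "pCons 0 (\<theta> t v) = 0" using \<theta>(1)[of "Suc t" "P * u" "Q * v"] assms(4) by (simp add: \<theta>(4,5))
  then have "\<theta> (Suc s) v = 0" unfolding Suc by simp
  then obtain v' where v': "v' \<in> forms s" "v = P * v'" using \<theta>(7)[of v s] assms(3) unfolding Suc by blast
  then have "P * (u + Q * v') = 0" using assms(4) by (simp add: algebra_simps)
  then have "u = - (Q * v')" using linear_coords_nonzero(1)[OF co] by (simp add: eq_neg_iff_add_eq_0)
  then show ?thesis using v' Suc that[of "- v'"] forms_uminus[of v'] by auto
qed

text \<open>The order filtration of \<open>K[[x,y,z]]/(a,b)\<close>, a power series ring in \<open>w\<close>, where \<open>a\<close> and \<open>b\<close> have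
  initial forms \<open>l2\<close> and \<open>- l1\<close>.\<close>

locale curve =
  fixes l1 l2 w a b :: "'k::field pser3"
  assumes co: "linear_coords l1 l2 w"
    and a: "a - l2 \<in> order_ge 2" and b: "b + l1 \<in> order_ge 2"
begin

lemma l_forms: "l1 \<in> forms 1" "l2 \<in> forms 1" "w \<in> forms 1"
  using linear_coords_formsD[OF co] .

lemma l_order: "l1 \<in> order_ge 1" "l2 \<in> order_ge 1" "w \<in> order_ge 1"
  using l_forms form_order_ge by blast+

lemma ab_order: "a \<in> order_ge 1" "b \<in> order_ge 1"
proof -
  have "a - l2 \<in> order_ge 1" by (rule order_ge_mono[OF _ a]) simp
  from order_ge_add[OF this l_order(2)] show "a \<in> order_ge 1" by simp
  have "b + l1 \<in> order_ge 1" by (rule order_ge_mono[OF _ b]) simp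
  from order_ge_diff[OF this l_order(1)] show "b \<in> order_ge 1" by simp
qed

lemma part_ab: "part 1 a = l2" "part 1 b = - l1"
proof -
  have "part 1 a = part 1 l2" by (rule part_eqI) (use a in \<open>simp add: numeral_2_eq_2\<close>)
  then show "part 1 a = l2" using l_forms part_of_form by metis
  have "part 1 b = part 1 (- l1)" by (rule part_eqI) (use b in \<open>simp add: numeral_2_eq_2\<close>)
  then show "part 1 b = - l1" using l_forms part_of_form forms_uminus by metis
qed

lemma part_Suc_ab:
  assumes "r \<in> order_ge k"
  shows "part (Suc k) (a * r) = l2 * part k r" "part (Suc k) (b * r) = - (l1 * part k r)"
  using part_mult[OF ab_order(1) assms] part_mult[OF ab_order(2) assms] part_ab by simp_all

text \<open>Exactness of the Koszul complex of \<open>a, b\<close> with control of orders: a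
  combination of order above \<open>k\<close> comes from coefficients of order at least
  \<open>k\<close>, up to a multiple of the trivial relation \<open>(b, - a)\<close>. The order is
  raised one at a time, because the leading components of the coefficients form a syzygy of
  \<open>l1, l2\<close>, which lifts to \<open>a, b\<close>.\<close>

lemma koszul_lift:
  assumes "a * r + b * s \<in> order_ge (Suc k)"
  obtains c where "r + c * b \<in> order_ge k" "s - c * a \<in> order_ge k"
proof -
  have "\<exists>c. r + c * b \<in> order_ge k \<and> s - c * a \<in> order_ge k"
    using assms
  proof (induction k)
    case (Suc k)
    then obtain c where c: "r + c * b \<in> order_ge k" "s - c * a \<in> order_ge k"
      using order_ge_mono[of "Suc k" "Suc (Suc k)"] by auto
    define r' s' where "r' = r + c * b" and "s' = s - c * a"
    have eq: "a * r' + b * s' = a * r + b * s" by (simp add: r'_def s'_def algebra_simps)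
    have "part (Suc k) (a * r' + b * s') = 0" unfolding eq using Suc.prems by (rule part_of_order_ge)
    then have "l1 * (- part k s') + l2 * part k r' = 0"
      using part_Suc_ab(1)[of r' k] part_Suc_ab(2)[of s' k] c by (simp add: part_add r'_def s'_def)
    then obtain d where d: "- part k s' = l2 * d" "part k r' = - (l1 * d)" "k = 0 \<Longrightarrow> d = 0" "\<And>j. k = Suc j \<Longrightarrow> d \<in> forms j"
      using linear_syzygy[OF co, of "- part k s'" k "part k r'"] forms_uminus[OF part_forms] part_forms by metis
    \<comment> \<open>\<open>d\<close> has degree \<open>k - 1\<close>, and multiplication by
      \<open>a\<close> and \<open>b\<close>, whose linear parts are \<open>l2\<close> and
      \<open>- l1\<close>, restores degree \<open>k\<close>; for \<open>k = 0\<close> the convention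
      \<open>d = 0\<close> applies.\<close>
    have "d * a \<in> order_ge k \<and> d * b \<in> order_ge k \<and> part k (d * a) = l2 * d \<and> part k (d * b) = - (l1 * d)"
    proof (cases k)
      case 0
      then show ?thesis using d(3) by simp
    next
      case (Suc j)
      then have "d \<in> forms j" using d(4) by simp
      then show ?thesis
        using part_Suc_ab[of d j] order_ge_mult[of d j a 1] order_ge_mult[of d j b 1] ab_order
        unfolding Suc by (simp add: form_order_ge part_of_form mult.commute)
    qed
    note db = this
    have "part k s' = - (l2 * d)" using d(1) by (metis add.inverse_inverse)
    then have "part k (r' - d * b) = 0" "part k (s' + d * a) = 0"
      using db d(2) by (simp_all add: part_diff part_add)
    moreover have "r' - d * b \<in> order_ge k" "s' + d * a \<in> order_ge k"
      using db c by (simp_all add: order_ge_diff order_ge_add r'_def s'_def)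
    ultimately have "r' - d * b \<in> order_ge (Suc k)" "s' + d * a \<in> order_ge (Suc k)"
      using order_ge_SucI by blast+
    moreover have "r' - d * b = r + (c - d) * b" "s' + d * a = s - (c - d) * a"
      by (simp_all add: r'_def s'_def algebra_simps)
    ultimately show ?case by metis
  qed simp
  then show ?thesis using that by blast
qed

text \<open>These are the series whose restriction to the curve has order at least \<open>k\<close>,
  that is, the ideal \<open>(a, b)\<close> plus the \<open>k\<close>-th power of the maximal
  ideal.\<close>

definition V :: "nat \<Rightarrow> 'k pser3 set"
  where "V k = {a * r + b * s + e | r s e. e \<in> order_ge k}"

lemma V_I: "e \<in> order_ge k \<Longrightarrow> a * r + b * s + e \<in> V k"
  by (auto simp: V_def)

lemma order_ge_V: "e \<in> order_ge k \<Longrightarrow> e \<in> V k"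
  using V_I[of e k 0 0] by simp

lemma ab_V: "a * r + b * s \<in> V k"
  using V_I[of 0 k r s] by simp

lemma V_0: "r \<in> V 0"
  by (rule order_ge_V) simp

lemma V_E:
  assumes "r \<in> V k"
  obtains u v e where "e \<in> order_ge k" "r = a * u + b * v + e"
  using assms unfolding V_def by blast

lemma V_add:
  assumes "r \<in> V k" "s \<in> V k"
  shows "r + s \<in> V k"
proof -
  obtain u v e where 1: "e \<in> order_ge k" "r = a * u + b * v + e" using V_E[OF assms(1)] .
  obtain u' v' e' where 2: "e' \<in> order_ge k" "s = a * u' + b * v' + e'" using V_E[OF assms(2)] .
  have "r + s = a * (u + u') + b * (v + v') + (e + e')" by (simp add: 1 2 algebra_simps)
  then show ?thesis using V_I[OF order_ge_add[OF 1(1) 2(1)]] by simp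
qed

lemma V_uminus:
  assumes "r \<in> V k"
  shows "- r \<in> V k"
proof -
  obtain u v e where 1: "e \<in> order_ge k" "r = a * u + b * v + e" using V_E[OF assms(1)] .
  have "- r = a * (- u) + b * (- v) + (- e)" by (simp add: 1 algebra_simps)
  then show ?thesis using V_I[OF order_ge_uminus[OF 1(1)]] by metis
qed

lemma V_diff: "r \<in> V k \<Longrightarrow> s \<in> V k \<Longrightarrow> r - s \<in> V k"
  using V_add[of r k "- s"] V_uminus by simp

lemma V_mult:
  assumes "r \<in> V j" "s \<in> V k"
  shows "r * s \<in> V (j + k)"
proof -
  obtain u v e where 1: "e \<in> order_ge j" "r = a * u + b * v + e" using V_E[OF assms(1)] .
  obtain u' v' e' where 2: "e' \<in> order_ge k" "s = a * u' + b * v' + e'" using V_E[OF assms(2)] .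
  have "r * s = a * (u * s + e * u') + b * (v * s + e * v') + e * e'" by (simp add: 1 2 algebra_simps)
  then show ?thesis using V_I[OF order_ge_mult[OF 1(1) 2(1)]] by simp
qed

lemma V_mono: "j \<le> k \<Longrightarrow> r \<in> V k \<Longrightarrow> r \<in> V j"
  unfolding V_def using order_ge_mono by blast

lemma w_power_V: "w ^ k \<in> V k"
  by (rule order_ge_V) (rule form_order_ge[OF linear_power_forms[OF l_forms(3)]])

text \<open>After a Koszul correction both coefficients have order \<open>k - 1\<close>, so the
  component of degree \<open>k\<close> would express \<open>c w^k\<close> in terms of
  \<open>l1\<close> and \<open>l2\<close>. Together with \<open>V_leading\<close> this makes
  \<open>V k\<close> modulo \<open>V (Suc k)\<close> one-dimensional, generated by
  \<open>w^k\<close>.\<close>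

lemma w_power_notin_V:
  assumes "ps_const c * w ^ k \<in> V (Suc k)"
  shows "c = 0"
proof -
  obtain r s e where rse: "e \<in> order_ge (Suc k)" "ps_const c * w ^ k = a * r + b * s + e"
    using V_E[OF assms] .
  show ?thesis
  proof (cases k)
    case 0
    have "a * r + b * s + e \<in> order_ge 1"
      using rse(1) ab_order by (intro order_ge_add order_ge_mult_right) (simp_all add: 0)
    then have "ps_const c \<in> order_ge 1" using rse(2) 0 by simp
    then have "ps_coeff (ps_const c) 0 0 0 = 0" unfolding order_ge_def by simp
    then show ?thesis by (simp add: ps_coeff_const)
  next
    case (Suc j)
    have wk: "ps_const c * w ^ k \<in> forms (Suc j)"
      using linear_power_forms[OF l_forms(3)] forms_scale unfolding Suc by blast
    have e: "e \<in> order_ge (Suc j)" using rse(1) Suc order_ge_mono[of "Suc j" "Suc k"] by simp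
    have "ps_const c * w ^ k - e \<in> order_ge (Suc j)"
      using e form_order_ge[OF wk] by (intro order_ge_diff)
    then have "a * r + b * s \<in> order_ge (Suc j)" using rse(2) by simp
    then obtain d where d: "r + d * b \<in> order_ge j" "s - d * a \<in> order_ge j" using koszul_lift by blast
    have "ps_const c * w ^ k = a * (r + d * b) + b * (s - d * a) + e"
      using rse(2) by (simp add: algebra_simps)
    then have "part (Suc j) (ps_const c * w ^ k) = part (Suc j) (a * (r + d * b)) + part (Suc j) (b * (s - d * a)) + part (Suc j) e"
      by (simp only: part_add)
    also have "part (Suc j) e = 0" using rse(1) unfolding Suc by (rule part_of_order_ge)
    finally have "ps_const c * w ^ Suc j = l1 * (- part j (s - d * a)) + l2 * part j (r + d * b)"
      using part_Suc_ab(1)[OF d(1)] part_Suc_ab(2)[OF d(2)] part_of_form[OF wk] Suc by simp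
    then show ?thesis
      using power_notin_ideal[OF co] part_forms forms_uminus by metis
  qed
qed

text \<open>On the curve \<open>l1\<close> and \<open>l2\<close> vanish to order 2, since they agree
  with \<open>- b\<close> and \<open>a\<close> up to terms of order 2; hence only the power of
  \<open>w\<close> survives in degree \<open>k + 1\<close>.\<close>

lemma form_mod_V:
  assumes "F = l1 * A + l2 * B + ps_const c * w ^ Suc k" "A \<in> order_ge k" "B \<in> order_ge k"
  shows "F - ps_const c * w ^ Suc k \<in> V (Suc (Suc k))"
proof -
  have "(b + l1) * A - (a - l2) * B \<in> order_ge (2 + k)"
    by (rule order_ge_diff[OF order_ge_mult[OF b assms(2)] order_ge_mult[OF a assms(3)]])
  then have "a * B + b * (- A) + ((b + l1) * A - (a - l2) * B) \<in> V (Suc (Suc k))"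
    by (intro V_I) simp
  moreover have "F - ps_const c * w ^ Suc k = a * B + b * (- A) + ((b + l1) * A - (a - l2) * B)"
    unfolding assms(1) by (simp add: algebra_simps)
  ultimately show ?thesis by simp
qed

lemma V_leading:
  assumes "r \<in> V k"
  obtains c where "r - ps_const c * w ^ k \<in> V (Suc k)"
proof -
  obtain u v e where e: "e \<in> order_ge k" "r = a * u + b * v + e" using V_E[OF assms(1)] .
  have "\<exists>c. part k e - ps_const c * w ^ k \<in> V (Suc k)"
  proof (cases k)
    case 0
    then obtain c where "part k e = ps_const c" using forms_0_const[OF part_forms[of 0 e]] by blast
    then have "part k e - ps_const c * w ^ k = 0" using 0 by simp
    then show ?thesis using order_ge_V[OF zero_order_ge] by metis
  next
    case (Suc j)
    obtain A B c where "A \<in> forms j" "B \<in> forms j" "part (Suc j) e = l1 * A + l2 * B + ps_const c * w ^ Suc j"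
      using forms_Suc_split_power[OF co part_forms] .
    then have "part k e - ps_const c * w ^ k \<in> V (Suc k)"
      using form_mod_V[of "part k e" A B c j] unfolding Suc by (simp add: form_order_ge)
    then show ?thesis by blast
  qed
  then obtain c where c: "part k e - ps_const c * w ^ k \<in> V (Suc k)" by blast
  have "r - ps_const c * w ^ k = (a * u + b * v + (e - part k e)) + (part k e - ps_const c * w ^ k)"
    unfolding e(2) by simp
  also have "\<dots> \<in> V (Suc k)"
    by (rule V_add[OF V_I[OF diff_part_order_ge[OF e(1)]] c])
  finally show ?thesis using that by blast
qed

end

section \<open>Initial forms with a common factor\<close>

text \<open>Explicit combinations replace the generated ideal, so that the arguments use plain ring
  arithmetic; \<open>genideal_ideal2\<close> identifies the two.\<close>

definition ideal2 :: "'k::field pser3 \<Rightarrow> 'k pser3 \<Rightarrow> 'k pser3 set"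
  where "ideal2 f g = {u * f + v * g | u v. True}"

lemma ideal2_mem: "f \<in> ideal2 f g" "g \<in> ideal2 f g"
proof -
  have "f = 1 * f + 0 * g" "g = 0 * f + 1 * g" by simp_all
  then show "f \<in> ideal2 f g" "g \<in> ideal2 f g" unfolding ideal2_def by blast+
qed

lemma ideal2_combination: "u * f + v * g \<in> ideal2 f g"
  unfolding ideal2_def by blast

lemma ideal2_add:
  assumes "r \<in> ideal2 f g" "s \<in> ideal2 f g"
  shows "r + s \<in> ideal2 f g"
proof -
  obtain u v u' v' where "r = u * f + v * g" "s = u' * f + v' * g"
    using assms unfolding ideal2_def by blast
  then have "r + s = (u + u') * f + (v + v') * g" by (simp add: algebra_simps)
  then show ?thesis using ideal2_combination by metis
qed

lemma ideal2_mult: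
  assumes "r \<in> ideal2 f g"
  shows "c * r \<in> ideal2 f g"
proof -
  obtain u v where "r = u * f + v * g" using assms unfolding ideal2_def by blast
  then have "c * r = (c * u) * f + (c * v) * g" by (simp add: algebra_simps)
  then show ?thesis using ideal2_combination by metis
qed

lemma ideal2_diff: "r \<in> ideal2 f g \<Longrightarrow> s \<in> ideal2 f g \<Longrightarrow> r - s \<in> ideal2 f g"
  using ideal2_add[of r f g "- 1 * s"] ideal2_mult[of s f g "- 1"] by simp

text \<open>\<open>L\<close> is not one of the coordinates: it may lie in the span of
  \<open>l1\<close> and \<open>l2\<close> or involve \<open>w\<close>, and both cases occur.\<close>

locale common_factor =
  fixes L l1 l2 w f g :: "'k::field pser3"
  assumes co: "linear_coords l1 l2 w" and L: "L \<in> forms 1" "L \<noteq> 0"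
    and f: "f \<in> order_ge 2" "part 2 f = L * l1" and g: "g \<in> order_ge 2" "part 2 g = L * l2"
begin

lemma lw_forms: "l1 \<in> forms 1" "l2 \<in> forms 1" "w \<in> forms 1"
  using linear_coords_formsD[OF co] .

lemma part_mult_fg:
  assumes "c \<in> order_ge t"
  shows "part (t + 2) (c * f) = L * (l1 * part t c)" "part (t + 2) (c * g) = L * (l2 * part t c)"
  using part_mult[OF assms f(1)] part_mult[OF assms g(1)] f(2) g(2) by (simp_all add: mult_ac)

lemma combination_order:
  assumes "c \<in> order_ge t" "c' \<in> order_ge t"
  shows "c * f + c' * g \<in> order_ge (t + 2)"
  by (rule order_ge_add[OF order_ge_mult[OF assms(1) f(1)] order_ge_mult[OF assms(2) g(1)]])

lemma part_combination:
  assumes "c \<in> order_ge t" "c' \<in> order_ge t"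
  shows "part (t + 2) (c * f + c' * g) = L * (l1 * part t c + l2 * part t c')"
  using part_mult_fg[OF assms(1)] part_mult_fg[OF assms(2)] by (simp add: part_add distrib_left)

text \<open>The hypothesis says that \<open>I\<^sup>*\<close> needs no generators besides \<open>f\<^sup>*, g\<^sup>*\<close> in degrees below \<open>m + 2\<close>.\<close>

lemma syzygy_lift:
  assumes std: "\<And>t r. t < m \<Longrightarrow> r \<in> ideal2 f g \<Longrightarrow> r \<in> order_ge (t + 2) \<Longrightarrow>
      \<exists>c\<in>forms t. \<exists>c'\<in>forms t. part (t + 2) r = L * (l1 * c + l2 * c')"
  obtains a b where "a - l2 \<in> order_ge 2" "b + l1 \<in> order_ge 2" "a * f + b * g \<in> order_ge (m + 2)"
proof -
  \<comment> \<open>The degree 3 component is \<open>L (l2 l1 - l1 l2) = 0\<close>, so the trivial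
    syzygy starts at order 4 and not only at 3.\<close>
  have start: "l2 * f + (- l1) * g \<in> order_ge 4"
  proof -
    have o: "l2 \<in> order_ge 1" "- l1 \<in> order_ge 1"
      using lw_forms form_order_ge order_ge_uminus by blast+
    have "l2 * f + (- l1) * g \<in> order_ge 3" using combination_order[OF o] by (simp add: numeral_3_eq_3)
    moreover have "part 3 (l2 * f + (- l1) * g) = 0"
      using part_combination[OF o] lw_forms by (simp add: part_uminus part_of_form numeral_3_eq_3 mult.commute)
    ultimately have "l2 * f + (- l1) * g \<in> order_ge (Suc 3)" by (rule order_ge_SucI)
    then show ?thesis by simp
  qed
  have "\<exists>a b. a - l2 \<in> order_ge 2 \<and> b + l1 \<in> order_ge 2 \<and> a * f + b * g \<in> order_ge (j + 4)"
    if "j = 0 \<or> j + 2 \<le> m" for j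
    using that
  proof (induction j)
    case 0
    show ?case using start by (intro exI[of _ l2] exI[of _ "- l1"]) simp
  next
    case (Suc j)
    then obtain a b where ab: "a - l2 \<in> order_ge 2" "b + l1 \<in> order_ge 2" "a * f + b * g \<in> order_ge (j + 4)"
      by auto
    have "j + 2 < m" using Suc.prems by simp
    moreover have "a * f + b * g \<in> order_ge ((j + 2) + 2)" using ab(3) by (simp add: eval_nat_numeral)
    ultimately obtain c c' where c: "c \<in> forms (j + 2)" "c' \<in> forms (j + 2)"
        "part ((j + 2) + 2) (a * f + b * g) = L * (l1 * c + l2 * c')"
      using std[OF _ ideal2_combination] by blast
    have co': "c \<in> order_ge (j + 2)" "c' \<in> order_ge (j + 2)" using c form_order_ge by blast+
    have "(a - c) * f + (b - c') * g = (a * f + b * g) - (c * f + c' * g)" by (simp add: algebra_simps)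
    moreover have "(a * f + b * g) - (c * f + c' * g) \<in> order_ge (Suc ((j + 2) + 2))"
    proof (rule order_ge_SucI)
      show "(a * f + b * g) - (c * f + c' * g) \<in> order_ge ((j + 2) + 2)"
        using \<open>a * f + b * g \<in> order_ge ((j + 2) + 2)\<close> combination_order[OF co'] by (rule order_ge_diff)
      show "part ((j + 2) + 2) ((a * f + b * g) - (c * f + c' * g)) = 0"
        unfolding part_diff c(3) part_combination[OF co'] using c by (simp add: part_of_form)
    qed
    ultimately have "(a - c) * f + (b - c') * g \<in> order_ge (Suc j + 4)" by (simp add: eval_nat_numeral)
    \<comment> \<open>The corrections have degree at least 2, so the linear parts of
      \<open>a\<close> and \<open>b\<close> are never touched.\<close>
    moreover have "(a - c) - l2 \<in> order_ge 2"
    proof -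
      have "(a - l2) - c \<in> order_ge 2"
        by (rule order_ge_diff[OF ab(1) order_ge_mono[OF _ co'(1)]]) simp
      then show ?thesis by (simp add: algebra_simps)
    qed
    moreover have "(b - c') + l1 \<in> order_ge 2"
    proof -
      have "(b + l1) - c' \<in> order_ge 2"
        by (rule order_ge_diff[OF ab(2) order_ge_mono[OF _ co'(2)]]) simp
      then show ?thesis by (simp add: algebra_simps)
    qed
    ultimately show ?case by blast
  qed
  \<comment> \<open>Subtraction is truncated: for \<open>m \<ge> 2\<close> the order reached is
    \<open>m + 2\<close>, and for \<open>m < 2\<close> the starting order 4 already exceeds
    it.\<close>
  moreover have "m - 2 = 0 \<or> m - 2 + 2 \<le> m" by linarith
  ultimately obtain a b where
      ab: "a - l2 \<in> order_ge 2" "b + l1 \<in> order_ge 2" "a * f + b * g \<in> order_ge (m - 2 + 4)" by blast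
  show ?thesis using that[OF ab(1,2)] order_ge_mono[OF _ ab(3), of "m + 2"] by simp
qed

text \<open>Below degree \<open>m + 2\<close> every syzygy is a multiple of the lifted one, so only \<open>a f + b g\<close> can
  contribute a new generator in degree \<open>m + 2\<close>.\<close>

lemma new_part:
  assumes a: "a - l2 \<in> order_ge 2" and b: "b + l1 \<in> order_ge 2"
    and h: "a * f + b * g \<in> order_ge (m + 2)"
    and r: "r \<in> ideal2 f g" "r \<in> order_ge (m + 2)"
  obtains c c' \<kappa> where "c \<in> forms m" "c' \<in> forms m"
    "part (m + 2) r = L * (l1 * c + l2 * c') + ps_const \<kappa> * part (m + 2) (a * f + b * g)"
proof -
  interpret curve l1 l2 w a b by unfold_locales (use co a b in auto)
  let ?h = "a * f + b * g"
  have "\<exists>c\<in>forms m. \<exists>c'\<in>forms m. \<exists>\<kappa>. part (m + 2) (u * f + v * g) =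
      L * (l1 * c + l2 * c') + ps_const \<kappa> * part (m + 2) ?h"
    \<comment> \<open>The induction is on the common order of the two coefficients. Order
      \<open>m\<close> gives an element of \<open>L (l1, l2)\<close>. Below \<open>m\<close> the
      leading components form a syzygy of \<open>l1, l2\<close>, and subtracting \<open>d\<close>
      times \<open>(a, b)\<close> raises the order at the price of the multiple
      \<open>d h\<close>.\<close>
    if "u \<in> order_ge i" "v \<in> order_ge i" "u * f + v * g \<in> order_ge (m + 2)" "i \<le> m" for u v i
    using that(4,1-3)
  proof (induction i arbitrary: u v rule: inc_induct)
    case base
    have "part (m + 2) (u * f + v * g) = L * (l1 * part m u + l2 * part m v) + ps_const 0 * part (m + 2) ?h"
      using part_combination[OF base(1,2)] by simp
    then show ?case using part_forms by blast
  next
    case (step i)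
    have "u * f + v * g \<in> order_ge (Suc (i + 2))" using step.prems(3) by (rule order_ge_mono[rotated]) (use step.hyps in simp)
    then have "part (i + 2) (u * f + v * g) = 0" by (rule part_of_order_ge)
    then have "l1 * part i u + l2 * part i v = 0" using part_combination[OF step.prems(1,2)] L(2) by simp
    then obtain d where d: "part i u = l2 * d" "part i v = - (l1 * d)" "i = 0 \<Longrightarrow> d = 0" "\<And>j. i = Suc j \<Longrightarrow> d \<in> forms j"
      using linear_syzygy[OF co part_forms part_forms] by metis
    have db: "d * a \<in> order_ge i \<and> d * b \<in> order_ge i \<and> part i (d * a) = l2 * d \<and> part i (d * b) = - (l1 * d)"
    proof (cases i)
      case 0
      then show ?thesis using d(3) by simp
    next
      case (Suc j)
      then have "d \<in> forms j" using d(4) by simp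
      then show ?thesis
        using part_Suc_ab[of d j] order_ge_mult[of d j a 1] order_ge_mult[of d j b 1] ab_order
        unfolding Suc by (simp add: form_order_ge part_of_form mult.commute)
    qed
    have eq: "(u - d * a) * f + (v - d * b) * g = (u * f + v * g) - d * ?h" by (simp add: algebra_simps)
    have dh: "d * ?h \<in> order_ge (m + 2)" by (rule order_ge_mult_left[OF h])
    have "u - d * a \<in> order_ge (Suc i)" "v - d * b \<in> order_ge (Suc i)"
      by (rule order_ge_SucI[OF order_ge_diff]; use db d(1,2) step.prems(1,2) in \<open>simp add: part_diff\<close>)+
    moreover have "(u - d * a) * f + (v - d * b) * g \<in> order_ge (m + 2)"
      unfolding eq using step.prems(3) dh by (rule order_ge_diff)
    ultimately obtain c c' \<kappa> where c: "c \<in> forms m" "c' \<in> forms m"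
        "part (m + 2) ((u - d * a) * f + (v - d * b) * g) = L * (l1 * c + l2 * c') + ps_const \<kappa> * part (m + 2) ?h"
      using step.IH by blast
    \<comment> \<open>Since \<open>h\<close> has order at least \<open>m + 2\<close>, only the
      constant term of \<open>d\<close> is felt in degree \<open>m + 2\<close>.\<close>
    obtain k where "part 0 d = ps_const k" using forms_0_const[OF part_forms] by blast
    then have "part (m + 2) (d * ?h) = ps_const k * part (m + 2) ?h"
      using part_mult[of d 0 ?h "m + 2"] h by simp
    then have "part (m + 2) (u * f + v * g) =
        L * (l1 * c + l2 * c') + ps_const (\<kappa> + k) * part (m + 2) ?h"
      using c(3) unfolding eq part_diff ps_const_add by (simp add: algebra_simps)
    then show ?case using c(1,2) by blast
  qed
  moreover obtain u v where "r = u * f + v * g" using r(1) unfolding ideal2_def by blast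
  ultimately show ?thesis using that r(2) by (metis UNIV_I order_ge_0 zero_le)
qed

end

section \<open>Contradiction from initial forms confined to \<open>(L)\<close>\<close>

context common_factor
begin

lemma initial_parts_in_plane_contradiction:
  assumes r0: "r0 \<in> ideal2 f g" "r0 \<in> order_ge (m + 2)" "part (m + 2) r0 = L * w ^ Suc m"
    and no_new: "\<And>r. r \<in> ideal2 f g \<Longrightarrow> r \<in> order_ge (Suc m) \<Longrightarrow> part (Suc m) r \<noteq> L * w ^ m"
    and plane: "\<And>s r. s < 2 * Suc m \<Longrightarrow> r \<in> ideal2 f g \<Longrightarrow> r \<in> order_ge (Suc s) \<Longrightarrow> \<exists>u\<in>forms s. part (Suc s) r = L * u"
  shows False
proof -
  have split: "\<exists>c\<in>forms t. \<exists>c'\<in>forms t. \<exists>\<kappa>. part (t + 2) r = L * (l1 * c + l2 * c' + ps_const \<kappa> * w ^ Suc t)"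
    if r: "Suc t < 2 * Suc m" "r \<in> ideal2 f g" "r \<in> order_ge (t + 2)" for t r
  proof -
    obtain u where u: "u \<in> forms (Suc t)" "part (Suc (Suc t)) r = L * u"
      using plane[OF r(1,2)] r(3) by auto
    obtain A B c where "A \<in> forms t" "B \<in> forms t" "u = l1 * A + l2 * B + ps_const c * w ^ Suc t"
      using forms_Suc_split_power[OF co u(1)] .
    then show ?thesis using u(2) by auto
  qed
  have std: "\<exists>c\<in>forms t. \<exists>c'\<in>forms t. part (t + 2) r = L * (l1 * c + l2 * c')"
    if t: "t < m" and r: "r \<in> ideal2 f g" "r \<in> order_ge (t + 2)" for t r
  proof -
    obtain c c' \<kappa> where c: "c \<in> forms t" "c' \<in> forms t"
        "part (t + 2) r = L * (l1 * c + l2 * c' + ps_const \<kappa> * w ^ Suc t)"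
      using split[OF _ r] t by auto
    \<comment> \<open>A term \<open>L w^(t+1)\<close> in lower degree could be isolated by
      subtracting multiples of \<open>f\<close> and \<open>g\<close>, and a power of
      \<open>w\<close> would carry it to \<open>L w^m\<close>, which \<open>no_new\<close>
      excludes.\<close>
    have "\<kappa> = 0"
    proof (rule ccontr)
      assume \<kappa>: "\<kappa> \<noteq> 0"
      have co': "c \<in> order_ge t" "c' \<in> order_ge t" using c form_order_ge by blast+
      define s where "s = r - (c * f + c' * g)"
      have s: "s \<in> ideal2 f g" "s \<in> order_ge (t + 2)"
        using r ideal2_combination combination_order[OF co'] by (auto simp: s_def intro!: ideal2_diff order_ge_diff)
      have ps: "part (t + 2) s = L * (ps_const \<kappa> * w ^ Suc t)"
        unfolding s_def part_diff c(3) part_combination[OF co'] using c by (simp add: part_of_form algebra_simps)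
      define e where "e = ps_const (inverse \<kappa>) * w ^ (m - Suc t)"
      have e: "e \<in> forms (m - Suc t)"
        unfolding e_def by (intro forms_scale linear_power_forms lw_forms)
      have sum: "(m - Suc t) + (t + 2) = Suc m" using t by simp
      have "e * s \<in> order_ge (Suc m)"
        using order_ge_mult[OF form_order_ge[OF e] s(2)] unfolding sum .
      moreover have "part (Suc m) (e * s) = e * (L * (ps_const \<kappa> * w ^ Suc t))"
        using part_mult[OF form_order_ge[OF e] s(2)] unfolding sum ps by (simp add: part_of_form[OF e])
      moreover have "e * (L * (ps_const \<kappa> * w ^ Suc t)) = L * w ^ m"
      proof -
        have "e * (L * (ps_const \<kappa> * w ^ Suc t)) = ps_const (inverse \<kappa> * \<kappa>) * (L * (w ^ (m - Suc t) * w ^ Suc t))"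
          unfolding e_def ps_const_mult by (simp add: mult_ac)
        also have "w ^ (m - Suc t) * w ^ Suc t = w ^ m" using t by (simp only: power_add[symmetric]) simp
        finally show ?thesis using \<kappa> by simp
      qed
      ultimately show False using no_new[OF ideal2_mult[OF s(1), of e]] by simp
    qed
    then show ?thesis using c by auto
  qed
  obtain a b where a: "a - l2 \<in> order_ge 2" and b: "b + l1 \<in> order_ge 2" and h: "a * f + b * g \<in> order_ge (m + 2)"
    using syzygy_lift[of m] std by blast
  interpret curve l1 l2 w a b by unfold_locales (use co a b in auto)
  define h where "h = a * f + b * g"
  have h_ideal: "h \<in> ideal2 f g" and h_ord: "h \<in> order_ge (m + 2)"
    using h ideal2_combination by (auto simp: h_def)
  obtain c c' \<kappa> where cc: "c \<in> forms m" "c' \<in> forms m"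
      "part (m + 2) r0 = L * (l1 * c + l2 * c') + ps_const \<kappa> * part (m + 2) h"
    using new_part[OF a b h r0(1,2)] unfolding h_def by metis
  obtain E F \<mu> where EF: "E \<in> forms m" "F \<in> forms m"
      "part (m + 2) h = L * (l1 * E + l2 * F + ps_const \<mu> * w ^ Suc m)"
    using split[OF _ h_ideal h_ord] by auto
  define q where "q = l1 * E + l2 * F + ps_const \<mu> * w ^ Suc m"
  have q: "q \<in> forms (Suc m)"
    unfolding q_def using EF(1,2) lw_forms
    by (intro forms_add forms_scale linear_power_forms forms_mult_Suc)
  \<comment> \<open>Otherwise \<open>h\<close> would contribute nothing outside
    \<open>L (l1, l2)\<close> and could not account for \<open>L w^(m+1)\<close>, the initial form
    of \<open>r0\<close>.\<close>
  have \<mu>: "\<mu> \<noteq> 0"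
  proof
    assume "\<mu> = 0"
    then have "L * w ^ Suc m = L * (l1 * (c + ps_const \<kappa> * E) + l2 * (c' + ps_const \<kappa> * F))"
      using r0(3) cc(3) EF(3) by (simp add: algebra_simps)
    then have "ps_const 1 * w ^ Suc m = l1 * (c + ps_const \<kappa> * E) + l2 * (c' + ps_const \<kappa> * F)"
      using L(2) by (simp del: power_Suc)
    then have "(1 :: 'k) = 0"
      by (rule power_notin_ideal[OF co, rotated 2]) (use cc EF in \<open>auto intro!: forms_add forms_scale\<close>)
    then show False by simp
  qed

  have not_both: "\<not> (f \<in> V (m + 2) \<and> g \<in> V (m + 2))"
  proof
    assume fg: "f \<in> V (m + 2) \<and> g \<in> V (m + 2)"
    \<comment> \<open>Replacing \<open>f, g\<close> by \<open>f + d b, g - d a\<close> changes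
      neither \<open>h\<close> nor the restrictions to the curve, and it brings both coefficients to
      order \<open>m + 1\<close>.\<close>
    obtain d where d: "f + d * b \<in> order_ge (Suc m)" "g - d * a \<in> order_ge (Suc m)"
      using koszul_lift[of f g "Suc m"] h by auto
    have ab: "d * b \<in> V k" "d * a \<in> V k" for k
      using ab_V[of 0 d k] ab_V[of d 0 k] by (simp_all add: mult.commute)
    have fgV: "f + d * b \<in> V (m + 2)" "g - d * a \<in> V (m + 2)"
      using fg ab by (auto intro: V_add V_diff)
    \<comment> \<open>Modulo \<open>(l1, l2)\<close> the component of degree \<open>m + 1\<close> is
      a multiple of \<open>w^(m+1)\<close>; its coefficient vanishes because \<open>r\<close> has
      order at least \<open>m + 2\<close> on the curve.\<close>
    have lin: "\<exists>A\<in>forms m. \<exists>B\<in>forms m. part (Suc m) r = l1 * A + l2 * B"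
      if r: "r \<in> order_ge (Suc m)" "r \<in> V (m + 2)" for r
    proof -
      obtain A B c where AB: "A \<in> forms m" "B \<in> forms m" "part (Suc m) r = l1 * A + l2 * B + ps_const c * w ^ Suc m"
        using forms_Suc_split_power[OF co part_forms] .
      have "part (Suc m) r - ps_const c * w ^ Suc m \<in> V (Suc (Suc m))"
        using form_mod_V[OF AB(3)] AB(1,2) form_order_ge by blast
      moreover have "r - (r - part (Suc m) r) \<in> V (Suc (Suc m))"
      proof (rule V_diff)
        show "r \<in> V (Suc (Suc m))" using r(2) by simp
        show "r - part (Suc m) r \<in> V (Suc (Suc m))" by (rule order_ge_V[OF diff_part_order_ge[OF r(1)]])
      qed
      ultimately have "r - (r - part (Suc m) r) - (part (Suc m) r - ps_const c * w ^ Suc m) \<in> V (Suc (Suc m))"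
        using V_diff by blast
      then have "c = 0" using w_power_notin_V[of c "Suc m"] by simp
      then show ?thesis using AB by auto
    qed
    obtain A B where AB: "A \<in> forms m" "B \<in> forms m" "part (Suc m) (f + d * b) = l1 * A + l2 * B"
      using lin[OF d(1) fgV(1)] by blast
    obtain A' B' where AB': "A' \<in> forms m" "B' \<in> forms m" "part (Suc m) (g - d * a) = l1 * A' + l2 * B'"
      using lin[OF d(2) fgV(2)] by blast
    have "h = a * (f + d * b) + b * (g - d * a)" by (simp add: h_def algebra_simps)
    then have "part (m + 2) h = l2 * part (Suc m) (f + d * b) - l1 * part (Suc m) (g - d * a)"
      using part_Suc_ab(1)[OF d(1)] part_Suc_ab(2)[OF d(2)] by (simp add: part_add)
    then have Lq: "L * q = l2 * (l1 * A + l2 * B) - l1 * (l1 * A' + l2 * B')"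
      unfolding AB(3) AB'(3) EF(3) q_def .
    obtain x1 x2 x3 where x: "L = ps_const x1 * l1 + ps_const x2 * l2 + ps_const x3 * w"
      using co L(1) unfolding linear_coords_def by blast
    note fm = forms_add forms_diff forms_scale forms_uminus forms_mult_Suc[OF lw_forms(1)]
      forms_mult_Suc[OF lw_forms(2)] forms_mult_Suc[OF lw_forms(3)] linear_power_forms[OF lw_forms(3)]
    \<comment> \<open>Modulo \<open>(l1, l2)\<close> the left side of \<open>Lq\<close> is
      \<open>x3 \<mu> w^(m+2)\<close> and the right side is 0, so \<open>L\<close> has no
      \<open>w\<close> term.\<close>
    have "ps_const (x3 * \<mu>) * w ^ Suc (Suc m) =
        l1 * (- (l1 * A' + l2 * B') - ps_const x1 * q - ps_const x3 * (w * E)) +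
        l2 * ((l1 * A + l2 * B) - ps_const x2 * q - ps_const x3 * (w * F))"
    proof -
      have "l1 * (- (l1 * A' + l2 * B') - ps_const x1 * q - ps_const x3 * (w * E)) +
          l2 * ((l1 * A + l2 * B) - ps_const x2 * q - ps_const x3 * (w * F)) =
          (l2 * (l1 * A + l2 * B) - l1 * (l1 * A' + l2 * B')) - (ps_const x1 * l1 + ps_const x2 * l2) * q
          - ps_const x3 * w * (l1 * E + l2 * F)"
        by (simp add: algebra_simps)
      also have "\<dots> = L * q - (ps_const x1 * l1 + ps_const x2 * l2) * q - ps_const x3 * w * (l1 * E + l2 * F)"
        unfolding Lq ..
      also have "\<dots> = (L - (ps_const x1 * l1 + ps_const x2 * l2)) * q - ps_const x3 * w * (l1 * E + l2 * F)"
        by (simp only: left_diff_distrib)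
      also have "L - (ps_const x1 * l1 + ps_const x2 * l2) = ps_const x3 * w" unfolding x by simp
      also have "ps_const x3 * w * q - ps_const x3 * w * (l1 * E + l2 * F) = ps_const (x3 * \<mu>) * w ^ Suc (Suc m)"
        unfolding q_def by (simp add: algebra_simps ps_const_mult del: ps.scale_scale)
      finally show ?thesis ..
    qed
    then have "x3 * \<mu> = 0"
      by (rule power_notin_ideal[OF co, rotated 2]) (intro fm AB AB' EF q)+
    then have x3: "x3 = 0" using \<mu> by simp
    \<comment> \<open>With \<open>L\<close> in the span of \<open>l1, l2\<close>, the identity
      \<open>Lq\<close> becomes a syzygy of \<open>l1, l2\<close>. Its solution places
      \<open>x1 q\<close> and \<open>x2 q\<close> in \<open>(l1, l2)\<close>, and since
      \<open>q\<close> contains \<open>\<mu> w^(m+1)\<close>, both \<open>x1\<close> and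
      \<open>x2\<close> vanish.\<close>
    have "l1 * (ps_const x1 * q + (l1 * A' + l2 * B')) + l2 * (ps_const x2 * q - (l1 * A + l2 * B)) =
        L * q - (l2 * (l1 * A + l2 * B) - l1 * (l1 * A' + l2 * B'))"
      unfolding x x3 by (simp add: algebra_simps)
    then have "l1 * (ps_const x1 * q + (l1 * A' + l2 * B')) + l2 * (ps_const x2 * q - (l1 * A + l2 * B)) = 0"
      unfolding Lq by simp
    moreover have "ps_const x1 * q + (l1 * A' + l2 * B') \<in> forms (Suc m)"
      by (intro fm AB AB' q)
    moreover have "ps_const x2 * q - (l1 * A + l2 * B) \<in> forms (Suc m)"
      by (intro fm AB AB' q)
    ultimately obtain e where e: "ps_const x1 * q + (l1 * A' + l2 * B') = l2 * e"
        "ps_const x2 * q - (l1 * A + l2 * B) = - (l1 * e)" "e \<in> forms m"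
      using linear_syzygy[OF co, of "ps_const x1 * q + (l1 * A' + l2 * B')" "Suc m"] by metis
    have "ps_const (x1 * \<mu>) * w ^ Suc m = l1 * (- A' - ps_const x1 * E) + l2 * (e - B' - ps_const x1 * F)"
    proof -
      have "ps_const (x1 * \<mu>) * w ^ Suc m =
          (ps_const x1 * q + (l1 * A' + l2 * B')) - ps_const x1 * (l1 * E + l2 * F) - (l1 * A' + l2 * B')"
        unfolding q_def by (simp add: algebra_simps ps_const_mult del: ps.scale_scale)
      then show ?thesis unfolding e(1) by (simp add: algebra_simps)
    qed
    then have "x1 * \<mu> = 0"
      by (rule power_notin_ideal[OF co, rotated 2]) (intro fm AB AB' EF e)+
    moreover have "ps_const (x2 * \<mu>) * w ^ Suc m = l1 * (A - e - ps_const x2 * E) + l2 * (B - ps_const x2 * F)"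
    proof -
      have "ps_const (x2 * \<mu>) * w ^ Suc m =
          (ps_const x2 * q - (l1 * A + l2 * B)) - ps_const x2 * (l1 * E + l2 * F) + (l1 * A + l2 * B)"
        unfolding q_def by (simp add: algebra_simps ps_const_mult del: ps.scale_scale)
      then show ?thesis unfolding e(2) by (simp add: algebra_simps)
    qed
    then have "x2 * \<mu> = 0"
      by (rule power_notin_ideal[OF co, rotated 2]) (intro fm AB AB' EF e)+
    ultimately have "L = 0" using \<mu> x x3 by simp
    then show False using L(2) by simp
  qed

  \<comment> \<open>The smaller of the orders of \<open>f\<close> and \<open>g\<close> on the curve,
    at most \<open>m + 1\<close> by \<open>not_both\<close>. The coefficients \<open>f0\<close> and
    \<open>g0\<close> of \<open>w^j\<close> cannot both be 0.\<close>
  define j where "j = (LEAST j. \<not> (f \<in> V (Suc j) \<and> g \<in> V (Suc j)))"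
  have j: "\<not> (f \<in> V (Suc j) \<and> g \<in> V (Suc j))"
    unfolding j_def by (rule LeastI[of _ "Suc m"]) (use not_both in simp)
  have "j \<le> Suc m"
    unfolding j_def by (rule Least_le) (use not_both in simp)
  have fj: "f \<in> V j \<and> g \<in> V j"
  proof (cases j)
    case 0
    then show ?thesis by (simp add: V_0)
  next
    case (Suc i)
    then show ?thesis using not_less_Least[of i "\<lambda>j. \<not> (f \<in> V (Suc j) \<and> g \<in> V (Suc j))"]
      unfolding j_def[symmetric] by simp
  qed
  obtain f0 where f0: "f - ps_const f0 * w ^ j \<in> V (Suc j)" using V_leading fj by blast
  obtain g0 where g0: "g - ps_const g0 * w ^ j \<in> V (Suc j)" using V_leading fj by blast
  have hV: "C * h \<in> V k" for C k
    using ab_V[of "C * f" "C * g" k] by (simp add: h_def algebra_simps)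

  \<comment> \<open>On the curve \<open>h\<close> drops out, \<open>B G\<close> and
    \<open>(A + q) F\<close> have order at least \<open>m + 2 + j\<close>, and \<open>q F\<close>
    has leading term \<open>\<mu> c0 w^(m+1+j)\<close>. Arbitrary \<open>F, G\<close> are used so
    that \<open>f\<close> and \<open>g\<close> can exchange roles.\<close>
  have leading_0: "c0 = 0"
    if FG: "F \<in> V j" "G \<in> V j" "F - ps_const c0 * w ^ j \<in> V (Suc j)"
      and AB: "A + q \<in> V (m + 2)" "B \<in> V (m + 2)"
      and p: "C * h + A * F + B * G \<in> order_ge (2 * Suc m + 1)" for A B C F G c0
  proof -
    define F' where "F' = F - ps_const c0 * w ^ j"
    define A' where "A' = (A + q) - (q - ps_const \<mu> * w ^ Suc m)"
    have "q - ps_const \<mu> * w ^ Suc m \<in> V (m + 2)"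
      using form_mod_V[OF q_def] EF form_order_ge by auto
    then have A': "A' \<in> V (m + 2)" unfolding A'_def by (rule V_diff[OF AB(1)])
    \<comment> \<open>This is where the bound \<open>2 n\<close> enters: because
      \<open>j \<le> m + 1\<close>, the order \<open>2 m + 3\<close> of the relation is beyond the
      order \<open>m + 1 + j\<close> of the leading term.\<close>
    have t1: "C * h + A * F + B * G \<in> V (Suc (Suc m + j))"
      by (rule V_mono[OF _ order_ge_V[OF p]]) (use \<open>j \<le> Suc m\<close> in simp)
    have t2: "B * G \<in> V (Suc (Suc m + j))" using V_mult[OF AB(2) FG(2)] by simp
    have t3: "A' * F \<in> V (Suc (Suc m + j))" using V_mult[OF A' FG(1)] by simp
    have "ps_const \<mu> * w ^ Suc m \<in> V (Suc m)"
      using V_mult[OF V_0 w_power_V[of "Suc m"]] by simp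
    then have t4: "(ps_const \<mu> * w ^ Suc m) * F' \<in> V (Suc (Suc m + j))"
      using V_mult[of _ "Suc m" F' "Suc j"] FG(3) unfolding F'_def by simp
    have "ps_const (\<mu> * c0) * w ^ (Suc m + j) =
        C * h + B * G + A' * F - (ps_const \<mu> * w ^ Suc m) * F' - (C * h + A * F + B * G)"
      unfolding A'_def F'_def by (simp add: algebra_simps ps_const_mult power_add del: ps.scale_scale)
    also have "\<dots> \<in> V (Suc (Suc m + j))"
      by (intro V_add V_diff hV t1 t2 t3 t4)
    finally show "c0 = 0" using w_power_notin_V \<mu> by fastforce
  qed

  \<comment> \<open>Each round raises the order by one: \<open>f\<close> and \<open>g\<close> remove
    the part of the initial form in \<open>L (l1, l2)\<close>, and \<open>h\<close> removes the
    power of \<open>w\<close>. Rounds are possible through degree \<open>2 m + 2\<close>, as far as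
    \<open>plane\<close> reaches.\<close>
  have reduce: "\<exists>A B C. C * h + A * f + B * g \<in> order_ge (2 * Suc m + 1) \<and> A - A0 \<in> V (m + 2) \<and> B - B0 \<in> V (m + 2)"
    if start: "C0 * h + A0 * f + B0 * g \<in> order_ge (m + 4)" for A0 B0 C0
  proof -
    have "\<exists>A B C. C * h + A * f + B * g \<in> order_ge (m + 4 + i) \<and> A - A0 \<in> V (m + 2) \<and> B - B0 \<in> V (m + 2)"
      if "i = 0 \<or> m + 3 + i \<le> 2 * Suc m" for i
      using that
    proof (induction i)
      case 0
      show ?case using start order_ge_V[OF zero_order_ge]
        by (intro exI[of _ A0] exI[of _ B0] exI[of _ C0]) simp
    next
      case (Suc i)
      then obtain A B C where ABC: "C * h + A * f + B * g \<in> order_ge (m + 4 + i)" "A - A0 \<in> V (m + 2)" "B - B0 \<in> V (m + 2)"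
        by auto
      define p where "p = C * h + A * f + B * g"
      have p: "p \<in> ideal2 f g" "p \<in> order_ge ((m + 2 + i) + 2)"
      proof -
        show "p \<in> ideal2 f g"
          unfolding p_def by (rule ideal2_add[OF ideal2_add[OF ideal2_mult[OF h_ideal]
              ideal2_mult[OF ideal2_mem(1)]] ideal2_mult[OF ideal2_mem(2)]])
        show "p \<in> order_ge ((m + 2 + i) + 2)" using ABC(1) by (simp add: p_def eval_nat_numeral)
      qed
      obtain c c' \<kappa> where c: "c \<in> forms (m + 2 + i)" "c' \<in> forms (m + 2 + i)"
          "part ((m + 2 + i) + 2) p = L * (l1 * c + l2 * c' + ps_const \<kappa> * w ^ Suc (m + 2 + i))"
        using split[OF _ p] Suc.prems by auto
      \<comment> \<open>Chosen so that \<open>e q\<close> has the power of \<open>w\<close> with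
        coefficient \<open>\<kappa>\<close>; the rest of \<open>e q\<close> lies in
        \<open>(l1, l2)\<close> and is compensated in \<open>c1\<close> and
        \<open>c2\<close>.\<close>
      define e where "e = ps_const (\<kappa> / \<mu>) * w ^ (i + 2)"
      have e: "e \<in> forms (i + 2)" unfolding e_def by (intro forms_scale linear_power_forms lw_forms)
      have eq: "e * (ps_const \<mu> * w ^ Suc m) = ps_const \<kappa> * w ^ Suc (m + 2 + i)"
      proof -
        have "e * (ps_const \<mu> * w ^ Suc m) = ps_const (\<kappa> / \<mu> * \<mu>) * (w ^ (i + 2) * w ^ Suc m)"
          unfolding e_def ps_const_mult by (simp only: mult_ac)
        also have "w ^ (i + 2) * w ^ Suc m = w ^ Suc (m + 2 + i)" by (simp only: power_add[symmetric]) (simp add: add_ac)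
        finally show ?thesis using \<mu> by simp
      qed
      have sums: "i + 2 + m = m + 2 + i" "(i + 2) + (m + 2) = (m + 2 + i) + 2" by simp_all
      define c1 c2 where "c1 = c - e * E" and "c2 = c' - e * F"
      have c12: "c1 \<in> forms (m + 2 + i)" "c2 \<in> forms (m + 2 + i)"
        using c EF(1,2) forms_mult[OF e EF(1)] forms_mult[OF e EF(2)] unfolding c1_def c2_def sums
        by (auto intro: forms_diff)
      have c12o: "c1 \<in> order_ge (m + 2 + i)" "c2 \<in> order_ge (m + 2 + i)" using c12 form_order_ge by blast+
      have eh: "e * h \<in> order_ge ((m + 2 + i) + 2)" "part ((m + 2 + i) + 2) (e * h) = e * (L * q)"
        using order_ge_mult[OF form_order_ge[OF e] h_ord] part_mult[OF form_order_ge[OF e] h_ord]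
        unfolding sums part_of_form[OF e] EF(3) q_def[symmetric] by blast+
      have "p - (c1 * f + c2 * g) - e * h \<in> order_ge (Suc ((m + 2 + i) + 2))"
      proof (rule order_ge_SucI)
        show "p - (c1 * f + c2 * g) - e * h \<in> order_ge ((m + 2 + i) + 2)"
          by (intro order_ge_diff p(2) combination_order c12o eh)
        have "part ((m + 2 + i) + 2) (p - (c1 * f + c2 * g) - e * h) =
            L * (l1 * c + l2 * c' + e * (ps_const \<mu> * w ^ Suc m)) - L * (l1 * c1 + l2 * c2) - e * (L * q)"
          unfolding part_diff c(3) part_combination[OF c12o] eh(2) eq using c12 by (simp add: part_of_form)
        also have "\<dots> = 0" unfolding c1_def c2_def q_def by (simp add: algebra_simps)
        finally show "part ((m + 2 + i) + 2) (p - (c1 * f + c2 * g) - e * h) = 0" .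
      qed
      moreover have "p - (c1 * f + c2 * g) - e * h = (C - e) * h + (A - c1) * f + (B - c2) * g"
        unfolding p_def by (simp add: algebra_simps)
      moreover have "Suc ((m + 2 + i) + 2) = m + 4 + Suc i" by simp
      ultimately have 1: "(C - e) * h + (A - c1) * f + (B - c2) * g \<in> order_ge (m + 4 + Suc i)" by metis
      \<comment> \<open>The multipliers have degree at least \<open>m + 2\<close>, so
        \<open>A\<close> and \<open>B\<close> keep their values modulo \<open>V (m + 2)\<close>, and
        in particular the leading term of \<open>- q\<close>.\<close>
      have "c1 \<in> V (m + 2)" "c2 \<in> V (m + 2)"
        using c12o order_ge_V order_ge_mono[of "m + 2" "m + 2 + i"] by auto
      then have "(A - A0) - c1 \<in> V (m + 2)" "(B - B0) - c2 \<in> V (m + 2)"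
        using ABC(2,3) V_diff by blast+
      then have "(A - c1) - A0 \<in> V (m + 2)" "(B - c2) - B0 \<in> V (m + 2)" by (simp_all add: algebra_simps)
      with 1 show ?case by blast
    qed
    moreover have "m - 1 = 0 \<or> m + 3 + (m - 1) \<le> 2 * Suc m" by (cases m) simp_all
    ultimately obtain A B C where
        "C * h + A * f + B * g \<in> order_ge (m + 4 + (m - 1))" "A - A0 \<in> V (m + 2)" "B - B0 \<in> V (m + 2)" by blast
    moreover have "2 * Suc m + 1 \<le> m + 4 + (m - 1)" by simp
    ultimately show ?thesis using order_ge_mono by blast
  qed

  \<comment> \<open>Both products have component \<open>l L q\<close> in degree
    \<open>m + 3\<close>.\<close>
  have start: "l * h - q * F \<in> order_ge (m + 4)"
    if l: "l \<in> forms 1" "F \<in> order_ge 2" "part 2 F = L * l" for l F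
  proof -
    have "l * h \<in> order_ge (m + 3)" using order_ge_mult[OF form_order_ge[OF l(1)] h_ord] by (simp add: eval_nat_numeral)
    moreover have "q * F \<in> order_ge (m + 3)" using order_ge_mult[OF form_order_ge[OF q] l(2)] by (simp add: eval_nat_numeral)
    moreover have "part (m + 3) (l * h) = l * (L * q)"
      using part_mult[OF form_order_ge[OF l(1)] h_ord] EF(3) part_of_form[OF l(1)] unfolding q_def
      by (simp add: eval_nat_numeral)
    moreover have "part (m + 3) (q * F) = q * (L * l)"
      using part_mult[OF form_order_ge[OF q] l(2)] l(3) part_of_form[OF q]
      by (simp add: eval_nat_numeral)
    ultimately have "l * h - q * F \<in> order_ge (Suc (m + 3))"
      by (intro order_ge_SucI order_ge_diff) (simp_all add: part_diff)
    then show ?thesis by (simp add: eval_nat_numeral)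
  qed

  have "f0 = 0"
  proof -
    have "l1 * h + (- q) * f + 0 * g \<in> order_ge (m + 4)" using start[OF lw_forms(1) f] by simp
    from reduce[OF this] obtain A B C where
      "C * h + A * f + B * g \<in> order_ge (2 * Suc m + 1)" "A + q \<in> V (m + 2)" "B \<in> V (m + 2)" by auto
    then show ?thesis using leading_0 fj f0 by blast
  qed
  moreover have "g0 = 0"
  proof -
    have "l2 * h + 0 * f + (- q) * g \<in> order_ge (m + 4)" using start[OF lw_forms(2) g] by simp
    from reduce[OF this] obtain A B C where
      "C * h + A * f + B * g \<in> order_ge (2 * Suc m + 1)" "A \<in> V (m + 2)" "B + q \<in> V (m + 2)" by auto
    moreover from this(1) have "C * h + B * g + A * f \<in> order_ge (2 * Suc m + 1)" by (simp only: add_ac)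
    ultimately show ?thesis using leading_0 fj g0 by blast
  qed
  ultimately show False using j f0 g0 by simp
qed

end

section \<open>Hilbert functions of initial ideals\<close>

text \<open>The degree \<open>t\<close> piece of the initial ideal. Elements of order above
  \<open>t\<close> contribute 0, which makes this a subspace.\<close>

definition initial_part :: "'k::field pser3 set \<Rightarrow> nat \<Rightarrow> 'k pser3 set"
  where "initial_part I t = part t ` (I \<inter> order_ge t)"

definition hf :: "'k::field pser3 set \<Rightarrow> nat \<Rightarrow> nat"
  where "hf I t = ps.dim (forms t :: 'k pser3 set) - ps.dim (initial_part I t)"

locale order2_pair =
  fixes f g :: "'k::field pser3"
  assumes f2: "f \<in> order_ge 2" and g2: "g \<in> order_ge 2"
begin

abbreviation I where "I \<equiv> ideal2 f g"
abbreviation J where "J \<equiv> initial_part (ideal2 f g)"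

lemma zero_ideal: "0 \<in> I"
  using ideal2_combination[of 0 f 0 g] by simp

lemma J_I: "r \<in> I \<Longrightarrow> r \<in> order_ge t \<Longrightarrow> part t r \<in> J t"
  unfolding initial_part_def by blast

lemma J_E:
  assumes "v \<in> J t"
  obtains r where "r \<in> I" "r \<in> order_ge t" "v = part t r"
  using assms unfolding initial_part_def by blast

lemma J_forms: "v \<in> J t \<Longrightarrow> v \<in> forms t"
  using J_E part_forms by metis

lemma J_add: "u \<in> J t \<Longrightarrow> v \<in> J t \<Longrightarrow> u + v \<in> J t"
  by (elim J_E) (auto simp: part_add[symmetric] intro: J_I ideal2_add order_ge_add)

lemma J_mult:
  assumes "u \<in> forms s" "v \<in> J t"
  shows "u * v \<in> J (s + t)"
proof -
  obtain r where r: "r \<in> I" "r \<in> order_ge t" "v = part t r" using J_E[OF assms(2)] .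
  have "part (s + t) (u * r) = u * v"
    using part_mult[OF form_order_ge[OF assms(1)] r(2)] r(3) part_of_form[OF assms(1)] by simp
  then show ?thesis
    using J_I[OF ideal2_mult[OF r(1)] order_ge_mult[OF form_order_ge[OF assms(1)] r(2)]] by metis
qed

lemma J_mult_Suc: "l \<in> forms 1 \<Longrightarrow> v \<in> J t \<Longrightarrow> l * v \<in> J (Suc t)"
  using J_mult[of l 1 v t] by simp

lemma J_scale: "v \<in> J t \<Longrightarrow> ps_const c * v \<in> J t"
  using J_mult[of "ps_const c" 0 v t] by simp

lemma J_0: "0 \<in> J t"
  using J_I[OF zero_ideal, of t] by simp

lemma J_subspace: "ps.subspace (J t)"
  by (rule ps.subspaceI) (auto intro: J_0 J_add J_scale)

lemma J_diff: "u \<in> J t \<Longrightarrow> v \<in> J t \<Longrightarrow> u - v \<in> J t"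
  by (rule ps.subspace_diff[OF J_subspace])

lemma J_finite_dim [simp]: "ps.finite_dim (J t)"
  by (rule ps.finite_dim_subset[OF _ finite_dim_forms[of t]]) (auto intro: J_forms)

lemma dim_J_le: "ps.dim (J t) \<le> ps.dim (forms t :: 'k pser3 set)"
  by (rule ps.dim_mono_finite) (auto intro: J_forms)

lemma hf_add_dim: "hf I t + ps.dim (J t) = ps.dim (forms t :: 'k pser3 set)"
  unfolding hf_def using dim_J_le by simp

lemma ideal_order: "r \<in> I \<Longrightarrow> r \<in> order_ge 2"
  unfolding ideal2_def using f2 g2 by (auto intro: order_ge_add order_ge_mult_left)

lemma J_trivial:
  assumes "t < 2"
  shows "J t = {0}"
proof -
  have "v = 0" if "v \<in> J t" for v
    using that part_of_order_ge[OF order_ge_mono[OF _ ideal_order], of t] assms by (elim J_E) simp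
  then show ?thesis using J_0 by blast
qed

lemma hf_0: "hf I 0 = 1" and hf_1: "hf I 1 = 3"
proof -
  have "ps.dim {0 :: 'k pser3} = 0" using ps.dim_le_card[of "{0}" "{}"] by simp
  then show "hf I 0 = 1" "hf I 1 = 3"
    using hf_add_dim[of 0] hf_add_dim[of 1]
    by (simp_all add: J_trivial dim_forms_0 dim_forms_1[unfolded One_nat_def])
qed

text \<open>Multiplication by \<open>l\<close> from degree \<open>t\<close> to degree
  \<open>t + 1\<close> of the associated graded ring is surjective.\<close>

definition generated_mod :: "'k pser3 \<Rightarrow> nat \<Rightarrow> bool"
  where "generated_mod l t \<longleftrightarrow> (\<forall>F\<in>forms (Suc t). \<exists>u\<in>forms t. F - l * u \<in> J (Suc t))"

text \<open>The graded ring is generated in degree 1, so surjectivity passes to the next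
  degree.\<close>

lemma generated_mod_Suc:
  assumes l: "l \<in> forms 1" and gen: "generated_mod l t"
  shows "generated_mod l (Suc t)"
  unfolding generated_mod_def
proof
  fix F :: "'k pser3" assume "F \<in> forms (Suc (Suc t))"
  then obtain A B C where F: "A \<in> forms (Suc t)" "B \<in> forms (Suc t)" "C \<in> forms (Suc t)"
      "F = ps_x * A + ps_y * B + ps_z * C"
    by (rule forms_Suc_split)
  obtain a b c where abc: "a \<in> forms t" "b \<in> forms t" "c \<in> forms t"
      "A - l * a \<in> J (Suc t)" "B - l * b \<in> J (Suc t)" "C - l * c \<in> J (Suc t)"
    using F gen unfolding generated_mod_def by metis
  have "F - l * (ps_x * a + ps_y * b + ps_z * c) =
      ps_x * (A - l * a) + ps_y * (B - l * b) + ps_z * (C - l * c)"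
    unfolding F(4) by (simp add: algebra_simps)
  also have "\<dots> \<in> J (Suc (Suc t))" by (intro J_add J_mult_Suc abc xyz_forms)
  finally show "\<exists>u\<in>forms (Suc t). F - l * u \<in> J (Suc (Suc t))"
    using abc by (intro bexI[of _ "ps_x * a + ps_y * b + ps_z * c"] forms_add forms_mult_Suc xyz_forms)
qed

text \<open>Multiplication by \<open>l\<close> sends a complement of \<open>J t\<close> to a set
  spanning the forms of degree \<open>t + 1\<close> modulo \<open>J (Suc t)\<close>.\<close>

lemma hf_Suc_le:
  assumes l: "l \<in> forms 1" and gen: "generated_mod l t"
  shows "hf I (Suc t) \<le> hf I t"
proof -
  obtain C where C: "finite C" "C \<subseteq> forms t" "ps.dim (J t) + card C = ps.dim (forms t :: 'k pser3 set)"
      "\<And>u. u \<in> forms t \<Longrightarrow> \<exists>v\<in>J t. \<exists>s\<in>ps.span C. u = v + s"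
    using ps.complement_exists[OF finite_dim_forms J_subspace _ forms_subspace, of t] J_forms
    by (metis subsetI)
  have "ps.dim (forms (Suc t) :: 'k pser3 set) \<le> ps.dim (J (Suc t)) + card ((*) l ` C)"
  proof (rule ps.dim_le_add_card)
    fix F :: "'k pser3" assume "F \<in> forms (Suc t)"
    then obtain u where u: "u \<in> forms t" "F - l * u \<in> J (Suc t)" using gen unfolding generated_mod_def by blast
    obtain v s where vs: "v \<in> J t" "s \<in> ps.span C" "u = v + s" using C(4)[OF u(1)] by blast
    have "F = ((F - l * u) + l * v) + l * s" unfolding vs(3) by (simp add: algebra_simps)
    moreover have "(F - l * u) + l * v \<in> J (Suc t)" using u(2) J_mult_Suc[OF l vs(1)] by (rule J_add)
    ultimately show "\<exists>v\<in>J (Suc t). \<exists>s\<in>ps.span ((*) l ` C). F = v + s"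
      using mult_mem_span_image[OF vs(2)] by blast
  qed (use C(1) in simp_all)
  also have "card ((*) l ` C) \<le> card C" using C(1) by (rule card_image_le)
  finally have "ps.dim (forms (Suc t) :: 'k pser3 set) \<le> ps.dim (J (Suc t)) + card C" by simp
  then show ?thesis using C(3) hf_add_dim[of t] hf_add_dim[of "Suc t"] by linarith
qed

lemma hf_decreasing:
  assumes "l \<in> forms 1" "generated_mod l N" "N \<le> t"
  shows "hf I (Suc t) \<le> hf I t"
proof -
  have "generated_mod l t"
    using assms(3,2,1) by (induction t rule: dec_induct) (auto intro: generated_mod_Suc)
  then show ?thesis using hf_Suc_le[OF assms(1)] by blast
qed

end

lemma linear_coords_replace:
  assumes co: "linear_coords P Q R" and l: "l = ps_const a * P + ps_const b * Q + ps_const c * R" and c: "c \<noteq> 0"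
  shows "linear_coords P Q l"
  unfolding linear_coords_def
proof (intro conjI ballI)
  note co_forms = linear_coords_formsD[OF co]
  show "{P, Q, l} \<subseteq> forms 1"
    unfolding l using co_forms by (auto intro!: forms_add forms_scale)
  fix m :: "'a pser3" assume "m \<in> forms 1"
  then obtain x y z where m: "m = ps_const x * P + ps_const y * Q + ps_const z * R"
    using co unfolding linear_coords_def by blast
  define k where "k = z / c"
  have "ps_const z * R = ps_const k * (ps_const c * R)"
    using c by (simp add: k_def mult.assoc[symmetric] ps_const_mult[symmetric])
  also have "ps_const c * R = l - ps_const a * P - ps_const b * Q" unfolding l by simp
  finally have "m = ps_const x * P + ps_const y * Q + ps_const k * (l - ps_const a * P - ps_const b * Q)"
    unfolding m by simp
  then have "m = ps_const (x - k * a) * P + ps_const (y - k * b) * Q + ps_const k * l"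
    by (simp add: algebra_simps ps_const_mult ps_const_diff del: ps.scale_scale)
  then show "\<exists>a b c. m = ps_const a * P + ps_const b * Q + ps_const c * l" by blast
qed

section \<open>Flats when the conics share a linear factor\<close>

sublocale common_factor \<subseteq> order2_pair f g
  by unfold_locales (use f g in auto)

context common_factor
begin

abbreviation LH :: "nat \<Rightarrow> 'k pser3 set"
  where "LH s \<equiv> (*) L ` forms s"

lemma dim_LH: "ps.dim (LH s) = ps.dim (forms s :: 'k pser3 set)"
  by (rule dim_image_mult[OF finite_dim_forms forms_subspace L(2)])

lemma LH_J:
  assumes "c \<in> forms t" "c' \<in> forms t"
  shows "L * (l1 * c + l2 * c') \<in> J (t + 2)"
proof -
  have o: "c \<in> order_ge t" "c' \<in> order_ge t" using assms form_order_ge by blast+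
  show ?thesis
    using J_I[OF ideal2_combination combination_order[OF o]] part_combination[OF o] assms by (simp add: part_of_form)
qed

text \<open>Since \<open>L (l1, l2)\<close> lies in the initial ideal, the multiples of
  \<open>L\<close> in one degree are covered as soon as a single power of \<open>w\<close> times
  \<open>L\<close> is, and this persists in higher degrees.\<close>

lemma L_power_J:
  assumes "L * w ^ s \<in> J (Suc s)" "s \<le> t"
  shows "LH t \<subseteq> J (Suc t)"
proof -
  have w: "L * w ^ t \<in> J (Suc t)"
    using assms(2,1)
  proof (induction t rule: dec_induct)
    case (step t)
    then have "w * (L * w ^ t) \<in> J (Suc (Suc t))" using J_mult_Suc lw_forms by blast
    then show ?case by (simp add: mult_ac)
  qed
  have "L * u \<in> J (Suc t)" if u: "u \<in> forms t" for u
  proof (cases t)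
    case 0
    then obtain c where "u = ps_const c" using u forms_0_const by blast
    then show ?thesis using J_scale[OF w, of c] 0 by (simp add: mult.commute)
  next
    case (Suc s)
    obtain A B c where "A \<in> forms s" "B \<in> forms s" "u = l1 * A + l2 * B + ps_const c * w ^ Suc s"
      using forms_Suc_split_power[OF co] u unfolding Suc by blast
    then have "L * u = L * (l1 * A + l2 * B) + ps_const c * (L * w ^ t)" "L * (l1 * A + l2 * B) \<in> J (Suc t)"
      using LH_J[of A s B] Suc by (simp_all add: algebra_simps)
    then show ?thesis using J_add J_scale[OF w] by metis
  qed
  then show ?thesis by blast
qed

text \<open>While the initial ideal lies between \<open>L (l1, l2)\<close> and \<open>(L)\<close>,
  the Hilbert function in degree \<open>t\<close> is \<open>t + 2\<close> or \<open>t + 1\<close>,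
  the latter when \<open>L w^(t-1)\<close> has been reached. Equal values in degrees
  \<open>m + 1\<close> and \<open>m + 2\<close> must both be \<open>m + 3\<close>: the power is
  missing in the first degree and present in the second.\<close>

lemma flat_imp_new_generator:
  assumes flat: "hf I (Suc m) = hf I (Suc (Suc m))"
    and sub: "J (Suc m) \<subseteq> LH m" "J (Suc (Suc m)) \<subseteq> LH (Suc m)"
  shows "L * w ^ m \<notin> J (Suc m)" "L * w ^ Suc m \<in> J (Suc (Suc m))"
proof -
  let ?H = "\<lambda>t. ps.dim (forms t :: 'k pser3 set)"
  have fin: "ps.finite_dim (LH t)" and subsp: "ps.subspace (LH t)" for t
    using finite_dim_image_mult[OF finite_dim_forms] subspace_image_mult[OF forms_subspace] by blast+
  have le: "ps.dim (J (Suc (Suc m))) \<le> ?H (Suc m)"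
    using ps.dim_mono_finite[OF fin sub(2)] dim_LH by simp
  have ge: "?H m \<le> ps.dim (J (Suc m)) + 1"
  proof -
    have "ps.dim (LH m) \<le> ps.dim (J (Suc m)) + card {L * w ^ m}"
    proof (rule ps.dim_le_add_card)
      fix F assume "F \<in> LH m"
      then obtain u where u: "u \<in> forms m" "F = L * u" by blast
      show "\<exists>v\<in>J (Suc m). \<exists>s\<in>ps.span {L * w ^ m}. F = v + s"
      proof (cases m)
        case 0
        then obtain c where "u = ps_const c" using u forms_0_const by blast
        then have "F = 0 + ps_const c * (L * w ^ m)" using u(2) 0 by (simp add: mult.commute)
        then show ?thesis using J_0 ps.span_scale[OF ps.span_base[of "L * w ^ m" "{L * w ^ m}"], of c] by blast
      next
        case (Suc s)
        obtain A B c where AB: "A \<in> forms s" "B \<in> forms s" "u = l1 * A + l2 * B + ps_const c * w ^ Suc s"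
          using forms_Suc_split_power[OF co] u(1) unfolding Suc by blast
        then have "F = L * (l1 * A + l2 * B) + ps_const c * (L * w ^ m)" using u(2) Suc by (simp add: algebra_simps)
        moreover have "L * (l1 * A + l2 * B) \<in> J (Suc m)" using LH_J[OF AB(1,2)] Suc by simp
        ultimately show ?thesis using ps.span_scale[OF ps.span_base[of "L * w ^ m" "{L * w ^ m}"], of c] by blast
      qed
    qed simp_all
    then show ?thesis using dim_LH by simp
  qed
  note hfs = hf_add_dim[of "Suc m"] hf_add_dim[of "Suc (Suc m)"]
    dim_forms_Suc[of m, where 'k = 'k] dim_forms_Suc[of "Suc m", where 'k = 'k]
  show "L * w ^ m \<notin> J (Suc m)"
  proof
    assume "L * w ^ m \<in> J (Suc m)"
    then have "J (Suc m) = LH m" using L_power_J[of m m] sub(1) by blast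
    then have "ps.dim (J (Suc m)) = ?H m" using dim_LH by simp
    then show False using flat le hfs by linarith
  qed
  show "L * w ^ Suc m \<in> J (Suc (Suc m))"
  proof (rule ccontr)
    assume no: "L * w ^ Suc m \<notin> J (Suc (Suc m))"
    have "\<not> ps.dim (LH (Suc m)) \<le> ps.dim (J (Suc (Suc m)))"
    proof
      assume "ps.dim (LH (Suc m)) \<le> ps.dim (J (Suc (Suc m)))"
      then have "J (Suc (Suc m)) = LH (Suc m)"
        by (rule ps.subspace_eq_of_dim_le[OF fin subsp J_subspace sub(2)])
      moreover have "L * w ^ Suc m \<in> LH (Suc m)" using linear_power_forms[OF lw_forms(3)] by blast
      ultimately show False using no by simp
    qed
    then show False using flat ge hfs dim_LH[of "Suc m"] by linarith
  qed
qed

text \<open>The zeros of the initial ideal lie in the point \<open>l1 = l2 = 0\<close> and the zeros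
  of \<open>u\<close> on the line \<open>L = 0\<close>; \<open>l\<close> is chosen to avoid them.
  Modulo \<open>l\<close> a product \<open>L B\<close> then lies in the initial ideal, because
  \<open>B\<close> can be taken in \<open>(l1, l2)\<close>, and \<open>u\<close> supplies the
  remaining form \<open>Q^(s+1)\<close>.\<close>

lemma plane_curve_generator:
  assumes u: "u \<in> J (Suc s)" "u \<notin> LH s" and inf: "infinite (UNIV :: 'k set)"
  obtains l where "l \<in> forms 1" "generated_mod l s"
proof -
  obtain Q R where co': "linear_coords L Q R" using linear_coords_extend1[OF L] .
  have coRQ: "linear_coords L R Q" using linear_coords_swap(2)[OF co'] .
  obtain \<theta> where "dehomogenization L R Q \<theta>" using dehomogenization_exists[OF coRQ] by blast
  note \<theta> = dehomogenizationD[OF this]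
  define p where "p = \<theta> (Suc s) u"
  have p: "p \<noteq> 0" using \<theta>(7)[OF J_forms[OF u(1)]] u(2) unfolding p_def by blast
  obtain x1 x2 x3 where x: "L = ps_const x1 * l1 + ps_const x2 * l2 + ps_const x3 * w"
    using co L(1) unfolding linear_coords_def by blast
  obtain y1 y2 y3 where y: "Q = ps_const y1 * l1 + ps_const y2 * l2 + ps_const y3 * w"
    using co linear_coords_formsD(2)[OF co'] unfolding linear_coords_def by blast
  obtain z1 z2 z3 where z: "R = ps_const z1 * l1 + ps_const z2 * l2 + ps_const z3 * w"
    using co linear_coords_formsD(3)[OF co'] unfolding linear_coords_def by blast
  have not_all: "x3 \<noteq> 0 \<or> y3 \<noteq> 0 \<or> z3 \<noteq> 0"
  proof (rule ccontr)
    assume no: "\<not> ?thesis"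
    obtain a b c where "w = ps_const a * L + ps_const b * Q + ps_const c * R"
      using co' lw_forms(3) unfolding linear_coords_def by blast
    also have "\<dots> = ps_const (a * x1 + b * y1 + c * z1) * l1 + ps_const (a * x2 + b * y2 + c * z2) * l2"
      unfolding x y z using no by (simp add: algebra_simps ps_const_mult ps_const_add del: ps.scale_scale)
    finally have "ps_const (- (a * x1 + b * y1 + c * z1)) * l1 + ps_const (- (a * x2 + b * y2 + c * z2)) * l2 + ps_const 1 * w = 0"
      by (simp only: ps_const_uminus) simp
    then show False using linear_coords_independent[OF co] by fastforce
  qed
  \<comment> \<open>If \<open>L\<close> has no \<open>w\<close> term, the point
    \<open>l1 = l2 = 0\<close> is on the line \<open>L = 0\<close>; the extra factor keeps
    \<open>l\<close> from vanishing there.\<close>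
  define q where "q = (if x3 = 0 then p * [:z3, - y3:] else p)"
  have "x3 = 0 \<Longrightarrow> [:z3, - y3:] \<noteq> 0" using not_all by auto
  then have "q \<noteq> 0" using p unfolding q_def by (simp only: mult_eq_0_iff split: if_split) simp
  then have "finite {c. poly q c = 0}" by (rule poly_roots_finite)
  then have "{c. poly q c = 0} \<noteq> UNIV" using inf by metis
  then obtain c where "poly q c \<noteq> 0" by blast
  then have c: "poly p c \<noteq> 0" "x3 = 0 \<Longrightarrow> z3 - c * y3 \<noteq> 0" by (auto simp: q_def split: if_splits)
  \<comment> \<open>When \<open>L\<close> has a \<open>w\<close> term, this multiple of
    \<open>L\<close> makes the \<open>w\<close> coefficient of \<open>l\<close> equal to 1.\<close>
  define d where "d = (if x3 = 0 then 0 else (z3 - c * y3 - 1) / x3)"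
  define l where "l = ps_const (- d) * L + ps_const (- c) * Q + ps_const 1 * R"
  have l: "l \<in> forms 1"
    unfolding l_def using linear_coords_formsD[OF co'] by (intro forms_add forms_scale)
  have "linear_coords L Q l" by (rule linear_coords_replace[OF co' l_def]) simp
  then have col: "linear_coords l L Q"
    using linear_coords_swap by blast
  have "l = ps_const (z1 - c * y1 - d * x1) * l1 + ps_const (z2 - c * y2 - d * x2) * l2 + ps_const (z3 - c * y3 - d * x3) * w"
    unfolding l_def x y z by (simp add: algebra_simps ps_const_mult ps_const_diff ps_const_add ps_const_uminus del: ps.scale_scale)
  moreover have "z3 - c * y3 - d * x3 \<noteq> 0" using c(2) by (auto simp: d_def)
  ultimately have col12: "linear_coords l1 l2 l" by (rule linear_coords_replace[OF co])
  have \<theta>l: "poly (\<theta> (Suc t) (l * F)) c = 0" for t F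
  proof -
    have "l * F = ps_const (- d) * (L * F) + (ps_const (- c) * (Q * F) + R * F)"
      unfolding l_def by (simp add: algebra_simps)
    then have "\<theta> (Suc t) (l * F) = smult (- d) (\<theta> (Suc t) (L * F)) + (smult (- c) (\<theta> (Suc t) (Q * F)) + \<theta> (Suc t) (R * F))"
      by (simp only: \<theta>(1,2))
    then show ?thesis by (simp add: \<theta>(4,5,6))
  qed
  obtain A B k where AB: "A \<in> forms s" "B \<in> forms s" "u = l * A + L * B + ps_const k * Q ^ Suc s"
    using forms_Suc_split_power[OF col J_forms[OF u(1)]] .
  have \<theta>Q: "\<theta> t (Q ^ t) = 1" for t by (induction t) (simp_all add: \<theta>(3,6))
  have "p = \<theta> (Suc s) (l * A) + \<theta> (Suc s) (L * B) + smult k (\<theta> (Suc s) (Q ^ Suc s))"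
    unfolding p_def AB(3) by (simp only: \<theta>(1,2))
  \<comment> \<open>Dehomogenizing and setting \<open>T = c\<close> evaluates at the point
    \<open>L = l = 0\<close>, normalized by \<open>Q = 1\<close>; there \<open>l A\<close> and
    \<open>L B\<close> vanish.\<close>
  then have "poly p c = k" using \<theta>l[of s A] \<theta>Q[of "Suc s"] by (simp add: \<theta>(4))
  then have k: "k \<noteq> 0" using c(1) by simp
  have s0: "s \<noteq> 0"
  proof
    assume "s = 0"
    then have "u = 0" using u(1) J_trivial[of 1] by simp
    then show False using u(2) by (auto intro!: image_eqI[of _ _ 0])
  qed
  have LB: "\<exists>e\<in>forms s. L * B - l * e \<in> J (Suc s)" if B: "B \<in> forms s" for B
  proof -
    obtain s' where s': "s = Suc s'" using s0 by (cases s) auto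
    obtain c1 c2 c3 where cs: "c1 \<in> forms s'" "c2 \<in> forms s'" "c3 \<in> forms s'" "B = l1 * c1 + l2 * c2 + l * c3"
      using forms_Suc_split3[OF col12] B unfolding s' by blast
    have "L * B - l * (L * c3) = L * (l1 * c1 + l2 * c2)" unfolding cs(4) by (simp add: algebra_simps)
    moreover have "L * (l1 * c1 + l2 * c2) \<in> J (Suc (Suc s'))" using LH_J[OF cs(1,2)] by simp
    ultimately have "L * B - l * (L * c3) \<in> J (Suc (Suc s'))" by metis
    then show ?thesis using forms_mult_Suc[OF L(1) cs(3)] unfolding s' by blast
  qed
  have "generated_mod l s" unfolding generated_mod_def
  proof
    fix F :: "'k pser3" assume "F \<in> forms (Suc s)"
    then obtain A' B' k' where AB': "A' \<in> forms s" "B' \<in> forms s" "F = l * A' + L * B' + ps_const k' * Q ^ Suc s"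
      using forms_Suc_split_power[OF col] by blast
    obtain e where e: "e \<in> forms s" "L * B - l * e \<in> J (Suc s)" using LB[OF AB(2)] by blast
    obtain e' where e': "e' \<in> forms s" "L * B' - l * e' \<in> J (Suc s)" using LB[OF AB'(2)] by blast
    let ?r = "ps_const (k' / k)"
    have "ps_const k' = ?r * ps_const k" using k by (simp add: ps_const_mult[symmetric])
    then have "F - l * (A' + e' - ?r * (A + e)) = (L * B' - l * e') + ?r * (u - (L * B - l * e))"
      unfolding AB'(3) AB(3) by (simp add: algebra_simps del: ps.scale_scale)
    also have "\<dots> \<in> J (Suc s)" by (intro J_add J_scale J_diff u e e')
    finally show "\<exists>v\<in>forms s. F - l * v \<in> J (Suc s)"
      using AB AB' e e' by (intro bexI[of _ "A' + e' - ?r * (A + e)"] forms_add forms_diff forms_scale)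
  qed
  then show ?thesis using that l by blast
qed

text \<open>\<open>N\<close> is one less than the degree in which the initial ideal leaves
  \<open>(L)\<close>. If \<open>N \<le> n\<close>, the function no longer rises from
  \<open>n\<close> on, which the strict inequality in a flat will exclude; otherwise its value at
  \<open>N\<close> bounds the multiplicity.\<close>

lemma flat_bound:
  assumes flat: "hf I n = hf I (Suc n)" and inf: "infinite (UNIV :: 'k set)"
  obtains N where "\<And>t. N \<le> t \<Longrightarrow> hf I (Suc t) \<le> hf I t" "N \<le> n \<or> hf I N \<le> 2 * n"
proof -
  have "n \<noteq> 0" using flat hf_0 hf_1 by (cases n) auto
  then obtain m where m: "n = Suc m" by (cases n) auto
  have key: "\<exists>s<2 * n. \<not> J (Suc s) \<subseteq> LH s"
    if sub: "J (Suc m) \<subseteq> LH m" "J (Suc (Suc m)) \<subseteq> LH (Suc m)"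
  proof (rule ccontr)
    assume no: "\<not> ?thesis"
    note new = flat_imp_new_generator[OF flat[unfolded m] sub]
    obtain r0 where r0: "r0 \<in> I" "r0 \<in> order_ge (m + 2)" "part (m + 2) r0 = L * w ^ Suc m"
      using new(2) by (elim J_E) simp
    show False
    proof (rule initial_parts_in_plane_contradiction[OF r0])
      fix r assume "r \<in> I" "r \<in> order_ge (Suc m)"
      then show "part (Suc m) r \<noteq> L * w ^ m" using new(1) J_I by metis
    next
      fix s r assume "s < 2 * Suc m" "r \<in> I" "r \<in> order_ge (Suc s)"
      then have "part (Suc s) r \<in> LH s" using no J_I m by blast
      then show "\<exists>u\<in>forms s. part (Suc s) r = L * u" by blast
    qed
  qed
  show ?thesis
  proof (cases "\<exists>s. \<not> J (Suc s) \<subseteq> LH s")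
    case False
    then show ?thesis using key by blast
  next
    case True
    define s where "s = (LEAST s. \<not> J (Suc s) \<subseteq> LH s)"
    have s: "\<not> J (Suc s) \<subseteq> LH s" unfolding s_def by (rule LeastI_ex[OF True])
    have below: "J (Suc t) \<subseteq> LH t" if "t < s" for t using not_less_Least that unfolding s_def by blast
    obtain u where "u \<in> J (Suc s)" "u \<notin> LH s" using s by blast
    then obtain l where l: "l \<in> forms 1" "generated_mod l s" using plane_curve_generator inf by metis
    have "s \<le> n \<or> hf I s \<le> 2 * n"
    proof (cases "s \<le> n")
      case False
      then have sub: "J (Suc m) \<subseteq> LH m" "J (Suc (Suc m)) \<subseteq> LH (Suc m)" using below m by auto
      obtain s' where "s' < 2 * n" "\<not> J (Suc s') \<subseteq> LH s'" using key[OF sub] by blast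
      then have "s < 2 * n" using Least_le[of "\<lambda>s. \<not> J (Suc s) \<subseteq> LH s" s'] unfolding s_def by linarith
      obtain t where t: "s = Suc t" using False by (cases s) auto
      have "L * w ^ Suc m \<in> J (Suc (Suc m))" using flat_imp_new_generator[OF flat[unfolded m] sub] by blast
      then have "LH t \<subseteq> J (Suc t)" using L_power_J[of "Suc m" t] False m t by simp
      then have "J s = LH t" using below[of t] t by auto
      then have "ps.dim (J s) = ps.dim (forms t :: 'k pser3 set)" using dim_LH by simp
      \<comment> \<open>In degree \<open>s\<close> the initial ideal is all of \<open>(L)\<close>,
        so the value is that of a polynomial ring in two variables.\<close>
      then have "hf I s = s + 1" using hf_add_dim[of s] dim_forms_Suc[of t, where 'k = 'k] t by simp
      then show ?thesis using \<open>s < 2 * n\<close> by simp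
    qed simp
    then show ?thesis using that[of s] hf_decreasing[OF l] by blast
  qed
qed

end

section \<open>Pencils of conics\<close>

lemma forms_2_coeffs:
  assumes co: "linear_coords P Q R" and F: "F \<in> forms 2"
  obtains a b c d e h where "F = ps_const a * P\<^sup>2 + ps_const b * (P * Q) + ps_const c * Q\<^sup>2
      + R * (ps_const d * P + ps_const e * Q) + ps_const h * R\<^sup>2"
proof -
  obtain A B k where AB: "A \<in> forms 1" "B \<in> forms 1" "F = P * A + Q * B + ps_const k * R ^ Suc 1"
    using forms_Suc_split_power[OF co, of F 1] F by (auto simp: numeral_2_eq_2)
  obtain a1 a2 a3 where a: "A = ps_const a1 * P + ps_const a2 * Q + ps_const a3 * R"
    using co AB(1) unfolding linear_coords_def by blast
  obtain b1 b2 b3 where b: "B = ps_const b1 * P + ps_const b2 * Q + ps_const b3 * R"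
    using co AB(2) unfolding linear_coords_def by blast
  have "F = ps_const a1 * P\<^sup>2 + ps_const (a2 + b1) * (P * Q) + ps_const b2 * Q\<^sup>2
      + R * (ps_const a3 * P + ps_const b3 * Q) + ps_const k * R\<^sup>2"
    unfolding AB(3) a b by (simp add: algebra_simps power2_eq_square ps_const_add)
  then show ?thesis using that by blast
qed

text \<open>The coordinates are adapted to a point where \<open>F\<close> is nonzero. A square with
  nonzero coefficient allows a coordinate point; otherwise a mixed term gives a point such as (1, 1,
  0), whence differences such as \<open>ps_x - ps_y\<close>.\<close>

lemma quadric_coords:
  assumes F: "F \<in> forms 2" "F \<noteq> (0 :: 'k::field pser3)"
  obtains P Q R a b c d e h where "linear_coords P Q R" "h \<noteq> 0"
    "F = ps_const a * P\<^sup>2 + ps_const b * (P * Q) + ps_const c * Q\<^sup>2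
      + R * (ps_const d * P + ps_const e * Q) + ps_const h * R\<^sup>2"
proof -
  obtain a b c d e h where eq: "F = ps_const a * ps_x\<^sup>2 + ps_const b * (ps_x * ps_y) + ps_const c * ps_y\<^sup>2
      + ps_z * (ps_const d * ps_x + ps_const e * ps_y) + ps_const h * ps_z\<^sup>2"
    using forms_2_coeffs[OF linear_coords_xyz F(1)] .
  have co: "linear_coords ps_x ps_z (ps_y :: 'k pser3)" "linear_coords ps_y ps_z (ps_x :: 'k pser3)"
    using linear_coords_xyz linear_coords_swap by blast+
  have co1: "linear_coords (ps_x - ps_y) ps_z (ps_y :: 'k pser3)"
    by (rule linear_coordsI[of _ _ _ 1 0 1 0 0 1 0 1 0]) (simp_all add: forms_diff)
  have co2: "linear_coords (ps_x - ps_z) ps_y (ps_z :: 'k pser3)"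
    by (rule linear_coordsI[of _ _ _ 1 0 1 0 1 0 0 0 1]) (simp_all add: forms_diff)
  have co3: "linear_coords (ps_y - ps_z) ps_x (ps_z :: 'k pser3)"
    by (rule linear_coordsI[of _ _ _ 0 1 0 1 0 1 0 0 1]) (simp_all add: forms_diff)
  consider "h \<noteq> 0" | "c \<noteq> 0" | "a \<noteq> 0" | "h = 0" "c = 0" "a = 0" "b \<noteq> 0"
    | "h = 0" "c = 0" "a = 0" "b = 0" "d \<noteq> 0" | "h = 0" "c = 0" "a = 0" "b = 0" "d = 0" "e \<noteq> 0"
    | "h = 0" "c = 0" "a = 0" "b = 0" "d = 0" "e = 0" by blast
  then show ?thesis
  proof cases
    case 1
    then show ?thesis using that[OF linear_coords_xyz _ eq] by blast
  next
    case 2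
    have "F = ps_const a * ps_x\<^sup>2 + ps_const d * (ps_x * ps_z) + ps_const h * ps_z\<^sup>2
      + ps_y * (ps_const b * ps_x + ps_const e * ps_z) + ps_const c * ps_y\<^sup>2"
      unfolding eq by (simp add: algebra_simps)
    then show ?thesis using that[OF co(1) 2] by blast
  next
    case 3
    have "F = ps_const c * ps_y\<^sup>2 + ps_const e * (ps_y * ps_z) + ps_const h * ps_z\<^sup>2
      + ps_x * (ps_const b * ps_y + ps_const d * ps_z) + ps_const a * ps_x\<^sup>2"
      unfolding eq by (simp add: algebra_simps)
    then show ?thesis using that[OF co(2) 3] by blast
  next
    case 4
    have "F = ps_const 0 * (ps_x - ps_y)\<^sup>2 + ps_const d * ((ps_x - ps_y) * ps_z) + ps_const 0 * ps_z\<^sup>2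
      + ps_y * (ps_const b * (ps_x - ps_y) + ps_const (d + e) * ps_z) + ps_const b * ps_y\<^sup>2"
      unfolding eq 4 by (simp add: algebra_simps power2_eq_square ps_const_add)
    then show ?thesis using that[OF co1 4(4)] by blast
  next
    case 5
    have "F = ps_const 0 * (ps_x - ps_z)\<^sup>2 + ps_const 0 * ((ps_x - ps_z) * ps_y) + ps_const 0 * ps_y\<^sup>2
      + ps_z * (ps_const d * (ps_x - ps_z) + ps_const e * ps_y) + ps_const d * ps_z\<^sup>2"
      unfolding eq 5 by (simp add: algebra_simps power2_eq_square)
    then show ?thesis using that[OF co2 5(5)] by blast
  next
    case 6
    have "F = ps_const 0 * (ps_y - ps_z)\<^sup>2 + ps_const 0 * ((ps_y - ps_z) * ps_x) + ps_const 0 * ps_x\<^sup>2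
      + ps_z * (ps_const e * (ps_y - ps_z) + ps_const 0 * ps_x) + ps_const e * ps_z\<^sup>2"
      unfolding eq 6 by (simp add: algebra_simps power2_eq_square)
    then show ?thesis using that[OF co3 6(6)] by blast
  next
    case 7
    then show ?thesis using eq F(2) by simp
  qed
qed

lemma linear_poly: "degree p \<le> 1 \<Longrightarrow> p = [:coeff p 0, coeff p 1:]"
  by (rule poly_eqI) (auto simp: coeff_pCons coeff_eq_0 split: nat.split)

text \<open>The expression is the resultant in \<open>R\<close> of \<open>R^2 + a R + b\<close> and
  \<open>\<beta> R + \<alpha>\<close>. If it vanishes, \<open>- \<alpha> / \<beta>\<close> is a
  common root; the degree bounds make it a polynomial \<open>- \<delta>\<close>, and the quadratic
  splits as \<open>(R + \<delta>) (R + a - \<delta>)\<close>.\<close>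

lemma resultant_zero_factor:
  fixes \<alpha> \<beta> a b :: "'k::field poly"
  assumes deg: "degree \<alpha> \<le> 2" "degree \<beta> \<le> 1" "degree a \<le> 1" "degree b \<le> 2"
    and res: "\<alpha>\<^sup>2 - a * \<alpha> * \<beta> + b * \<beta>\<^sup>2 = 0" and \<beta>: "\<beta> \<noteq> 0"
  obtains \<delta> where "degree \<delta> \<le> 1" "\<alpha> = \<beta> * \<delta>" "b = \<delta> * (a - \<delta>)"
proof -
  have sq: "\<alpha>\<^sup>2 = \<beta> * (a * \<alpha> - b * \<beta>)" using res by (simp add: algebra_simps power2_eq_square)
  have "\<exists>\<delta>. degree \<delta> \<le> 1 \<and> \<alpha> = \<beta> * \<delta>"
  proof (cases "degree \<beta> = 0")
    case True
    then obtain k where k: "\<beta> = [:k:]" using degree_eq_zeroE by blast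
    then have "k \<noteq> 0" using \<beta> by simp
    \<comment> \<open>Divisibility by a constant is automatic; the degree of the quotient is the
      issue, and a square of degree 4 cannot equal a right side of degree at most 3.\<close>
    have "degree \<alpha> \<le> 1"
    proof (rule ccontr)
      assume "\<not> ?thesis"
      then have d: "degree \<alpha> = 2" using deg by simp
      then have "degree (\<alpha>\<^sup>2) = 4"
        using degree_mult_eq[of \<alpha> \<alpha>] by (cases "\<alpha> = 0") (simp_all add: power2_eq_square)
      moreover have "degree (\<beta> * (a * \<alpha> - b * \<beta>)) \<le> 3"
      proof -
        have "degree (a * \<alpha>) \<le> 3" using degree_mult_le[of a \<alpha>] deg by simp
        moreover have "degree (b * \<beta>) \<le> 3" using degree_mult_le[of b \<beta>] deg by simp
        ultimately have "degree (a * \<alpha> - b * \<beta>) \<le> 3" by (rule degree_diff_le)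
        then show ?thesis using degree_mult_le[of \<beta> "a * \<alpha> - b * \<beta>"] True by simp
      qed
      ultimately show False unfolding sq by simp
    qed
    moreover have "\<alpha> = \<beta> * smult (1 / k) \<alpha>" using \<open>k \<noteq> 0\<close> by (simp add: k)
    ultimately show ?thesis using degree_smult_le[of "1 / k" \<alpha>] by (meson le_trans)
  next
    case False
    then have d1: "degree \<beta> = 1" using deg by simp
    define r where "r = - coeff \<beta> 0 / coeff \<beta> 1"
    have b1: "coeff \<beta> 1 \<noteq> 0" using d1 \<beta> by (metis leading_coeff_0_iff)
    have \<beta>eq: "\<beta> = smult (coeff \<beta> 1) [:- r, 1:]"
      using linear_poly[of \<beta>] d1 b1 by (simp add: r_def)
    have "poly (\<alpha>\<^sup>2) r = 0" unfolding sq by (subst \<beta>eq) simp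
    then have "[:- r, 1:] dvd \<alpha>" by (simp add: poly_eq_0_iff_dvd[symmetric])
    then obtain \<kappa> where \<kappa>: "\<alpha> = [:- r, 1:] * \<kappa>" by blast
    have "degree \<kappa> \<le> 1"
    proof (cases "\<kappa> = 0")
      case False
      then have "degree \<alpha> = 1 + degree \<kappa>" unfolding \<kappa> by (subst degree_mult_eq) simp_all
      then show ?thesis using deg by simp
    qed simp
    then have "degree (smult (1 / coeff \<beta> 1) \<kappa>) \<le> 1" using degree_smult_le le_trans by blast
    moreover have "\<beta> * smult (1 / coeff \<beta> 1) \<kappa> = smult (coeff \<beta> 1) [:- r, 1:] * smult (1 / coeff \<beta> 1) \<kappa>"
      using \<beta>eq by metis
    then have "\<alpha> = \<beta> * smult (1 / coeff \<beta> 1) \<kappa>"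
      using b1 unfolding \<kappa> by (simp only: mult_smult_left mult_smult_right smult_smult) simp
    ultimately show ?thesis by blast
  qed
  then obtain \<delta> where \<delta>: "degree \<delta> \<le> 1" "\<alpha> = \<beta> * \<delta>" by blast
  have "\<beta>\<^sup>2 * (\<delta>\<^sup>2 - a * \<delta> + b) = 0" using res unfolding \<delta>(2) by (simp add: algebra_simps power2_eq_square)
  then have "\<delta>\<^sup>2 - a * \<delta> + b = 0" using \<beta> by simp
  moreover have "b = (\<delta>\<^sup>2 - a * \<delta> + b) + \<delta> * (a - \<delta>)" by (simp add: algebra_simps power2_eq_square)
  ultimately have "b = \<delta> * (a - \<delta>)" by simp
  then show ?thesis using that \<delta> by blast
qed

text \<open>A zero resultant yields a common linear factor. Otherwise there is a line
  \<open>l = 0\<close> on which the resultant is nonzero, and two binary quadrics without common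
  zero generate all binary cubics.\<close>

lemma quadric_pencil:
  fixes F G :: "'k::field pser3"
  assumes inf: "infinite (UNIV :: 'k set)" and FG: "F \<in> forms 2" "G \<in> forms 2"
    and F0: "F \<noteq> 0" and GF: "\<And>c. G \<noteq> ps_const c * F"
  obtains (common) L l1 l2 where "L \<in> forms 1" "l1 \<in> forms 1" "l2 \<in> forms 1" "F = L * l1" "G = L * l2"
  | (coprime) l where "l \<in> forms 1"
      "\<And>E. E \<in> forms 3 \<Longrightarrow> \<exists>u\<in>forms 2. \<exists>A\<in>forms 1. \<exists>B\<in>forms 1. E = l * u + A * F + B * G"
proof -
  obtain P Q R b0 b1 b2 a0 a1 h where co: "linear_coords P Q R" and h: "h \<noteq> 0" and
    Feq: "F = ps_const b0 * P\<^sup>2 + ps_const b1 * (P * Q) + ps_const b2 * Q\<^sup>2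
      + R * (ps_const a0 * P + ps_const a1 * Q) + ps_const h * R\<^sup>2"
    using quadric_coords[OF FG(1) F0] .
  obtain c0 c1 c2 d0 d1 h' where
    Geq: "G = ps_const c0 * P\<^sup>2 + ps_const c1 * (P * Q) + ps_const c2 * Q\<^sup>2
      + R * (ps_const d0 * P + ps_const d1 * Q) + ps_const h' * R\<^sup>2"
    using forms_2_coeffs[OF co FG(2)] .
  note PQR = linear_coords_formsD[OF co]
  define k where "k = inverse h"
  \<comment> \<open>\<open>k\<close> makes the coefficient of \<open>R^2\<close> in \<open>F\<close>
    equal to 1, and subtracting \<open>t F\<close> removes \<open>R^2\<close> from
    \<open>G\<close>.\<close>
  define t where "t = h' * k"
  define A0 A1 B0 B1 B2 where "A0 = k * a0" and "A1 = k * a1"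
    and "B0 = k * b0" and "B1 = k * b1" and "B2 = k * b2"
  define C0 C1 C2 D0 D1 where "C0 = c0 - t * b0" and "C1 = c1 - t * b1" and "C2 = c2 - t * b2"
    and "D0 = d0 - t * a0" and "D1 = d1 - t * a1"
  note AB = A0_def A1_def B0_def B1_def B2_def and CD = C0_def C1_def C2_def D0_def D1_def
  define F1 where "F1 = ps_const B0 * P\<^sup>2 + ps_const B1 * (P * Q) + ps_const B2 * Q\<^sup>2
      + R * (ps_const A0 * P + ps_const A1 * Q) + R\<^sup>2"
  define G1 where "G1 = ps_const C0 * P\<^sup>2 + ps_const C1 * (P * Q) + ps_const C2 * Q\<^sup>2
      + R * (ps_const D0 * P + ps_const D1 * Q)"
  have hk: "ps_const k * ps_const h = 1" using h by (simp add: k_def ps_const_mult[symmetric])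
  have F1: "F1 = ps_const k * F"
  proof -
    have "ps_const k * F = ps_const B0 * P\<^sup>2 + ps_const B1 * (P * Q) + ps_const B2 * Q\<^sup>2
      + R * (ps_const A0 * P + ps_const A1 * Q) + (ps_const k * ps_const h) * R\<^sup>2"
      unfolding Feq AB by (simp add: algebra_simps ps_const_mult del: ps.scale_scale)
    then show ?thesis unfolding hk F1_def by simp
  qed
  have F: "F = ps_const h * F1"
  proof -
    have "ps_const h * F1 = (ps_const k * ps_const h) * F" unfolding F1 by (simp only: mult_ac)
    then show ?thesis unfolding hk by simp
  qed
  have G: "G = G1 + ps_const t * F"
  proof -
    have "ps_const t * ps_const h = ps_const h'" using h by (simp add: t_def k_def ps_const_mult[symmetric] mult.assoc)
    then have "G1 + ps_const t * F = ps_const c0 * P\<^sup>2 + ps_const c1 * (P * Q) + ps_const c2 * Q\<^sup>2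
      + R * (ps_const d0 * P + ps_const d1 * Q) + (ps_const t * ps_const h) * R\<^sup>2"
      unfolding G1_def Feq CD by (simp add: algebra_simps ps_const_mult ps_const_diff del: ps.scale_scale)
    then show ?thesis unfolding Geq \<open>ps_const t * ps_const h = ps_const h'\<close> ..
  qed
  \<comment> \<open>For \<open>P = 1\<close> and \<open>Q = T\<close> the normalized conics are
    \<open>R^2 + a R + b\<close> and \<open>\<beta> R + \<alpha>\<close>.\<close>
  define \<alpha> \<beta> a b where "\<alpha> = [:C0, C1, C2:]" and "\<beta> = [:D0, D1:]" and "a = [:A0, A1:]" and "b = [:B0, B1, B2:]"
  note polys = \<alpha>_def \<beta>_def a_def b_def
  define res where "res = \<alpha>\<^sup>2 - a * \<alpha> * \<beta> + b * \<beta>\<^sup>2"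
  show ?thesis
  proof (cases "res = 0")
    case True
    have "\<beta> \<noteq> 0"
    proof
      assume "\<beta> = 0"
      then have "\<alpha> = 0" using True unfolding res_def by simp
      then have "G1 = 0" using \<open>\<beta> = 0\<close> unfolding polys G1_def by simp
      then show False using G GF by simp
    qed
    moreover have "degree \<alpha> \<le> 2" "degree \<beta> \<le> 1" "degree a \<le> 1" "degree b \<le> 2"
      unfolding polys by (auto intro: order_trans[OF degree_pCons_le])
    ultimately obtain \<delta> where \<delta>: "degree \<delta> \<le> 1" "\<alpha> = \<beta> * \<delta>" "b = \<delta> * (a - \<delta>)"
      using resultant_zero_factor[of \<alpha> \<beta> a b] True unfolding res_def by metis
    obtain e0 e1 where e: "\<delta> = [:e0, e1:]" using linear_poly[OF \<delta>(1)] by blast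
    have C: "C0 = D0 * e0" "C1 = D0 * e1 + D1 * e0" "C2 = D1 * e1"
      using \<delta>(2) unfolding polys e by (simp_all add: algebra_simps)
    have B: "B0 = e0 * (A0 - e0)" "B1 = e0 * (A1 - e1) + e1 * (A0 - e0)" "B2 = e1 * (A1 - e1)"
      using \<delta>(3) unfolding polys e by (simp_all add: algebra_simps)
    define L where "L = R + ps_const e0 * P + ps_const e1 * Q"
    define M where "M = R + ps_const (A0 - e0) * P + ps_const (A1 - e1) * Q"
    define N where "N = ps_const D0 * P + ps_const D1 * Q"
    have two: "ps_const 2 = (2 :: 'k pser3)" using ps_const_add[of 1 "1 :: 'k"] by simp
    have "F1 = L * M"
      unfolding F1_def B L_def M_def
      by (simp add: two algebra_simps power2_eq_square ps_const_mult ps_const_add ps_const_diff del: ps.scale_scale)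
    moreover have "G1 = L * N"
      unfolding G1_def C L_def N_def
      by (simp add: algebra_simps power2_eq_square ps_const_mult ps_const_add del: ps.scale_scale)
    ultimately have "F = L * (ps_const h * M)" "G = L * (N + ps_const t * (ps_const h * M))"
      using F G by (simp_all add: algebra_simps del: ps.scale_scale)
    moreover have "L \<in> forms 1" "M \<in> forms 1" "N \<in> forms 1"
      unfolding L_def M_def N_def by (intro forms_add forms_scale PQR)+
    ultimately show ?thesis using common[of L "ps_const h * M" "N + ps_const t * (ps_const h * M)"]
      by (simp only: forms_add forms_scale)
  next
    case False
    then have "finite {c. poly res c = 0}" by (rule poly_roots_finite)
    then have "{c. poly res c = 0} \<noteq> UNIV" using inf by metis
    then obtain c where c: "poly res c \<noteq> 0" by blast
    \<comment> \<open>The line \<open>Q = c P\<close> through the point \<open>P = Q = 0\<close>,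
      with \<open>c\<close> not a root of the resultant.\<close>
    define l where "l = ps_const (- c) * P + ps_const 0 * R + ps_const 1 * Q"
    have l: "l \<in> forms 1" unfolding l_def by (intro forms_add forms_scale PQR)
    have "linear_coords P R l"
      by (rule linear_coords_replace[OF linear_coords_swap(2)[OF co] l_def]) simp
    then have col: "linear_coords l P R" using linear_coords_swap by blast
    have Q: "Q = l + ps_const c * P" unfolding l_def by (simp add: ps_const_uminus)
    define a' b' \<alpha>' \<beta>' where "a' = poly a c" and "b' = poly b c" and "\<alpha>' = poly \<alpha> c" and "\<beta>' = poly \<beta> c"
    note vals = a'_def b'_def \<alpha>'_def \<beta>'_def
    \<comment> \<open>\<open>\<Phi>\<close> and \<open>\<Gamma>\<close> are the restrictions of
      \<open>k F\<close> and \<open>G - t F\<close> to the line \<open>l = 0\<close>, written in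
      \<open>P\<close> and \<open>R\<close>.\<close>
    define \<Phi> where "\<Phi> = R\<^sup>2 + ps_const a' * (P * R) + ps_const b' * P\<^sup>2"
    define \<Gamma> where "\<Gamma> = ps_const \<beta>' * (P * R) + ps_const \<alpha>' * P\<^sup>2"
    define \<mu> where "\<mu> = ps_const B1 * P + ps_const B2 * (Q + ps_const c * P) + ps_const A1 * R"
    define \<nu> where "\<nu> = ps_const C1 * P + ps_const C2 * (Q + ps_const c * P) + ps_const D1 * R"
    have \<mu>\<nu>: "\<mu> \<in> forms 1" "\<nu> \<in> forms 1"
      unfolding \<mu>_def \<nu>_def by (intro forms_add forms_scale PQR)+
    have \<Phi>: "\<Phi> = ps_const k * F - l * \<mu>"
    proof -
      have "a' = A0 + c * A1" "b' = B0 + c * (B1 + c * B2)" by (simp_all add: vals polys)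
      then show ?thesis
        unfolding F1[symmetric] F1_def \<Phi>_def \<mu>_def Q
        by (simp add: algebra_simps power2_eq_square ps_const_mult ps_const_add del: ps.scale_scale)
    qed
    have \<Gamma>: "\<Gamma> = G - ps_const t * F - l * \<nu>"
    proof -
      have "\<beta>' = D0 + c * D1" "\<alpha>' = C0 + c * (C1 + c * C2)" by (simp_all add: vals polys)
      moreover have "G - ps_const t * F = G1" using G by simp
      ultimately show ?thesis
        unfolding G1_def \<Gamma>_def \<nu>_def Q
        by (simp add: algebra_simps power2_eq_square ps_const_mult ps_const_add del: ps.scale_scale)
    qed
    define W where "W = {E. \<exists>u\<in>forms 2. \<exists>A\<in>forms 1. \<exists>B\<in>forms 1. E = l * u + A * F + B * G}"
    have W_I: "l * u + A * F + B * G \<in> W" if "u \<in> forms 2" "A \<in> forms 1" "B \<in> forms 1" for u A B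
      unfolding W_def using that by blast
    have W_add: "E + E' \<in> W" if "E \<in> W" "E' \<in> W" for E E'
    proof -
      obtain u A B u' A' B' where w: "u \<in> forms 2" "A \<in> forms 1" "B \<in> forms 1" "E = l * u + A * F + B * G"
        "u' \<in> forms 2" "A' \<in> forms 1" "B' \<in> forms 1" "E' = l * u' + A' * F + B' * G"
        using \<open>E \<in> W\<close> \<open>E' \<in> W\<close> unfolding W_def by blast
      have "E + E' = l * (u + u') + (A + A') * F + (B + B') * G" unfolding w(4,8) by (simp add: algebra_simps)
      moreover have "l * (u + u') + (A + A') * F + (B + B') * G \<in> W" by (intro W_I forms_add w)
      ultimately show ?thesis by simp
    qed
    have W_scale: "ps_const d * E \<in> W" if "E \<in> W" for E d
    proof -
      obtain u A B where w: "u \<in> forms 2" "A \<in> forms 1" "B \<in> forms 1" "E = l * u + A * F + B * G"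
        using \<open>E \<in> W\<close> unfolding W_def by blast
      have "ps_const d * E = l * (ps_const d * u) + (ps_const d * A) * F + (ps_const d * B) * G"
        unfolding w(4) by (simp add: algebra_simps del: ps.scale_scale)
      moreover have "l * (ps_const d * u) + (ps_const d * A) * F + (ps_const d * B) * G \<in> W"
        by (intro W_I forms_scale w)
      ultimately show ?thesis by simp
    qed
    have W_l: "l * u \<in> W" if "u \<in> forms 2" for u using W_I[OF that zero_forms zero_forms] by simp
    have forms_11: "A * B \<in> forms 2" if "A \<in> forms 1" "B \<in> forms 1" for A B :: "'k pser3"
      using forms_mult[OF that] by (simp add: numeral_2_eq_2)
    have W_\<Phi>: "A * \<Phi> \<in> W" if A: "A \<in> forms 1" for A
    proof -
      have "A * \<Phi> = l * (- (A * \<mu>)) + (ps_const k * A) * F + 0 * G" unfolding \<Phi> by (simp add: algebra_simps)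
      moreover have "l * (- (A * \<mu>)) + (ps_const k * A) * F + 0 * G \<in> W"
        by (intro W_I forms_uminus forms_11 forms_scale A \<mu>\<nu> zero_forms)
      ultimately show ?thesis by simp
    qed
    have W_\<Gamma>: "A * \<Gamma> \<in> W" if A: "A \<in> forms 1" for A
    proof -
      have "A * \<Gamma> = l * (- (A * \<nu>)) + (ps_const (- t) * A) * F + A * G"
        unfolding \<Gamma> by (simp add: algebra_simps ps_const_uminus)
      moreover have "l * (- (A * \<nu>)) + (ps_const (- t) * A) * F + A * G \<in> W"
        by (intro W_I forms_uminus forms_11 forms_scale A \<mu>\<nu>)
      ultimately show ?thesis by simp
    qed
    define \<rho> where "\<rho> = \<alpha>'\<^sup>2 - a' * \<alpha>' * \<beta>' + b' * \<beta>'\<^sup>2"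
    have \<rho>: "\<rho> \<noteq> 0" using c unfolding \<rho>_def vals res_def by simp
    have div\<rho>: "E \<in> W" if "ps_const \<rho> * E \<in> W" for E
    proof -
      have "ps_const (inverse \<rho>) * (ps_const \<rho> * E) = E"
        using \<rho> by (simp add: mult.assoc[symmetric] ps_const_mult[symmetric])
      then show ?thesis using W_scale[OF that, of "inverse \<rho>"] by (simp only:)
    qed
    \<comment> \<open>The coefficients solve the Sylvester system of \<open>\<Phi>\<close> and
      \<open>\<Gamma>\<close> by Cramer's rule; its determinant is \<open>\<rho>\<close>.\<close>
    have W1: "P * P\<^sup>2 \<in> W"
    proof (rule div\<rho>)
      have "ps_const \<rho> * (P * P\<^sup>2) = ps_const (\<alpha>' - a' * \<beta>') * (P * \<Gamma>) +
          ps_const (\<beta>'\<^sup>2) * (P * \<Phi>) + ps_const (- \<beta>') * (R * \<Gamma>)"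
        unfolding \<rho>_def \<Phi>_def \<Gamma>_def
        by (simp add: algebra_simps power2_eq_square ps_const_mult ps_const_add ps_const_diff ps_const_uminus del: ps.scale_scale)
      also have "\<dots> \<in> W" by (intro W_add W_scale W_\<Phi> W_\<Gamma> PQR)
      finally show "ps_const \<rho> * (P * P\<^sup>2) \<in> W" .
    qed
    have W2: "R * P\<^sup>2 \<in> W"
    proof (rule div\<rho>)
      have "ps_const \<rho> * (R * P\<^sup>2) = ps_const (b' * \<beta>') * (P * \<Gamma>) +
          ps_const (- (\<alpha>' * \<beta>')) * (P * \<Phi>) + ps_const \<alpha>' * (R * \<Gamma>)"
        unfolding \<rho>_def \<Phi>_def \<Gamma>_def
        by (simp add: algebra_simps power2_eq_square ps_const_mult ps_const_add ps_const_diff ps_const_uminus del: ps.scale_scale)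
      also have "\<dots> \<in> W" by (intro W_add W_scale W_\<Phi> W_\<Gamma> PQR)
      finally show "ps_const \<rho> * (R * P\<^sup>2) \<in> W" .
    qed
    have W3: "P * R\<^sup>2 \<in> W"
    proof -
      have "P * R\<^sup>2 = P * \<Phi> + (ps_const (- a') * (R * P\<^sup>2) + ps_const (- b') * (P * P\<^sup>2))"
        unfolding \<Phi>_def by (simp add: algebra_simps power2_eq_square ps_const_uminus)
      also have "\<dots> \<in> W" by (intro W_add W_scale W_\<Phi> PQR W1 W2)
      finally show ?thesis .
    qed
    have W4: "R * R\<^sup>2 \<in> W"
    proof -
      have "R * R\<^sup>2 = R * \<Phi> + (ps_const (- a') * (P * R\<^sup>2) + ps_const (- b') * (R * P\<^sup>2))"
        unfolding \<Phi>_def by (simp add: algebra_simps power2_eq_square ps_const_uminus)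
      also have "\<dots> \<in> W" by (intro W_add W_scale W_\<Phi> PQR W2 W3)
      finally show ?thesis .
    qed
    \<comment> \<open>Modulo \<open>l\<close> a cubic is binary in \<open>P\<close> and
      \<open>R\<close>, and its four monomials have been shown to lie in \<open>W\<close>.\<close>
    have "E \<in> W" if E: "E \<in> forms 3" for E
    proof -
      obtain u v k1 where u: "u \<in> forms 2" "v \<in> forms 2" "E = l * u + P * v + ps_const k1 * R ^ Suc 2"
        using forms_Suc_split_power[OF col, of E 2] E by (auto simp: numeral_3_eq_3 numeral_2_eq_2)
      obtain b0 b1 b2 a0 a1 h where v: "v = ps_const b0 * l\<^sup>2 + ps_const b1 * (l * P) + ps_const b2 * P\<^sup>2
          + R * (ps_const a0 * l + ps_const a1 * P) + ps_const h * R\<^sup>2"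
        using forms_2_coeffs[OF col u(2)] .
      have "E = l * (u + ps_const b0 * (l * P) + ps_const b1 * (P * P) + ps_const a0 * (R * P)) +
          (ps_const b2 * (P * P\<^sup>2) + ps_const a1 * (R * P\<^sup>2) + ps_const h * (P * R\<^sup>2) + ps_const k1 * (R * R\<^sup>2))"
        unfolding u(3) v by (simp add: algebra_simps power2_eq_square eval_nat_numeral del: ps.scale_scale)
      also have "\<dots> \<in> W"
        by (intro W_add W_scale W_l W1 W2 W3 W4 forms_add forms_scale forms_11 u l PQR)
      finally show ?thesis .
    qed
    then show ?thesis using coprime[OF l] unfolding W_def by blast
  qed
qed

text \<open>For coprime conics \<open>N = 2\<close> works: the initial ideal contains at most a
  two-dimensional space of conics, so the values begin with 1, 3 and at least 4, and positions 0 and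
  1 cannot be flat.\<close>

theorem hf_flat_bound:
  fixes f g :: "'k::field pser3"
  assumes inf: "infinite (UNIV :: 'k set)" and fg: "f \<in> order_ge 2" "g \<in> order_ge 2"
    and F0: "part 2 f \<noteq> 0" and GF: "\<And>c. part 2 g \<noteq> ps_const c * part 2 f"
    and flat: "hf (ideal2 f g) n = hf (ideal2 f g) (Suc n)"
  obtains N where "\<And>t. N \<le> t \<Longrightarrow> hf (ideal2 f g) (Suc t) \<le> hf (ideal2 f g) t"
    "N \<le> n \<or> hf (ideal2 f g) N \<le> 2 * n"
  using inf part_forms part_forms F0 GF
proof (cases rule: quadric_pencil[of "part 2 f" "part 2 g"])
  case (common L l1 l2)
  have L: "L \<noteq> 0" using F0 common by auto
  have "a = 0 \<and> b = 0" if "ps_const a * l1 + ps_const b * l2 = 0" for a b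
  proof -
    have *: "ps_const a * part 2 f + ps_const b * part 2 g = 0"
      unfolding common(4,5) using that by (metis distrib_left mult.left_commute mult_zero_right)
    have "b = 0"
    proof (rule ccontr)
      assume b: "b \<noteq> 0"
      have "part 2 g = ps_const (inverse b) * (ps_const b * part 2 g)"
        using b by (simp add: mult.assoc[symmetric] ps_const_mult[symmetric])
      also have "ps_const b * part 2 g = ps_const (- a) * part 2 f"
        using * by (simp add: ps_const_uminus eq_neg_iff_add_eq_0 add.commute)
      finally show False using GF[of "inverse b * - a"] by (simp add: ps_const_mult)
    qed
    then show ?thesis using * F0 by simp
  qed
  then obtain w where co: "linear_coords l1 l2 w" using linear_coords_extend2 common(2,3) by blast
  interpret common_factor L l1 l2 w f g
    by unfold_locales (use co common L fg in auto)
  show ?thesis using flat_bound[OF flat inf] that by metis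
next
  case (coprime l)
  interpret order2_pair f g by unfold_locales (use fg in auto)
  have J2: "part 2 f \<in> J 2" "part 2 g \<in> J 2" using fg ideal2_mem J_I by blast+
  have "generated_mod l 2" unfolding generated_mod_def
  proof
    fix E :: "'k pser3" assume "E \<in> forms (Suc 2)"
    then obtain u A B where E: "u \<in> forms 2" "A \<in> forms 1" "B \<in> forms 1" "E = l * u + A * part 2 f + B * part 2 g"
      using coprime(2)[of E] by auto
    have "E - l * u = A * part 2 f + B * part 2 g" using E(4) by simp
    also have "\<dots> \<in> J (Suc 2)" by (intro J_add J_mult_Suc E J2)
    finally show "\<exists>u\<in>forms 2. E - l * u \<in> J (Suc 2)" using E(1) by blast
  qed
  then have dec: "\<And>t. 2 \<le> t \<Longrightarrow> hf I (Suc t) \<le> hf I t" using hf_decreasing coprime(1) by blast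
  have "J 2 \<subseteq> ps.span {part 2 f, part 2 g}"
  proof
    fix v assume "v \<in> J 2"
    then obtain r where r: "r \<in> I" "v = part 2 r" by (elim J_E)
    then obtain u u' where "r = u * f + u' * g" unfolding ideal2_def by blast
    moreover have "part 2 (u * f) = part 0 u * part 2 f" "part 2 (u' * g) = part 0 u' * part 2 g"
      using part_mult[of u 0 f 2] part_mult[of u' 0 g 2] fg by (simp_all add: numeral_2_eq_2)
    ultimately have v: "v = part 0 u * part 2 f + part 0 u' * part 2 g" using r(2) by (simp add: part_add)
    obtain c c' where "part 0 u = ps_const c" "part 0 u' = ps_const c'" using forms_0_const part_forms by blast
    then show "v \<in> ps.span {part 2 f, part 2 g}"
      unfolding v by (simp only:) (intro ps.span_add ps.span_scale ps.span_base; simp)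
  qed
  then have "ps.dim (J 2) \<le> card {part 2 f, part 2 g}" by (intro ps.dim_le_card) simp_all
  also have "\<dots> \<le> 2" by (simp add: card_insert_if)
  finally have "hf I 2 \<ge> 4"
    using hf_add_dim[of 2] dim_forms_Suc[of 1, where 'k = 'k] dim_forms_1[where 'k = 'k] by (simp add: numeral_2_eq_2)
  then have "n \<noteq> 0 \<and> n \<noteq> 1" using flat hf_0 hf_1
    by (cases n; cases "n - 1") (auto simp: numeral_2_eq_2)
  then show ?thesis using that[of 2] dec by simp
qed

section \<open>The Hilbert function as a dimension of forms\<close>

lemma PS3_simps [simp]:
  "carrier PS3 = UNIV" "x \<otimes>\<^bsub>PS3\<^esub> y = x * y" "x \<oplus>\<^bsub>PS3\<^esub> y = x + y" "\<one>\<^bsub>PS3\<^esub> = 1" "\<zero>\<^bsub>PS3\<^esub> = 0"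
  by (simp_all add: ring_of_type_algebra_def)

lemma cring_PS3: "cring PS3"
  by (rule cring_from_type_algebra)

lemma PS3_uminus [simp]: "\<ominus>\<^bsub>PS3\<^esub> x = - x"
proof -
  interpret cring "PS3 :: 'a pser3 ring" by (rule cring_PS3)
  show ?thesis by (rule minus_equality) simp_all
qed

lemma PS3_minus [simp]: "x \<ominus>\<^bsub>PS3\<^esub> y = x - y"
  by (simp add: a_minus_def)

lemma PS3_idealI:
  assumes "0 \<in> I" "\<And>a b. a \<in> I \<Longrightarrow> b \<in> I \<Longrightarrow> a + b \<in> I" "\<And>a r. a \<in> I \<Longrightarrow> r * a \<in> I"
  shows "ideal I (PS3 :: 'k::field pser3 ring)"
proof -
  interpret cring "PS3 :: 'k pser3 ring" by (rule cring_PS3)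
  show ?thesis
  proof (rule idealI)
    show "subgroup I (add_monoid PS3)"
    proof (rule add.subgroupI)
      show "\<ominus>\<^bsub>PS3\<^esub> a \<in> I" if "a \<in> I" for a
        using assms(3)[OF that, of "- 1"] by simp
    qed (use assms in auto)
  qed (use assms ring_axioms in \<open>auto simp: mult.commute\<close>)
qed

lemma ideal_order_ge: "ideal (order_ge t) (PS3 :: 'k::field pser3 ring)"
  by (rule PS3_idealI) (auto intro: order_ge_add order_ge_mult_left)

lemma ideal_ideal2: "ideal (ideal2 f g) (PS3 :: 'k::field pser3 ring)"
  by (rule PS3_idealI) (use ideal2_combination[of 0 f 0 g] in \<open>auto intro: ideal2_add ideal2_mult\<close>)

lemma genideal_ideal2: "Idl\<^bsub>PS3\<^esub> {f, g} = ideal2 f (g :: 'k::field pser3)"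
proof -
  interpret cring "PS3 :: 'k pser3 ring" by (rule cring_PS3)
  have i: "ideal (Idl\<^bsub>PS3\<^esub> {f, g}) PS3" by (rule genideal_ideal) simp
  have mem: "{f, g} \<subseteq> Idl\<^bsub>PS3\<^esub> {f, g}" by (rule genideal_self) simp
  show ?thesis
  proof
    show "Idl\<^bsub>PS3\<^esub> {f, g} \<subseteq> ideal2 f g"
      by (rule genideal_minimal[OF ideal_ideal2]) (simp add: ideal2_mem)
    show "ideal2 f g \<subseteq> Idl\<^bsub>PS3\<^esub> {f, g}"
    proof
      fix r assume "r \<in> ideal2 f g"
      then obtain u v where "r = u * f + v * g" unfolding ideal2_def by blast
      moreover have "u * f \<in> Idl\<^bsub>PS3\<^esub> {f, g}" "v * g \<in> Idl\<^bsub>PS3\<^esub> {f, g}"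
        using ideal.I_l_closed[OF i, of f u] ideal.I_l_closed[OF i, of g v] mem by simp_all
      ultimately show "r \<in> Idl\<^bsub>PS3\<^esub> {f, g}"
        using additive_subgroup.a_closed[OF ideal.axioms(1)[OF i], of "u * f" "v * g"] by simp
    qed
  qed
qed

lemma genideal_xyz: "Idl\<^bsub>PS3\<^esub> {ps_x, ps_y, ps_z} = (order_ge 1 :: 'k::field pser3 set)"
proof -
  interpret cring "PS3 :: 'k pser3 ring" by (rule cring_PS3)
  let ?G = "Idl\<^bsub>PS3\<^esub> {ps_x, ps_y, ps_z :: 'k pser3}"
  have i: "ideal ?G PS3" by (rule genideal_ideal) simp
  have mem: "{ps_x, ps_y, ps_z} \<subseteq> ?G" by (rule genideal_self) simp
  show ?thesis
  proof
    show "?G \<subseteq> order_ge 1"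
      by (rule genideal_minimal[OF ideal_order_ge]) (use form_order_ge[OF xyz_forms(1)] form_order_ge[OF xyz_forms(2)] form_order_ge[OF xyz_forms(3)] in simp)
    show "order_ge 1 \<subseteq> ?G"
    proof
      fix r :: "'k pser3" assume "r \<in> order_ge 1"
      then obtain a b c where r: "r = ps_x * a + ps_y * b + ps_z * c"
        using order_ge_Suc_split[of r 0] by auto
      have "ps_x * a \<in> ?G" "ps_y * b \<in> ?G" "ps_z * c \<in> ?G"
        using ideal.I_r_closed[OF i, of ps_x a] ideal.I_r_closed[OF i, of ps_y b] ideal.I_r_closed[OF i, of ps_z c] mem by simp_all
      then show "r \<in> ?G"
        using additive_subgroup.a_closed[OF ideal.axioms(1)[OF i]] unfolding r by (metis PS3_simps(3))
    qed
  qed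
qed

section \<open>Comparison with dimensions in the quotient ring\<close>

lemma (in vector_space) span_list_combination:
  assumes "s \<in> span (set bs)"
  obtains cs where "length cs = length bs" "s = sum_list (map2 scale cs bs)"
proof -
  have "\<exists>cs. length cs = length bs \<and> s = sum_list (map2 scale cs bs)"
    using assms
  proof (induction bs arbitrary: s)
    case (Cons b bs)
    then obtain c where "s - scale c b \<in> span (set bs)" using span_breakdown_eq[of s b "set bs"] by auto
    then obtain cs where "length cs = length bs" "s - scale c b = sum_list (map2 scale cs bs)"
      using Cons.IH by blast
    then show ?case by (intro exI[of _ "c # cs"]) (simp add: algebra_simps)
  qed simp
  then show ?thesis using that by blast
qed

lemma (in vector_space) list_combination_span:
  "sum_list (map2 scale cs bs) \<in> span (set bs)"
proof (induction cs bs rule: list_induct2')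
  case (4 c cs b bs)
  have "span (set bs) \<subseteq> span (set (b # bs))" by (rule span_mono) auto
  then show ?case using 4 by (auto intro!: span_add span_scale intro: span_base)
qed (auto simp: span_zero)

text \<open>Products in \<open>ideals_set A\<close> are ideal products. Splitting a series as
  \<open>x a + y b + z c\<close> shows that one more factor of the maximal ideal raises the order by
  exactly one.\<close>

lemma power_maximal_ideal_quotient:
  fixes I :: "'k::field pser3 set"
  assumes I: "ideal I PS3"
  defines "A \<equiv> PS3 Quot I"
  shows "(a_r_coset PS3 I ` order_ge 1) [^]\<^bsub>ideals_set A\<^esub> t = a_r_coset PS3 I ` order_ge t"
proof -
  interpret I: ideal I "PS3 :: 'k pser3 ring" by (rule I)
  interpret h: ring_hom_ring "PS3 :: 'k pser3 ring" A "a_r_coset PS3 I"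
    unfolding A_def by (rule I.rcos_ring_hom_ring)
  let ?h = "a_r_coset PS3 I"
  have h_mult: "?h (x * y) = ?h x \<otimes>\<^bsub>A\<^esub> ?h y" and h_add: "?h (x + y) = ?h x \<oplus>\<^bsub>A\<^esub> ?h y" for x y
    using h.hom_mult[of x y] h.hom_add[of x y] by simp_all
  show ?thesis
  proof (induction t)
    case 0
    have "carrier A = ?h ` UNIV"
      unfolding A_def FactRing_def A_RCOSETS_def' by auto
    then show ?case by (simp add: nat_pow_def ideals_set_def)
  next
    case (Suc t)
    have "(?h ` order_ge 1) [^]\<^bsub>ideals_set A\<^esub> Suc t = ideal_prod A (?h ` order_ge t) (?h ` order_ge 1)"
      using Suc unfolding nat_pow_def by (simp add: ideals_set_def)
    also have "\<dots> = ?h ` order_ge (Suc t)"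
    proof
      show "ideal_prod A (?h ` order_ge t) (?h ` order_ge 1) \<subseteq> ?h ` order_ge (Suc t)"
      proof
        fix s assume "s \<in> ideal_prod A (?h ` order_ge t) (?h ` order_ge 1)"
        then show "s \<in> ?h ` order_ge (Suc t)"
        proof induction
          case (prod i j)
          then obtain a b where ab: "a \<in> order_ge t" "i = ?h a" "b \<in> order_ge 1" "j = ?h b" by blast
          then have "a * b \<in> order_ge (Suc t)" using order_ge_mult[of a t b 1] by simp
          then show ?case using h_mult ab by blast
        next
          case (sum s1 s2)
          then obtain a b where ab: "a \<in> order_ge (Suc t)" "s1 = ?h a" "b \<in> order_ge (Suc t)" "s2 = ?h b" by blast
          then show ?case using h_add[of a b] order_ge_add[OF ab(1,3)] by (metis imageI)
        qed
      qed
      show "?h ` order_ge (Suc t) \<subseteq> ideal_prod A (?h ` order_ge t) (?h ` order_ge 1)"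
      proof
        fix s assume "s \<in> ?h ` order_ge (Suc t)"
        then obtain r where r: "r \<in> order_ge (Suc t)" "s = ?h r" by blast
        obtain a b c where abc: "a \<in> order_ge t" "b \<in> order_ge t" "c \<in> order_ge t" "r = ps_x * a + ps_y * b + ps_z * c"
          using order_ge_Suc_split[OF r(1)] .
        have p: "?h (l * a) \<in> ideal_prod A (?h ` order_ge t) (?h ` order_ge 1)" if "l \<in> forms 1" "a \<in> order_ge t" for l a
        proof -
          have "?h a \<otimes>\<^bsub>A\<^esub> ?h l \<in> ideal_prod A (?h ` order_ge t) (?h ` order_ge 1)"
            using that form_order_ge by (intro ideal_prod.prod) auto
          then show ?thesis using h_mult[of a l] by (simp add: mult.commute)
        qed
        show "s \<in> ideal_prod A (?h ` order_ge t) (?h ` order_ge 1)"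
          unfolding r(2) abc(4) h_add by (intro ideal_prod.sum p abc xyz_forms)
      qed
    qed
    finally show ?case .
  qed
qed

text \<open>The images of a basis \<open>C\<close> of a complement of \<open>J t\<close> in the
  forms of degree \<open>t\<close> are a basis of the graded piece; \<open>h\<close> is the
  composite of the two quotient maps.\<close>

lemma (in order2_pair) HF_eq_hf: "HF (ideal2 f g) t = hf (ideal2 f g) t"
proof -
  interpret PS: cring "PS3 :: 'k pser3 ring" by (rule cring_PS3)
  interpret I: ideal I "PS3 :: 'k pser3 ring" by (rule ideal_ideal2)
  define A where "A = PS3 Quot I"
  let ?h1 = "a_r_coset PS3 I"
  define N where "N = ?h1 ` order_ge (Suc t)"
  have N: "ideal N A"
    unfolding N_def A_def by (rule PS.ring_ideal_imp_quot_ideal[OF ideal_ideal2 ideal_order_ge])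
  interpret N: ideal N A by (rule N)
  define Q where "Q = A Quot N"
  define h where "h = a_r_coset A N \<circ> ?h1"
  have h_hom: "h \<in> ring_hom PS3 Q"
    unfolding h_def Q_def A_def
    by (rule ring_hom_trans[OF I.rcos_ring_hom]) (use N.rcos_ring_hom in \<open>simp add: A_def\<close>)
  have ringQ: "ring Q" unfolding Q_def by (rule N.quotient_is_ring)
  interpret h: ring_hom_ring "PS3 :: 'k pser3 ring" Q h
    by (rule ring_hom_ringI2[OF PS.ring_axioms ringQ h_hom])
  have h_add: "h (x + y) = h x \<oplus>\<^bsub>Q\<^esub> h y" and h_mult: "h (x * y) = h x \<otimes>\<^bsub>Q\<^esub> h y"
    and h_carrier: "h x \<in> carrier Q" for x y
    using h.hom_add[of x y] h.hom_mult[of x y] h.hom_closed[of x] by simp_all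
  have h0: "h 0 = \<zero>\<^bsub>Q\<^esub>" using h.hom_zero by simp

  have h_eq: "h x = h y \<longleftrightarrow> (\<exists>i\<in>I. x - y - i \<in> order_ge (Suc t))" for x y
  proof -
    have car: "?h1 x \<in> carrier A" for x
      using ring_hom_closed[OF I.rcos_ring_hom, of x] unfolding A_def by simp
    interpret h1: ring_hom_ring "PS3 :: 'k pser3 ring" A ?h1
      unfolding A_def by (rule I.rcos_ring_hom_ring)
    have "h x = h y \<longleftrightarrow> ?h1 x \<ominus>\<^bsub>A\<^esub> ?h1 y \<in> N"
      unfolding h_def comp_def using N.quotient_eq_iff_same_a_r_cos[OF N car car] by simp
    also have "?h1 x \<ominus>\<^bsub>A\<^esub> ?h1 y = ?h1 (x - y)"
      using h1.hom_add[of x "- y"] h1.hom_a_inv[of y] by (simp add: a_minus_def)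
    also have "?h1 (x - y) \<in> N \<longleftrightarrow> (\<exists>e\<in>order_ge (Suc t). ?h1 (x - y) = ?h1 e)"
      unfolding N_def by blast
    also have "\<dots> \<longleftrightarrow> (\<exists>e\<in>order_ge (Suc t). x - y - e \<in> I)"
      using PS.quotient_eq_iff_same_a_r_cos[OF ideal_ideal2, of "x - y"] by simp
    also have "\<dots> \<longleftrightarrow> (\<exists>i\<in>I. x - y - i \<in> order_ge (Suc t))"
    proof
      assume "\<exists>e\<in>order_ge (Suc t). x - y - e \<in> I"
      then obtain e where "e \<in> order_ge (Suc t)" "x - y - e \<in> I" by blast
      then show "\<exists>i\<in>I. x - y - i \<in> order_ge (Suc t)" by (intro bexI[of _ "x - y - e"]) simp_all
    next
      assume "\<exists>i\<in>I. x - y - i \<in> order_ge (Suc t)"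
      then obtain i where "i \<in> I" "x - y - i \<in> order_ge (Suc t)" by blast
      then show "\<exists>e\<in>order_ge (Suc t). x - y - e \<in> I" by (intro bexI[of _ "x - y - i"]) simp_all
    qed
    finally show ?thesis .
  qed

  define K where "K = h ` range ps_const"
  \<comment> \<open>The scalars embed because 1 stays nonzero: elements of \<open>I\<close> have
    positive order, so \<open>1 - i\<close> never has.\<close>
  have K: "subfield K Q"
  proof -
    have "field (ring_of_type_algebra :: 'k ring)" by (rule field_from_type_algebra)
    then interpret F: field "ring_of_type_algebra :: 'k ring" .
    have "ps_const \<in> ring_hom (ring_of_type_algebra :: 'k ring) (PS3 :: 'k pser3 ring)"
      by (rule ring_hom_memI) (simp_all add: ring_of_type_algebra_def ps_const_add ps_const_mult)
    then have "h \<circ> ps_const \<in> ring_hom (ring_of_type_algebra :: 'k ring) Q" using h_hom by (rule ring_hom_trans)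
    then interpret hc: ring_hom_ring "ring_of_type_algebra :: 'k ring" Q "h \<circ> ps_const"
      by (rule ring_hom_ringI2[OF F.ring_axioms ringQ])
    have "\<one>\<^bsub>Q\<^esub> \<noteq> \<zero>\<^bsub>Q\<^esub>"
    proof
      assume "\<one>\<^bsub>Q\<^esub> = \<zero>\<^bsub>Q\<^esub>"
      then have "h 1 = h 0" using h.hom_one h0 by simp
      then obtain i where i: "i \<in> I" "1 - i \<in> order_ge (Suc t)" using h_eq[of 1 0] by auto
      have "(1 - i) + i \<in> order_ge 1"
        using order_ge_mono[OF _ i(2), of 1] order_ge_mono[OF _ ideal_order[OF i(1)], of 1] by (intro order_ge_add) simp_all
      then have "ps_coeff (1 :: 'k pser3) 0 0 0 = 0" unfolding order_ge_def by simp
      then show False by (simp add: ps_coeff_1)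
    qed
    then have "subfield ((h \<circ> ps_const) ` carrier (ring_of_type_algebra :: 'k ring)) Q"
      by (rule hc.img_is_subfield(2)[OF F.carrier_is_subfield])
    then show ?thesis unfolding K_def by (simp add: ring_of_type_algebra_def image_comp)
  qed

  obtain C where C: "finite C" "C \<subseteq> forms t" "ps.independent C" "ps.dim (J t) + card C = ps.dim (forms t :: 'k pser3 set)"
      "\<And>u. u \<in> forms t \<Longrightarrow> \<exists>v\<in>J t. \<exists>s\<in>ps.span C. u = v + s" "\<And>s. s \<in> ps.span C \<Longrightarrow> s \<in> J t \<Longrightarrow> s = 0"
    using ps.complement_exists[OF finite_dim_forms J_subspace _ forms_subspace, of t] J_forms
    by (metis subsetI)
  obtain bs where bs: "set bs = C" "distinct bs" using finite_distinct_list[OF C(1)] by blast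
  have spanC: "ps.span C \<subseteq> forms t" using C(2) forms_subspace by (rule ps.span_minimal)

  define lc :: "'k list \<Rightarrow> 'k pser3 list \<Rightarrow> 'k pser3"
    where "lc cs bs = sum_list (map2 (\<lambda>c b. ps_const c * b) cs bs)" for cs bs
  have combine: "ring.combine Q (map (\<lambda>c. h (ps_const c)) cs) (map h bs) = h (lc cs bs)" for cs bs
  proof (induction cs bs rule: list_induct2')
    case (4 c cs b bs)
    then show ?case by (simp add: lc_def ring.combine.simps[OF ringQ] h_add h_mult)
  qed (simp_all add: lc_def ring.combine.simps[OF ringQ] h0)
  have Span: "u \<in> ring.Span Q K (map h bs') \<longleftrightarrow> (\<exists>cs. length cs = length bs' \<and> u = h (lc cs bs'))" for u bs'
  proof -
    have "set (map h bs') \<subseteq> carrier Q" using h_carrier by auto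
    note * = ring.Span_mem_iff_length_version[OF ringQ K this]
    show ?thesis unfolding *
    proof
      assume "\<exists>Ks. set Ks \<subseteq> K \<and> length Ks = length (map h bs') \<and> u = ring.combine Q Ks (map h bs')"
      then obtain Ks where Ks: "set Ks \<subseteq> K" "length Ks = length bs'" "u = ring.combine Q Ks (map h bs')" by auto
      have "\<exists>cs. Ks = map (\<lambda>c. h (ps_const c)) cs"
        using Ks(1) by (intro ex_map_conv[THEN iffD2]) (auto simp: K_def)
      then obtain cs where "Ks = map (\<lambda>c. h (ps_const c)) cs" by blast
      then show "\<exists>cs. length cs = length bs' \<and> u = h (lc cs bs')" using Ks combine by auto
    next
      assume "\<exists>cs. length cs = length bs' \<and> u = h (lc cs bs')"
      then obtain cs where "length cs = length bs'" "u = h (lc cs bs')" by blast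
      then show "\<exists>Ks. set Ks \<subseteq> K \<and> length Ks = length (map h bs') \<and> u = ring.combine Q Ks (map h bs')"
        using combine by (intro exI[of _ "map (\<lambda>c. h (ps_const c)) cs"]) (auto simp: K_def)
    qed
  qed
  have lc_span: "lc cs bs' \<in> ps.span (set bs')" for cs bs'
    unfolding lc_def by (rule ps.list_combination_span)

  \<comment> \<open>No \<open>h b\<close> may lie in the span of its successors: the difference
    would be a combination of \<open>C\<close> equal to the degree \<open>t\<close> component of an
    element of \<open>I\<close>, and \<open>C\<close> is complementary to those.\<close>
  have indep: "ring.independent Q K (map h bs')" if "distinct bs'" "set bs' \<subseteq> C" for bs'
    using that
  proof (induction bs')
    case Nil
    then show ?case using ring.li_Nil[OF ringQ] by simp
  next
    case (Cons b bs')
    have "h b \<notin> ring.Span Q K (map h bs')"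
    proof
      assume "h b \<in> ring.Span Q K (map h bs')"
      then obtain cs where "h b = h (lc cs bs')" unfolding Span by blast
      then obtain i where i: "i \<in> I" "b - lc cs bs' - i \<in> order_ge (Suc t)" unfolding h_eq by blast
      have sub: "ps.span (set bs') \<subseteq> ps.span C" using Cons.prems by (intro ps.span_mono) auto
      have sp: "b - lc cs bs' \<in> ps.span C"
        using Cons.prems lc_span sub by (intro ps.span_diff) (auto intro: ps.span_base)
      then have form: "b - lc cs bs' \<in> forms t" using spanC by blast
      have "b - lc cs bs' = part t i"
        using part_eqI[OF i(2)] part_of_form[OF form] by simp
      moreover have "i \<in> order_ge t"
      proof -
        have "(b - lc cs bs') - (b - lc cs bs' - i) \<in> order_ge t"
          by (rule order_ge_diff[OF form_order_ge[OF form] order_ge_mono[OF _ i(2)]]) simp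
        then show ?thesis by simp
      qed
      ultimately have "b - lc cs bs' = 0" using C(6)[OF sp] J_I[OF i(1)] by metis
      then have "b \<in> ps.span (set bs')" using lc_span[of cs bs'] by simp
      moreover have "set bs' \<subseteq> C - {b}" using Cons.prems by auto
      ultimately have "b \<in> ps.span (C - {b})" using ps.span_mono by blast
      then show False using C(3) Cons.prems unfolding ps.dependent_def by auto
    qed
    then show ?case using ring.li_Cons[OF ringQ h_carrier] Cons by simp
  qed

  have "ring.Span Q K (map h bs) = h ` order_ge t"
  proof
    show "ring.Span Q K (map h bs) \<subseteq> h ` order_ge t"
    proof
      fix u assume "u \<in> ring.Span Q K (map h bs)"
      then obtain cs where "u = h (lc cs bs)" unfolding Span by blast
      moreover have "lc cs bs \<in> order_ge t" using lc_span[of cs bs] bs(1) spanC form_order_ge by blast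
      ultimately show "u \<in> h ` order_ge t" by blast
    qed
    show "h ` order_ge t \<subseteq> ring.Span Q K (map h bs)"
    proof
      fix u assume "u \<in> h ` order_ge t"
      then obtain r where r: "r \<in> order_ge t" "u = h r" by blast
      \<comment> \<open>Modulo order \<open>t + 1\<close> only the degree \<open>t\<close> component
        matters, and its summand in \<open>J t\<close> comes from an element of \<open>I\<close>,
        which \<open>h\<close> kills.\<close>
      obtain v s where vs: "v \<in> J t" "s \<in> ps.span C" "part t r = v + s" using C(5)[OF part_forms] by blast
      obtain i where i: "i \<in> I" "i \<in> order_ge t" "v = part t i" using J_E[OF vs(1)] .
      have "r - s - i = (r - part t r) - (i - part t i)" using vs(3) i(3) by simp
      also have "\<dots> \<in> order_ge (Suc t)" by (intro order_ge_diff[of _ "Suc t"] diff_part_order_ge r i)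
      finally have "h r = h s" unfolding h_eq using i(1) by blast
      moreover obtain cs where "length cs = length bs" "s = lc cs bs"
        using ps.span_list_combination[of s bs] vs(2) bs(1) unfolding lc_def by blast
      ultimately show "u \<in> ring.Span Q K (map h bs)" unfolding Span r(2) by metis
    qed
  qed
  then have "ring.dimension Q (length (map h bs)) K (h ` order_ge t)"
    using ring.dimensionI[OF ringQ K indep[of bs]] bs by simp
  then have "ring.dim Q K (h ` order_ge t) = length (map h bs)"
    using ring.dimI[OF ringQ K] unfolding over_def by blast
  moreover have "HF I t = ring.dim Q K (h ` order_ge t)"
  proof -
    have pow: "(?h1 ` order_ge 1) [^]\<^bsub>ideals_set A\<^esub> s = ?h1 ` order_ge s" for s
      unfolding A_def by (rule power_maximal_ideal_quotient[OF ideal_ideal2])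
    show ?thesis
      unfolding HF_def graded_dim_def genideal_xyz A_def[symmetric] pow N_def[symmetric] Let_def
        Q_def[symmetric] K_def h_def by (simp add: image_comp)
  qed
  moreover have "length bs = card C" using bs distinct_card by metis
  ultimately show ?thesis using C(4) hf_add_dim[of t] by simp
qed

lemma eventually_const_of_decreasing:
  fixes u :: "nat \<Rightarrow> nat"
  assumes "\<And>t. N \<le> t \<Longrightarrow> u (Suc t) \<le> u t"
  obtains e where "eventually (\<lambda>t. u t = e) sequentially" "\<And>t. N \<le> t \<Longrightarrow> e \<le> u t"
proof -
  have anti: "u t \<le> u s" if "N \<le> s" "s \<le> t" for s t
    using that(2,1)
  proof (induction t rule: dec_induct)
    case (step t)
    then show ?case using assms[of t] by simp
  qed simp
  define e where "e = (LEAST e. \<exists>t\<ge>N. u t = e)"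
  have "\<exists>t\<ge>N. u t = e" unfolding e_def by (rule LeastI[of _ "u N"]) blast
  then obtain T where T: "N \<le> T" "u T = e" by blast
  have le: "e \<le> u t" if "N \<le> t" for t unfolding e_def using that by (intro Least_le) blast
  have "u t = e" if "T \<le> t" for t
    using anti[OF T(1) that] le[of t] T that by simp
  then show ?thesis using that le unfolding eventually_sequentially by blast
qed

lemma ps_order_order_ge: "f \<noteq> 0 \<Longrightarrow> f \<in> order_ge (ps_order f)"
  unfolding order_ge_def ps_order_def using not_less_Least by blast

lemma part_ps_order_nonzero:
  assumes "f \<noteq> 0"
  shows "part (ps_order f) f \<noteq> 0"
proof -
  have "\<exists>i j k. ps_coeff f i j k \<noteq> 0"
  proof (rule ccontr)
    assume "\<not> ?thesis"
    then have "f = 0" by (intro ps_eqI) simp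
    then show False using assms by simp
  qed
  then have "\<exists>v i j k. i + j + k = v \<and> ps_coeff f i j k \<noteq> 0" by blast
  then have "\<exists>i j k. i + j + k = ps_order f \<and> ps_coeff f i j k \<noteq> 0"
    unfolding ps_order_def by (rule LeastI_ex)
  then obtain i j k where "i + j + k = ps_order f" "ps_coeff f i j k \<noteq> 0" by blast
  then have "ps_coeff (part (ps_order f) f) i j k \<noteq> 0" by simp
  then show ?thesis by force
qed

text \<open>By contraposition, the ideal condition on polynomial initial forms shows that the
  components of degree 2 are not proportional.\<close>

lemma initial_form_multiple:
  fixes f g :: "'k::field pser3"
  assumes "ps_order f = ps_order g" "part (ps_order f) g = ps_const c * part (ps_order f) f"
  shows "initial_form g \<in> Idl\<^bsub>P3\<^esub> {initial_form f}"
proof -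
  interpret P: cring "P3 :: 'k poly3 ring" by (rule cring_from_type_algebra)
  have car: "carrier (P3 :: 'k poly3 ring) = UNIV" by (simp add: ring_of_type_algebra_def)
  have "initial_form g = [:[:[:c:]:]:] * initial_form f"
  proof (intro poly_eqI)
    fix k j i
    have "ps_coeff (part (ps_order f) g) i j k = ps_coeff (ps_const c * part (ps_order f) f) i j k"
      using assms(2) by simp
    then show "coeff (coeff (coeff (initial_form g) k) j) i = coeff (coeff (coeff ([:[:[:c:]:]:] * initial_form f) k) j) i"
      using assms(1) by (simp add: coeff_initial_form split: if_splits)
  qed
  moreover have "initial_form f \<in> Idl\<^bsub>P3\<^esub> {initial_form f}" by (rule P.genideal_self') (simp add: car)
  moreover have "ideal (Idl\<^bsub>P3\<^esub> {initial_form f}) (P3 :: 'k poly3 ring)"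
    by (rule P.genideal_ideal) (simp add: car)
  ultimately show ?thesis
    using ideal.I_l_closed[of _ "P3 :: 'k poly3 ring" "initial_form f" "[:[:[:c:]:]:]"]
    by (simp add: ring_of_type_algebra_def)
qed

theorem theorem3p6:
  fixes I :: "'k::{alg_closed_field, field_char_0} pser3 set" and e n :: nat
  assumes "type_2_2 I"
    and "e = hs_multiplicity I"
    and "has_flat I n"
  shows "e \<le> 2 * n"
proof -
  obtain f g where I: "I = Idl\<^bsub>PS3\<^esub> {f, g}" and fg: "f \<noteq> 0" "g \<noteq> 0" "ps_order f = 2" "ps_order g = 2"
      and init: "initial_form g \<notin> Idl\<^bsub>P3\<^esub> {initial_form f}"
    using assms(1) unfolding type_2_2_def by blast
  have ord: "f \<in> order_ge 2" "g \<in> order_ge 2" using ps_order_order_ge[of f] ps_order_order_ge[of g] fg by simp_all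
  interpret order2_pair f g by unfold_locales (rule ord)+
  have HF: "HF (Idl\<^bsub>PS3\<^esub> {f, g}) t = hf (ideal2 f g) t" for t
    unfolding genideal_ideal2 by (rule HF_eq_hf)
  have F0: "part 2 f \<noteq> 0" using part_ps_order_nonzero[OF fg(1)] fg(3) by simp
  have GF: "part 2 g \<noteq> ps_const c * part 2 f" for c
    using initial_form_multiple[of f g c] init fg by auto
  have flat: "hf (ideal2 f g) n = hf (ideal2 f g) (Suc n)" "hf (ideal2 f g) (Suc n) < e"
    using assms(2,3) unfolding has_flat_def I HF by simp_all
  obtain N where N: "\<And>t. N \<le> t \<Longrightarrow> hf (ideal2 f g) (Suc t) \<le> hf (ideal2 f g) t"
      "N \<le> n \<or> hf (ideal2 f g) N \<le> 2 * n"
    using hf_flat_bound[OF infinite_UNIV_char_0 ord F0 GF flat(1)] by blast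
  obtain e' where e': "eventually (\<lambda>t. hf (ideal2 f g) t = e') sequentially" "\<And>t. N \<le> t \<Longrightarrow> e' \<le> hf (ideal2 f g) t"
    using eventually_const_of_decreasing[of N "hf (ideal2 f g)"] N(1) by blast
  have "hs_multiplicity I = e'"
    unfolding hs_multiplicity_def I HF
  proof (rule the_equality)
    fix d assume "eventually (\<lambda>t. hf (ideal2 f g) t = d) sequentially"
    with e'(1) have "eventually (\<lambda>t. d = e') sequentially" by eventually_elim simp
    then show "d = e'" by simp
  qed (rule e'(1))
  then have "e = e'" using assms(2) by simp
  \<comment> \<open>With \<open>N \<le> n\<close> the function would decrease to \<open>e\<close>
    from \<open>n + 1\<close> on, against its value there being below \<open>e\<close>.\<close>
  then have "\<not> N \<le> n" using e'(2)[of "Suc n"] flat(2) by auto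
  then show ?thesis using N(2) e'(2)[of N] \<open>e = e'\<close> by simp
qed

end
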